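(* Suppose that $\Omega$ is a minimal and uniquely ergodic space of aperiodic tilings of $\mathbb{R}^d$, that $\Omega'$ is a space of tilings of $\mathbb{R}^d$ (no finite local complexity is assumed for either), and that $h:\Omega\to\Omega'$ is an orbit equivalence. Then there exist a tiling space $\Omega''$ and homeomorphisms $\tau_s:\Omega\to\Omega$, $h_{sc}:\Omega\to\Omega''$ and $\phi:\Omega'\to\Omega''$ such that: (1) $\phi\circ h=h_{sc}\circ\tau_s$, or equivalently $h=\phi^{-1}\circ h_{sc}\circ\tau_s$; (2) $\tau_s$ is a quasi-translation; (3) $h_{sc}$ is a shape change transformation; (4) $\phi$ is a topological conjugacy.
   Context: **Tiling spaces.** A tile is a convex polytope in $\mathbb{R}^d$ with non-empty interior, possibly carrying a label in a compact metric space; the set of prototiles (tiles up to translation) is compact. A tiling is a collection of tiles covering $\mathbb{R}^d$, any two of which meet only along their boundaries. A Delone set is a uniformly discrete and relatively dense subset of $\mathbb{R}^d$, possibly with labels in a compact metric space. Tilings and labelled Delone sets are used interchangeably. $\mathbb{R}^d$ acts by translation, $T\mapsto T-x$. Two tilings (Delone sets) are $\varepsilon$-close if on a ball of radius about $1/\varepsilon$ around the origin there is a one-to-one correspondence between their tiles (points), corresponding tiles being $\varepsilon$-close in Hausdorff distance (points being $\varepsilon$-close) with $\varepsilon$-close labels. A tiling space is a compact translation-invariant set of tilings (or labelled Delone sets), such as the orbit closure of a tiling. It is minimal if every $\mathbb{R}^d$-orbit is dense, aperiodic if $T-x=T$ implies $x=0$ for each of its elements $T$, uniquely ergodic if it carries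 exactly one translation-invariant Borel probability measure. **Maps.** An orbit equivalence is a homeomorphism sending $\mathbb{R}^d$-orbits to $\mathbb{R}^d$-orbits. A topological conjugacy is a homeomorphism $\phi$ with $\phi(T-x)=\phi(T)-x$ for all $T,x$. A quasi-translation is a map $\tau_s:\Omega\to\Omega$ of the form $\tau_s(T)=T-s(T)$ with $s:\Omega\to\mathbb{R}^d$ continuous (hence homotopic to the identity). **Shape change transformation (general case).** Let $\Omega$ be a minimal tiling space and $T\in\Omega$ a tiling with a vertex at $0$; let $\Lambda$ be its vertex set (or an associated Delone set). A function $f$ on $\mathbb{R}^d$ is weakly pattern-equivariant (PE) with respect to $T$ if there is a continuous $F$ on $\Omega$ with $f(x)=F(T-x)$; a smooth $\mathbb{R}^d$-valued 1-form on $\mathbb{R}^d$ is weakly PE if its coefficients and all their partial derivatives are weakly PE. Let $\omega$ be a closed weakly PE $\mathbb{R}^d$-valued 1-form, let $A(x)=\int_0^x\omega$, and suppose $A:\mathbb{R}^d\to\mathbb{R}^d$ is a homeomorphism. Label each $p\in\Lambda$ by $T-p$ (a point of a transversal of $\Omega$). Let $\Lambda'$ be obtained by moving each $p\in\Lambda$ to $A(p)$, keeping its label; view $\Lambda'$ as (the vertex set of) a new tiling $T'$, and let $\Omega''$ be the orbit closure of $T'$. The map $h_\omega(T-x)=T'-A(x)$ extends to a homeomorphism $h_\omega:\Omega\to\Omega''$, called the shape change transformation associated to $\omega$. *)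

theory Defs
  imports "HOL-Probability.Probability"
begin

section \<open>Tilings and labelled Delone sets\<close>

text \<open>
  Tilings and labelled Delone sets are used interchangeably, so both are encoded by one type: a set
  of labelled closed subsets of space. In a tiling these sets are polytopes; a labelled Delone set
  has the singleton \<open>{p}\<close> in place of the point \<open>p\<close>. The Hausdorff distance of two singletons is
  the distance of the points, so one notion of closeness serves both cases.

  Labels live in a compact metric space given by a carrier \<open>L\<close> and a metric \<open>dl\<close>, as in the
  library locale \<open>Metric_space\<close>. A type class would not do: below, the points of one tiling space
  become the labels of another.
\<close>

type_synonym ('v, 'l) tile = "'v set \<times> 'l"
type_synonym ('v, 'l) tiling = "('v, 'l) tile set"

definition is_tile :: "'l set \<Rightarrow> ('v::euclidean_space, 'l) tile \<Rightarrow> bool" where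
  "is_tile L t \<longleftrightarrow> polytope (fst t) \<and> interior (fst t) \<noteq> {} \<and> snd t \<in> L"

definition is_tiling :: "'l set \<Rightarrow> ('v::euclidean_space, 'l) tiling \<Rightarrow> bool" where
  "is_tiling L T \<longleftrightarrow>
     (\<forall>t\<in>T. is_tile L t) \<and> (\<Union>t\<in>T. fst t) = UNIV \<and>
     (\<forall>t\<in>T. \<forall>s\<in>T. t \<noteq> s \<longrightarrow> fst t \<inter> fst s \<subseteq> frontier (fst t) \<inter> frontier (fst s))"

definition relatively_dense :: "'v::euclidean_space set \<Rightarrow> bool" where
  "relatively_dense X \<longleftrightarrow> (\<exists>R. \<forall>x. \<exists>p\<in>X. dist x p \<le> R)"

definition delone :: "'v::euclidean_space set \<Rightarrow> bool" where
  "delone X \<longleftrightarrow> uniform_discrete X \<and> relatively_dense X"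

definition labelled_points :: "'v set \<Rightarrow> ('v \<Rightarrow> 'l) \<Rightarrow> ('v, 'l) tiling" where
  "labelled_points X lab = (\<lambda>p. ({p}, lab p)) ` X"

definition is_labelled_delone :: "'l set \<Rightarrow> ('v::euclidean_space, 'l) tiling \<Rightarrow> bool" where
  "is_labelled_delone L T \<longleftrightarrow> (\<exists>X lab. delone X \<and> lab ` X \<subseteq> L \<and> T = labelled_points X lab)"

text \<open>A point \<open>p\<close> of a labelled Delone set is the one extreme point of \<open>{p}\<close>.\<close>

definition vertices :: "('v::euclidean_space, 'l) tiling \<Rightarrow> 'v set" where
  "vertices T = {v. \<exists>t\<in>T. v extreme_point_of fst t}"

definition translate_tile :: "'v::euclidean_space \<Rightarrow> ('v, 'l) tile \<Rightarrow> ('v, 'l) tile" where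
  "translate_tile x t = ((\<lambda>y. y - x) ` fst t, snd t)"

text \<open>\<open>translate x T\<close> is \<open>T - x\<close>.\<close>

definition translate :: "'v::euclidean_space \<Rightarrow> ('v, 'l) tiling \<Rightarrow> ('v, 'l) tiling" where
  "translate x T = translate_tile x ` T"

definition orbit :: "('v::euclidean_space, 'l) tiling \<Rightarrow> ('v, 'l) tiling set" where
  "orbit T = range (\<lambda>x. translate x T)"


section \<open>The tiling topology\<close>

definition hausdorff_dist :: "'v::euclidean_space set \<Rightarrow> 'v set \<Rightarrow> real" where
  "hausdorff_dist A B =
     Inf {e. 0 \<le> e \<and> (\<forall>a\<in>A. \<exists>b\<in>B. dist a b \<le> e) \<and> (\<forall>b\<in>B. \<exists>a\<in>A. dist a b \<le> e)}"

definition tile_dist ::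
    "('l \<Rightarrow> 'l \<Rightarrow> real) \<Rightarrow> ('v::euclidean_space, 'l) tile \<Rightarrow> ('v, 'l) tile \<Rightarrow> real" where
  "tile_dist dl t s = max (hausdorff_dist (fst t) (fst s)) (dl (snd t) (snd s))"

text \<open>
  The correspondence \<open>f\<close> must cover all tiles meeting the ball of radius \<open>1/\<epsilon>\<close>, on either side; it
  may involve further tiles. This makes precise ``on a ball of radius about \<open>1/\<epsilon>\<close>'' for
  tiles that cross the boundary of the ball.
\<close>

definition tiling_close ::
    "('l \<Rightarrow> 'l \<Rightarrow> real) \<Rightarrow> real \<Rightarrow> ('v::euclidean_space, 'l) tiling \<Rightarrow> ('v, 'l) tiling \<Rightarrow> bool" where
  "tiling_close dl \<epsilon> T S \<longleftrightarrow>
     (\<exists>T0 S0 f. T0 \<subseteq> T \<and> S0 \<subseteq> S \<and> bij_betw f T0 S0 \<and>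
        {t\<in>T. fst t \<inter> cball 0 (1 / \<epsilon>) \<noteq> {}} \<subseteq> T0 \<and>
        {s\<in>S. fst s \<inter> cball 0 (1 / \<epsilon>) \<noteq> {}} \<subseteq> S0 \<and>
        (\<forall>t\<in>T0. tile_dist dl t (f t) < \<epsilon>))"

text \<open>The cut-off at \<open>1\<close> is what makes the triangle inequality hold.\<close>

definition tiling_dist ::
    "('l \<Rightarrow> 'l \<Rightarrow> real) \<Rightarrow> ('v::euclidean_space, 'l) tiling \<Rightarrow> ('v, 'l) tiling \<Rightarrow> real" where
  "tiling_dist dl T S = Inf (insert 1 {\<epsilon>. 0 < \<epsilon> \<and> tiling_close dl \<epsilon> T S})"

definition all_tilings :: "'l set \<Rightarrow> ('v::euclidean_space, 'l) tiling set" where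
  "all_tilings L = {T. is_tiling L T \<or> is_labelled_delone L T}"

definition tiling_topology ::
    "'l set \<Rightarrow> ('l \<Rightarrow> 'l \<Rightarrow> real) \<Rightarrow> ('v::euclidean_space, 'l) tiling topology" where
  "tiling_topology L dl = Metric_space.mtopology (all_tilings L) (tiling_dist dl)"


section \<open>Tiling spaces\<close>

definition compact_metric :: "'a set \<Rightarrow> ('a \<Rightarrow> 'a \<Rightarrow> real) \<Rightarrow> bool" where
  "compact_metric M d \<longleftrightarrow> Metric_space M d \<and> compact_space (Metric_space.mtopology M d)"

text \<open>
  \<open>P\<close> is a compact set of tiles containing a representative of each prototile.
\<close>

definition compact_prototiles ::
    "'l set \<Rightarrow> ('l \<Rightarrow> 'l \<Rightarrow> real) \<Rightarrow> ('v::euclidean_space, 'l) tiling set \<Rightarrow> bool" where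
  "compact_prototiles L dl \<Omega> \<longleftrightarrow>
     (\<exists>P. (\<forall>t\<in>P. is_tile L t) \<and> compact_metric P (tile_dist dl) \<and>
          (\<forall>T\<in>\<Omega>. \<forall>t\<in>T. \<exists>p\<in>P. \<exists>x. t = translate_tile x p))"

definition tiling_space ::
    "'l set \<Rightarrow> ('l \<Rightarrow> 'l \<Rightarrow> real) \<Rightarrow> ('v::euclidean_space, 'l) tiling set \<Rightarrow> bool" where
  "tiling_space L dl \<Omega> \<longleftrightarrow>
     compact_metric L dl \<and>
     ((\<forall>T\<in>\<Omega>. is_tiling L T) \<and> compact_prototiles L dl \<Omega> \<or> (\<forall>T\<in>\<Omega>. is_labelled_delone L T)) \<and>
     (\<forall>T\<in>\<Omega>. \<forall>x. translate x T \<in> \<Omega>) \<and>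
     compactin (tiling_topology L dl) \<Omega>"

definition space_topology ::
    "'l set \<Rightarrow> ('l \<Rightarrow> 'l \<Rightarrow> real) \<Rightarrow> ('v::euclidean_space, 'l) tiling set \<Rightarrow> ('v, 'l) tiling topology" where
  "space_topology L dl \<Omega> = subtopology (tiling_topology L dl) \<Omega>"

definition minimal ::
    "'l set \<Rightarrow> ('l \<Rightarrow> 'l \<Rightarrow> real) \<Rightarrow> ('v::euclidean_space, 'l) tiling set \<Rightarrow> bool" where
  "minimal L dl \<Omega> \<longleftrightarrow> (\<forall>T\<in>\<Omega>. space_topology L dl \<Omega> closure_of orbit T = \<Omega>)"

definition aperiodic :: "('v::euclidean_space, 'l) tiling set \<Rightarrow> bool" where
  "aperiodic \<Omega> \<longleftrightarrow> (\<forall>T\<in>\<Omega>. \<forall>x. translate x T = T \<longrightarrow> x = 0)"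

definition invariant_prob_measure ::
    "'l set \<Rightarrow> ('l \<Rightarrow> 'l \<Rightarrow> real) \<Rightarrow> ('v::euclidean_space, 'l) tiling set \<Rightarrow>
     ('v, 'l) tiling measure \<Rightarrow> bool" where
  "invariant_prob_measure L dl \<Omega> M \<longleftrightarrow>
     space M = \<Omega> \<and> sets M = sigma_sets \<Omega> {U. openin (space_topology L dl \<Omega>) U} \<and>
     prob_space M \<and> (\<forall>x. \<forall>B\<in>sets M. emeasure M (translate x ` B) = emeasure M B)"

definition uniquely_ergodic ::
    "'l set \<Rightarrow> ('l \<Rightarrow> 'l \<Rightarrow> real) \<Rightarrow> ('v::euclidean_space, 'l) tiling set \<Rightarrow> bool" where
  "uniquely_ergodic L dl \<Omega> \<longleftrightarrow> (\<exists>!M. invariant_prob_measure L dl \<Omega> M)"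


section \<open>Maps between tiling spaces\<close>

definition orbit_equivalence ::
    "'l set \<Rightarrow> ('l \<Rightarrow> 'l \<Rightarrow> real) \<Rightarrow> ('v::euclidean_space, 'l) tiling set \<Rightarrow>
     'm set \<Rightarrow> ('m \<Rightarrow> 'm \<Rightarrow> real) \<Rightarrow> ('v, 'm) tiling set \<Rightarrow>
     (('v, 'l) tiling \<Rightarrow> ('v, 'm) tiling) \<Rightarrow> bool" where
  "orbit_equivalence L dl \<Omega> L' dl' \<Omega>' h \<longleftrightarrow>
     homeomorphic_map (space_topology L dl \<Omega>) (space_topology L' dl' \<Omega>') h \<and>
     (\<forall>T\<in>\<Omega>. h ` orbit T = orbit (h T))"

definition topological_conjugacy ::
    "'l set \<Rightarrow> ('l \<Rightarrow> 'l \<Rightarrow> real) \<Rightarrow> ('v::euclidean_space, 'l) tiling set \<Rightarrow>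
     'm set \<Rightarrow> ('m \<Rightarrow> 'm \<Rightarrow> real) \<Rightarrow> ('v, 'm) tiling set \<Rightarrow>
     (('v, 'l) tiling \<Rightarrow> ('v, 'm) tiling) \<Rightarrow> bool" where
  "topological_conjugacy L dl \<Omega> L' dl' \<Omega>' \<phi> \<longleftrightarrow>
     homeomorphic_map (space_topology L dl \<Omega>) (space_topology L' dl' \<Omega>') \<phi> \<and>
     (\<forall>T\<in>\<Omega>. \<forall>x. \<phi> (translate x T) = translate x (\<phi> T))"

definition quasi_translation ::
    "'l set \<Rightarrow> ('l \<Rightarrow> 'l \<Rightarrow> real) \<Rightarrow> ('v::euclidean_space, 'l) tiling set \<Rightarrow>
     (('v, 'l) tiling \<Rightarrow> ('v, 'l) tiling) \<Rightarrow> bool" where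
  "quasi_translation L dl \<Omega> \<tau> \<longleftrightarrow>
     (\<exists>s. continuous_map (space_topology L dl \<Omega>) euclidean s \<and> (\<forall>T\<in>\<Omega>. \<tau> T = translate (s T) T))"


section \<open>Shape changes\<close>

definition weakly_pe ::
    "'l set \<Rightarrow> ('l \<Rightarrow> 'l \<Rightarrow> real) \<Rightarrow> ('v::euclidean_space, 'l) tiling set \<Rightarrow> ('v, 'l) tiling \<Rightarrow>
     ('v \<Rightarrow> real) \<Rightarrow> bool" where
  "weakly_pe L dl \<Omega> T f \<longleftrightarrow>
     (\<exists>F. continuous_map (space_topology L dl \<Omega>) euclideanreal F \<and> (\<forall>x. f x = F (translate x T)))"

definition partial :: "'n::finite \<Rightarrow> (real^'n \<Rightarrow> real) \<Rightarrow> real^'n \<Rightarrow> real" where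
  "partial j f x = frechet_derivative f (at x) (axis j 1)"

definition smooth :: "(real^'n::finite \<Rightarrow> real) \<Rightarrow> bool" where
  "smooth f \<longleftrightarrow> (\<forall>js. foldr partial js f differentiable_on UNIV)"

text \<open>
  An \<open>\<real>\<^sup>d\<close>-valued 1-form on \<open>\<real>\<^sup>d\<close> is given by its matrix of coefficients: \<open>\<omega> x $ i $ j\<close> is the
  coefficient of \<open>dx\<^sub>j\<close> in the \<open>i\<close>-th component.
\<close>

definition smooth_weakly_pe_form ::
    "'l set \<Rightarrow> ('l \<Rightarrow> 'l \<Rightarrow> real) \<Rightarrow> (real^'n::finite, 'l) tiling set \<Rightarrow> (real^'n, 'l) tiling \<Rightarrow>
     (real^'n \<Rightarrow> real^'n^'n) \<Rightarrow> bool" where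
  "smooth_weakly_pe_form L dl \<Omega> T \<omega> \<longleftrightarrow>
     (\<forall>i j. smooth (\<lambda>x. \<omega> x $ i $ j) \<and>
            (\<forall>js. weakly_pe L dl \<Omega> T (foldr partial js (\<lambda>x. \<omega> x $ i $ j))))"

definition closed_form :: "(real^'n::finite \<Rightarrow> real^'n^'n) \<Rightarrow> bool" where
  "closed_form \<omega> \<longleftrightarrow>
     (\<forall>x i j k. partial k (\<lambda>y. \<omega> y $ i $ j) x = partial j (\<lambda>y. \<omega> y $ i $ k) x)"

text \<open>The integral of \<open>\<omega>\<close> from \<open>0\<close> to \<open>x\<close>, along the straight segment; for closed \<open>\<omega>\<close> the path is irrelevant.\<close>

definition form_integral :: "(real^'n::finite \<Rightarrow> real^'n^'n) \<Rightarrow> real^'n \<Rightarrow> real^'n" where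
  "form_integral \<omega> x = integral {0..1} (\<lambda>t. \<omega> (t *\<^sub>R x) *v x)"

text \<open>
  A Delone set associated to \<open>T \<in> \<Omega>\<close>: the value at \<open>T\<close> of a continuous, translation-equivariant
  assignment of (unlabelled) Delone sets to the elements of \<open>\<Omega>\<close>. Without finite local complexity the
  vertex set of a tiling need not be uniformly discrete, so this alternative is needed.
\<close>

definition associated_delone ::
    "'l set \<Rightarrow> ('l \<Rightarrow> 'l \<Rightarrow> real) \<Rightarrow> ('v::euclidean_space, 'l) tiling set \<Rightarrow> ('v, 'l) tiling \<Rightarrow>
     'v set \<Rightarrow> bool" where
  "associated_delone L dl \<Omega> T \<Lambda> \<longleftrightarrow>
     (\<exists>D. (\<forall>S\<in>\<Omega>. delone (D S)) \<and>
          continuous_map (space_topology L dl \<Omega>) (tiling_topology UNIV (\<lambda>_ _. 0))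
            (\<lambda>S. labelled_points (D S) (\<lambda>_. ())) \<and>
          (\<forall>S\<in>\<Omega>. \<forall>x. D (translate x S) = (\<lambda>y. y - x) ` D S) \<and>
          D T = \<Lambda>)"

text \<open>
  The moved set \<open>T'\<close> carries labels in \<open>\<Omega>\<close> with its tiling metric; the labels that occur are the
  \<open>T - p\<close> with \<open>p \<in> \<Lambda>\<close>.
\<close>

definition moved_tiling ::
    "(real^'n::finite, 'l) tiling \<Rightarrow> (real^'n) set \<Rightarrow> (real^'n \<Rightarrow> real^'n) \<Rightarrow>
     (real^'n, (real^'n, 'l) tiling) tiling" where
  "moved_tiling T \<Lambda> A = (\<lambda>p. ({A p}, translate p T)) ` \<Lambda>"

definition shape_change ::
    "'l set \<Rightarrow> ('l \<Rightarrow> 'l \<Rightarrow> real) \<Rightarrow> (real^'n::finite, 'l) tiling set \<Rightarrow>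
     (real^'n, (real^'n, 'l) tiling) tiling set \<Rightarrow>
     ((real^'n, 'l) tiling \<Rightarrow> (real^'n, (real^'n, 'l) tiling) tiling) \<Rightarrow> bool" where
  "shape_change L dl \<Omega> \<Omega>'' h \<longleftrightarrow>
     (\<exists>T\<in>\<Omega>. \<exists>\<Lambda> \<omega>.
        0 \<in> \<Lambda> \<and> delone \<Lambda> \<and> (\<Lambda> = vertices T \<or> associated_delone L dl \<Omega> T \<Lambda>) \<and>
        smooth_weakly_pe_form L dl \<Omega> T \<omega> \<and> closed_form \<omega> \<and>
        homeomorphic_map euclidean euclidean (form_integral \<omega>) \<and>
        (let T' = moved_tiling T \<Lambda> (form_integral \<omega>) in
           is_labelled_delone \<Omega> T' \<and>
           \<Omega>'' = tiling_topology \<Omega> (tiling_dist dl) closure_of orbit T' \<and>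
           homeomorphic_map (space_topology L dl \<Omega>) (space_topology \<Omega> (tiling_dist dl) \<Omega>'') h \<and>
           (\<forall>x. h (translate x T) = translate (form_integral \<omega> x) T')))"


section \<open>The tiling metric is a metric\<close>

lemma hausdorff_dist_commute: "hausdorff_dist A B = hausdorff_dist B A"
  unfolding hausdorff_dist_def by (simp add: conj_commute dist_commute)

lemma hausdorff_dist_le:
  assumes "0 \<le> e" "\<And>a. a \<in> A \<Longrightarrow> \<exists>b\<in>B. dist a b \<le> e" "\<And>b. b \<in> B \<Longrightarrow> \<exists>a\<in>A. dist a b \<le> e"
  shows "hausdorff_dist A B \<le> e"
  unfolding hausdorff_dist_def by (rule cInf_lower) (use assms in \<open>auto intro!: bdd_belowI[of _ 0]\<close>)

lemma hausdorff_dist_lessD: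
  assumes "A \<noteq> {}" "B \<noteq> {}" "bounded A" "bounded B" "hausdorff_dist A B < e"
  shows "0 < e" "a \<in> A \<Longrightarrow> \<exists>b\<in>B. dist a b < e" "b \<in> B \<Longrightarrow> \<exists>a\<in>A. dist a b < e"
proof -
  let ?E = "{e. 0 \<le> e \<and> (\<forall>a\<in>A. \<exists>b\<in>B. dist a b \<le> e) \<and> (\<forall>b\<in>B. \<exists>a\<in>A. dist a b \<le> e)}"
  have "bounded (A \<union> B)" using assms by simp
  then obtain K where K: "\<And>x y. x \<in> A \<union> B \<Longrightarrow> y \<in> A \<union> B \<Longrightarrow> dist x y \<le> K"
    using bounded_two_points by metis
  have "0 \<le> K" using assms(1) K by (metis UnI1 all_not_in_conv dist_self)
  then have "K \<in> ?E" using K assms(1,2) by fastforce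
  then obtain e' where e': "e' \<in> ?E" "e' < e"
    using cInf_lessD[of ?E e] assms(5) unfolding hausdorff_dist_def by blast
  show "0 < e" using e' by simp
  show "a \<in> A \<Longrightarrow> \<exists>b\<in>B. dist a b < e" "b \<in> B \<Longrightarrow> \<exists>a\<in>A. dist a b < e"
    using e' le_less_trans by (blast, blast)
qed

lemma hausdorff_dist_triangle_less:
  assumes "A \<noteq> {}" "B \<noteq> {}" "C \<noteq> {}" "bounded A" "bounded B" "bounded C"
    and "hausdorff_dist A B < e" "hausdorff_dist B C < e'"
  shows "hausdorff_dist A C < e + e'"
proof -
  obtain e1 where e1: "hausdorff_dist A B < e1" "e1 < e" using assms(7) dense by blast
  note 1 = hausdorff_dist_lessD[OF assms(1,2,4,5) e1(1)]
  note 2 = hausdorff_dist_lessD[OF assms(2,3,5,6,8)]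
  have "hausdorff_dist A C \<le> e1 + e'"
  proof (rule hausdorff_dist_le)
    show "0 \<le> e1 + e'" using 1(1) 2(1) by simp
    fix a assume "a \<in> A"
    then obtain b where b: "b \<in> B" "dist a b < e1" using 1(2) by blast
    then obtain c where "c \<in> C" "dist b c < e'" using 2(2) by blast
    then show "\<exists>c\<in>C. dist a c \<le> e1 + e'" using b dist_triangle[of a c b] by force
  next
    fix c assume "c \<in> C"
    then obtain b where b: "b \<in> B" "dist b c < e'" using 2(3) by blast
    then obtain a where "a \<in> A" "dist a b < e1" using 1(3) by blast
    then show "\<exists>a\<in>A. dist a c \<le> e1 + e'" using b dist_triangle[of a c b] by force
  qed
  then show ?thesis using e1 by simp
qed

lemma interior_of_close_convex:
  fixes C :: "'v::euclidean_space set"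
  assumes C: "convex C" "closed C" and A: "ball x r \<subseteq> A" "0 < r"
    and close: "\<And>a. a \<in> A \<Longrightarrow> \<exists>c\<in>C. dist a c < r/2"
  shows "x \<in> interior C"
proof -
  have "ball x (r/2) \<subseteq> C"
  proof (rule ccontr)
    assume "\<not> ball x (r/2) \<subseteq> C"
    then obtain y where y: "dist x y < r/2" "y \<notin> C" unfolding subset_iff mem_ball by blast
    obtain a b where ab: "inner a y < b" "\<forall>c\<in>C. b < inner a c"
      using separating_hyperplane_closed_point[OF C y(2)] by blast
    have "x \<in> A" using A by auto
    then have "C \<noteq> {}" using close by blast
    then have a0: "a \<noteq> 0" using ab by auto
    define u where "u = y - (r/2 / norm a) *\<^sub>R a"
    have "dist y u = r/2" using a0 A(2) by (simp add: u_def dist_norm)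
    then have "dist x u < r" using y(1) dist_triangle[of x u y] by simp
    then have "u \<in> A" using A by auto
    then obtain c where c: "c \<in> C" "dist u c < r/2" using close by blast
    have "inner a (c - u) \<le> norm a * norm (c - u)" by (rule norm_cauchy_schwarz)
    also have "\<dots> \<le> norm a * (r/2)"
      using c(2) by (intro mult_left_mono) (auto simp: dist_norm norm_minus_commute)
    finally have "inner a c \<le> inner a u + norm a * (r/2)" by (simp add: inner_diff_right)
    also have "inner a u = inner a y - norm a * (r/2)"
      using a0 by (simp add: u_def inner_diff_right dot_square_norm power2_eq_square)
    finally show False using ab c(1) by force
  qed
  then show ?thesis using A(2) by (auto simp: interior_def intro!: exI[of _ "ball x (r/2)"])
qed

definition regular_tile :: "'l set \<Rightarrow> ('v::euclidean_space, 'l) tile \<Rightarrow> bool" where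
  "regular_tile L t \<longleftrightarrow> fst t \<noteq> {} \<and> compact (fst t) \<and> snd t \<in> L"

lemma regular_tile_all_tilings:
  "T \<in> all_tilings L \<Longrightarrow> t \<in> T \<Longrightarrow> regular_tile L t"
  by (auto simp: all_tilings_def is_tiling_def is_tile_def is_labelled_delone_def
      labelled_points_def regular_tile_def polytope_imp_compact)

context
  fixes L :: "'l set" and dl :: "'l \<Rightarrow> 'l \<Rightarrow> real"
  assumes L: "Metric_space L dl"
begin

interpretation L: Metric_space L dl by (rule L)

lemma tile_dist_commute: "tile_dist dl t s = tile_dist dl s t"
  by (simp add: tile_dist_def hausdorff_dist_commute L.commute)

lemma tile_dist_refl:
  assumes "regular_tile L t" shows "tile_dist dl t t = 0"
proof -
  have "hausdorff_dist (fst t) (fst t) \<le> 0" by (rule hausdorff_dist_le) auto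
  then show ?thesis using assms by (simp add: tile_dist_def regular_tile_def)
qed

lemma tile_dist_triangle_less:
  assumes "regular_tile L t" "regular_tile L s" "regular_tile L r"
    and "tile_dist dl t s < a" "tile_dist dl s r < b"
  shows "tile_dist dl t r < a + b"
proof -
  have "hausdorff_dist (fst t) (fst r) < a + b"
    using assms by (intro hausdorff_dist_triangle_less[of _ "fst s"])
      (auto simp: regular_tile_def tile_dist_def compact_imp_bounded)
  moreover have "dl (snd t) (snd r) \<le> dl (snd t) (snd s) + dl (snd s) (snd r)"
    using assms by (intro L.triangle) (auto simp: regular_tile_def)
  ultimately show ?thesis using assms(4,5) by (simp add: tile_dist_def)
qed

lemma tile_dist_lessD:
  assumes "regular_tile L t" "regular_tile L s" "tile_dist dl t s < e"
  shows "x \<in> fst t \<Longrightarrow> \<exists>y\<in>fst s. dist x y < e" "y \<in> fst s \<Longrightarrow> \<exists>x\<in>fst t. dist x y < e"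
    "dl (snd t) (snd s) < e"
  using assms hausdorff_dist_lessD[of "fst t" "fst s" e]
  by (auto simp: regular_tile_def tile_dist_def compact_imp_bounded)

lemma tile_eqI:
  assumes "regular_tile L t" "regular_tile L s" "\<And>e. 0 < e \<Longrightarrow> tile_dist dl t s < e"
  shows "t = s"
proof -
  have "x \<in> fst s" if "x \<in> fst t" for x
  proof (rule closed_approachable[THEN iffD1, rule_format])
    show "closed (fst s)" using assms by (simp add: regular_tile_def compact_imp_closed)
    show "\<exists>y\<in>fst s. dist y x < e" if "0 < e" for e
      using tile_dist_lessD(1)[OF assms(1,2) assms(3)[OF that] \<open>x \<in> fst t\<close>] by (simp add: dist_commute)
  qed
  moreover have "x \<in> fst t" if "x \<in> fst s" for x
  proof (rule closed_approachable[THEN iffD1, rule_format])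
    show "closed (fst t)" using assms by (simp add: regular_tile_def compact_imp_closed)
    show "\<exists>y\<in>fst t. dist y x < e" if "0 < e" for e
      using tile_dist_lessD(2)[OF assms(1,2) assms(3)[OF that] \<open>x \<in> fst s\<close>] .
  qed
  ultimately have "fst t = fst s" by blast
  moreover have "dl (snd t) (snd s) \<le> 0"
    using tile_dist_lessD(3)[OF assms(1,2)] assms(3) by (meson not_less less_irrefl)
  then have "snd t = snd s"
    using assms(1,2) by (metis L.nonneg L.zero order_antisym regular_tile_def)
  ultimately show ?thesis by (simp add: prod_eq_iff)
qed

lemma tiling_close_commute_imp:
  assumes "tiling_close dl e T S" shows "tiling_close dl e S T"
proof -
  obtain T0 S0 f where f: "T0 \<subseteq> T" "S0 \<subseteq> S" "bij_betw f T0 S0"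
    "{t\<in>T. fst t \<inter> cball 0 (1 / e) \<noteq> {}} \<subseteq> T0" "{s\<in>S. fst s \<inter> cball 0 (1 / e) \<noteq> {}} \<subseteq> S0"
    "\<forall>t\<in>T0. tile_dist dl t (f t) < e"
    using assms unfolding tiling_close_def by blast
  have "\<forall>s\<in>S0. tile_dist dl s (inv_into T0 f s) < e"
  proof
    fix s assume "s \<in> S0"
    then have "f (inv_into T0 f s) = s" "inv_into T0 f s \<in> T0"
      using f(3) by (auto simp: bij_betw_inv_into_right bij_betw_imp_surj_on intro: inv_into_into)
    then show "tile_dist dl s (inv_into T0 f s) < e"
      using f(6) tile_dist_commute[of s "inv_into T0 f s"] by force
  qed
  then show ?thesis
    unfolding tiling_close_def
    by (intro exI[of _ S0] exI[of _ T0] exI[of _ "inv_into T0 f"] conjI f bij_betw_inv_into)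
qed

lemma tiling_dist_commute: "tiling_dist dl T S = tiling_dist dl S T"
proof -
  have "tiling_close dl e T S \<longleftrightarrow> tiling_close dl e S T" for e
    using tiling_close_commute_imp by blast
  then show ?thesis by (simp add: tiling_dist_def)
qed

lemma tiling_close_mono:
  fixes T S :: "('a::euclidean_space, 'l) tiling"
  assumes "tiling_close dl a T S" "0 < a" "a \<le> b" shows "tiling_close dl b T S"
proof -
  have "cball 0 (1 / b) \<subseteq> (cball 0 (1 / a) :: 'a set)"
    using assms by (intro subset_cball) (simp add: frac_le)
  then have sub: "{t\<in>U. fst t \<inter> cball 0 (1 / b) \<noteq> {}} \<subseteq> {t\<in>U. fst t \<inter> cball 0 (1 / a) \<noteq> {}}"
    for U :: "('a, 'l) tiling"
    by blast
  obtain T0 S0 f where f: "T0 \<subseteq> T" "S0 \<subseteq> S" "bij_betw f T0 S0"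
    "{t\<in>T. fst t \<inter> cball 0 (1 / a) \<noteq> {}} \<subseteq> T0" "{s\<in>S. fst s \<inter> cball 0 (1 / a) \<noteq> {}} \<subseteq> S0"
    "\<forall>t\<in>T0. tile_dist dl t (f t) < a"
    using assms(1) unfolding tiling_close_def by blast
  have "\<forall>t\<in>T0. tile_dist dl t (f t) < b" using f(6) assms(3) by force
  then show ?thesis
    unfolding tiling_close_def
    by (intro exI[of _ T0] exI[of _ S0] exI[of _ f] conjI f(1-3) order_trans[OF sub] f(4,5))
qed

lemma tiling_close_refl:
  assumes "T \<in> all_tilings L" "0 < e" shows "tiling_close dl e T T"
proof -
  have "\<forall>t\<in>T. tile_dist dl t (id t) < e"
    using assms tile_dist_refl[OF regular_tile_all_tilings] by (metis id_apply)
  then show ?thesis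
    unfolding tiling_close_def
    by (intro exI[of _ T] exI[of _ id]) (auto simp del: id_apply)
qed

lemma tiling_close_triangle:
  assumes TSR: "T \<in> all_tilings L" "S \<in> all_tilings L" "R \<in> all_tilings L"
    and close: "tiling_close dl a T S" "tiling_close dl b S R"
    and ab: "0 < a" "0 < b" "a + b \<le> 1"
  shows "tiling_close dl (a + b) T R"
proof -
  obtain T0 S0 f where f: "T0 \<subseteq> T" "S0 \<subseteq> S" "bij_betw f T0 S0"
    "{t\<in>T. fst t \<inter> cball 0 (1 / a) \<noteq> {}} \<subseteq> T0" "{s\<in>S. fst s \<inter> cball 0 (1 / a) \<noteq> {}} \<subseteq> S0"
    "\<forall>t\<in>T0. tile_dist dl t (f t) < a"
    using close(1) unfolding tiling_close_def by blast
  obtain S1 R1 g where g: "S1 \<subseteq> S" "R1 \<subseteq> R" "bij_betw g S1 R1"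
    "{s\<in>S. fst s \<inter> cball 0 (1 / b) \<noteq> {}} \<subseteq> S1" "{r\<in>R. fst r \<inter> cball 0 (1 / b) \<noteq> {}} \<subseteq> R1"
    "\<forall>s\<in>S1. tile_dist dl s (g s) < b"
    using close(2) unfolding tiling_close_def by blast
  have reg: "\<And>t. t \<in> T0 \<Longrightarrow> regular_tile L t" "\<And>t. t \<in> S \<Longrightarrow> regular_tile L t"
    "\<And>t. t \<in> R1 \<Longrightarrow> regular_tile L t"
    using TSR f(1) g(2) regular_tile_all_tilings by blast+
  have rad: "1 / (a + b) + a \<le> 1 / b" "1 / (a + b) + b \<le> 1 / a"
  proof -
    have key: "1 / (x + y) + x \<le> 1 / y" if "0 < x" "0 < y" "x + y \<le> 1" for x y :: real
    proof -
      have "y * (x + y) \<le> 1 * 1" using that by (intro mult_mono) auto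
      then have "x * (y * (x + y)) \<le> x" using that by (simp add: mult_left_le)
      then show ?thesis using that by (simp add: field_simps)
    qed
    show "1 / (a + b) + a \<le> 1 / b" "1 / (a + b) + b \<le> 1 / a"
      using key[of a b] key[of b a] ab by (simp_all add: add.commute)
  qed
  have ra: "1 / (a + b) \<le> 1 / a" and rb: "1 / (a + b) \<le> 1 / b" using ab by (simp_all add: frac_le)
  let ?M = "S0 \<inter> S1"
  let ?T = "inv_into T0 f ` ?M" and ?R = "g ` ?M"
  have bf: "bij_betw f ?T ?M"
    using f(3) by (intro bij_betw_byWitness[where f' = "inv_into T0 f"])
      (auto simp: bij_betw_inv_into_right)
  have "?T \<subseteq> T0" using f(3) by (metis bij_betw_imp_surj_on image_subsetI inv_into_into IntD1)
  have bg: "bij_betw g ?M ?R" using g(3) by (meson Int_lower2 bij_betw_subset)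
  have bij: "bij_betw (g \<circ> f) ?T ?R" using bf bg by (rule bij_betw_trans)
  have 1: "{t\<in>T. fst t \<inter> cball 0 (1 / (a + b)) \<noteq> {}} \<subseteq> ?T"
  proof
    fix t assume "t \<in> {t\<in>T. fst t \<inter> cball 0 (1 / (a + b)) \<noteq> {}}"
    then obtain x where x: "t \<in> T" "x \<in> fst t" "norm x \<le> 1 / (a + b)" by auto
    then have t: "t \<in> T0" using f(4) ra by fastforce
    then have ft: "f t \<in> S0" using f(3) bij_betwE by blast
    then obtain y where y: "y \<in> fst (f t)" "dist x y < a"
      using tile_dist_lessD(1)[of t "f t" a x] reg t f(2,6) x(2) by blast
    then have "norm y \<le> 1 / b" using rad(1) x(3) norm_triangle_ineq3[of x y] by (simp add: dist_norm)
    then have "f t \<in> S1" using g(4) y(1) ft f(2) by fastforce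
    then show "t \<in> ?T" using ft t f(3) by (metis IntI bij_betw_inv_into_left image_eqI)
  qed
  have 2: "{r\<in>R. fst r \<inter> cball 0 (1 / (a + b)) \<noteq> {}} \<subseteq> ?R"
  proof
    fix r assume "r \<in> {r\<in>R. fst r \<inter> cball 0 (1 / (a + b)) \<noteq> {}}"
    then obtain x where x: "r \<in> R" "x \<in> fst r" "norm x \<le> 1 / (a + b)" by auto
    then have r: "r \<in> R1" using g(5) rb by fastforce
    then obtain s where s: "s \<in> S1" "g s = r" using g(3) by (metis bij_betw_imp_surj_on imageE)
    then obtain y where y: "y \<in> fst s" "dist y x < b"
      using tile_dist_lessD(2)[of s r b x] reg r g(1,6) x(2) by blast
    then have "norm y \<le> 1 / a" using rad(2) x(3) norm_triangle_ineq3[of y x] by (simp add: dist_norm)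
    then have "s \<in> S0" using f(5) y(1) s g(1) by fastforce
    then show "r \<in> ?R" using s by blast
  qed
  have 3: "tile_dist dl t ((g \<circ> f) t) < a + b" if "t \<in> ?T" for t
  proof -
    have t: "t \<in> T0" and ft: "f t \<in> S0" "f t \<in> S1" using that bf \<open>?T \<subseteq> T0\<close> bij_betwE by blast+
    have "g (f t) \<in> R1" using g(3) ft bij_betwE by blast
    then show ?thesis
      using tile_dist_triangle_less[OF reg(1)[OF t] reg(2) reg(3), of "f t" "g (f t)" a b] t ft subsetD[OF f(2) ft(1)] f(6) g(6)
      by simp
  qed
  have sub: "?T \<subseteq> T" "?R \<subseteq> R"
    using \<open>?T \<subseteq> T0\<close> f(1) g(2) bij_betw_imp_surj_on[OF g(3)] by auto
  show ?thesis
    unfolding tiling_close_def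
    by (rule exI[of _ ?T], rule exI[of _ ?R], rule exI[of _ "g \<circ> f"])
      (rule conjI[OF sub(1) conjI[OF sub(2) conjI[OF bij conjI[OF 1 conjI[OF 2 ballI[OF 3]]]]]], assumption)
qed

lemma tiling_dist_less_iff:
  assumes "e \<le> 1"
  shows "tiling_dist dl T S < e \<longleftrightarrow> (\<exists>a>0. a < e \<and> tiling_close dl a T S)"
proof -
  have "tiling_dist dl T S < e \<longleftrightarrow> (\<exists>a\<in>insert 1 {a. 0 < a \<and> tiling_close dl a T S}. a < e)"
    unfolding tiling_dist_def by (rule cInf_less_iff) (auto intro!: bdd_belowI[of _ 0])
  then show ?thesis using assms by auto
qed

lemma tiling_dist_bounds: "0 \<le> tiling_dist dl T S" "tiling_dist dl T S \<le> 1"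
  unfolding tiling_dist_def
  by (auto intro!: cInf_greatest cInf_lower bdd_belowI[of _ 0])

lemma tiling_dist_zeroD:
  assumes "tiling_dist dl T S = 0" "0 < e" "t \<in> T" "fst t \<noteq> {}"
  shows "\<exists>s\<in>S. tile_dist dl t s < e"
proof -
  obtain x where x: "x \<in> fst t" using assms by blast
  define e' where "e' = min 1 (min e (1 / (norm x + 1)))"
  have n: "norm x + 1 > 0" by (smt (verit) norm_ge_zero)
  have e': "0 < e'" "e' \<le> 1" "e' \<le> e" "e' \<le> 1 / (norm x + 1)"
    using assms(2) n by (auto simp: e'_def)
  have "tiling_dist dl T S < e'" using assms(1) e' by simp
  then have "tiling_close dl e' T S"
    unfolding tiling_dist_less_iff[OF e'(2)] by (meson less_imp_le tiling_close_mono)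
  then obtain T0 S0 f where f: "S0 \<subseteq> S" "bij_betw f T0 S0"
    "{t\<in>T. fst t \<inter> cball 0 (1 / e') \<noteq> {}} \<subseteq> T0" "\<forall>t\<in>T0. tile_dist dl t (f t) < e'"
    unfolding tiling_close_def by blast
  have "e' * (norm x + 1) \<le> 1" using e'(4) n by (simp add: field_simps)
  then have "norm x \<le> 1 / e'" using e'(1) by (simp add: field_simps)
  then have "t \<in> T0" using f(3) x assms(3) by fastforce
  then show ?thesis using f e'(3) by (meson bij_betwE less_le_trans subsetD)
qed

lemma tiling_not_delone:
  assumes T: "is_tiling L T" and S: "is_labelled_delone L S" and "t \<in> T"
  shows "\<exists>e>0. \<forall>s\<in>S. e \<le> tile_dist dl t s"
proof (rule ccontr)
  assume neg: "\<not> ?thesis"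
  have t: "regular_tile L t" using T \<open>t \<in> T\<close> regular_tile_all_tilings unfolding all_tilings_def by blast
  have "interior (fst t) \<noteq> {}" using T \<open>t \<in> T\<close> by (auto simp: is_tiling_def is_tile_def)
  then obtain x r where r: "0 < r" "cball x r \<subseteq> fst t" by (meson all_not_in_conv mem_interior_cball)
  obtain b :: 'a where b: "b \<in> Basis" using nonempty_Basis by blast
  let ?y = "x + r *\<^sub>R b"
  have y: "?y \<in> fst t" "x \<in> fst t" "dist x ?y = r" using r b by (auto simp: subset_iff dist_norm)
  obtain s where s: "s \<in> S" "tile_dist dl t s < r/2" using neg r(1) by (metis half_gt_zero not_less)
  have sr: "regular_tile L s" using S s regular_tile_all_tilings unfolding all_tilings_def by blast
  obtain q where "fst s = {q}" using S s(1) by (auto simp: is_labelled_delone_def labelled_points_def)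
  then have "dist x q < r/2" "dist ?y q < r/2" using tile_dist_lessD(1)[OF t sr s(2)] y by auto
  then show False using y(3) dist_triangle2[of x ?y q] by simp
qed

lemma tiling_dist_zero_subset:
  assumes T: "T \<in> all_tilings L" and S: "S \<in> all_tilings L" and 0: "tiling_dist dl T S = 0"
  shows "T \<subseteq> S"
proof
  fix t assume t: "t \<in> T"
  note tr = regular_tile_all_tilings[OF T t] and sr = regular_tile_all_tilings[OF S]
  have near: "\<exists>s\<in>S. tile_dist dl t s < e" if "0 < e" for e
    using tiling_dist_zeroD[OF 0 that t] tr by (simp add: regular_tile_def)
  have "tiling_dist dl S T = 0"
    using 0 by (simp add: tiling_dist_commute)
  then have near': "\<exists>t\<in>T. tile_dist dl s t < e" if "0 < e" "s \<in> S" for e s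
    using tiling_dist_zeroD[OF _ that] sr[OF that(2)] by (simp add: regular_tile_def)
  have unique: "t \<in> S" if "0 < d" and *: "\<And>s s'. s \<in> S \<Longrightarrow> s' \<in> S \<Longrightarrow> tile_dist dl t s < d \<Longrightarrow>
      tile_dist dl t s' < d \<Longrightarrow> s = s'" for d
  proof -
    obtain s where s: "s \<in> S" "tile_dist dl t s < d" using near \<open>0 < d\<close> by blast
    have "tile_dist dl t s < e" if "0 < e" for e
      using near[of "min d e"] * s that \<open>0 < d\<close> by (metis min_less_iff_conj)
    then have "t = s" using tile_eqI tr sr s(1) by blast
    then show ?thesis using s(1) by simp
  qed
  consider "is_tiling L T" "is_tiling L S" | "is_labelled_delone L T" "is_labelled_delone L S"
    | "is_tiling L T" "is_labelled_delone L S" | "is_labelled_delone L T" "is_tiling L S"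
    using T S unfolding all_tilings_def by blast
  then show "t \<in> S"
  proof cases
    case 1
    have "interior (fst t) \<noteq> {}" using 1 t by (auto simp: is_tiling_def is_tile_def)
    then obtain x r where r: "0 < r" "ball x r \<subseteq> fst t" by (meson all_not_in_conv mem_interior)
    have int: "x \<in> interior (fst s)" if "s \<in> S" "tile_dist dl t s < r/2" for s
    proof (rule interior_of_close_convex[OF _ _ r(2,1)])
      show "convex (fst s)" "closed (fst s)"
        using 1 that(1) by (auto simp: is_tiling_def is_tile_def polytope_imp_convex polytope_imp_closed)
    qed (use tile_dist_lessD(1)[OF tr sr[OF that(1)] that(2)] in blast)
    show ?thesis
    proof (rule unique[of "r/2"])
      fix s s' assume s: "s \<in> S" "s' \<in> S" "tile_dist dl t s < r/2" "tile_dist dl t s' < r/2"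
      have "x \<in> interior (fst s)" "x \<in> interior (fst s')" by (rule int; fact s)+
      then have x: "x \<in> fst s \<inter> fst s'" "x \<notin> frontier (fst s)"
        using interior_subset[of "fst s"] interior_subset[of "fst s'"] by (auto simp: frontier_def)
      show "s = s'"
      proof (rule ccontr)
        assume "s \<noteq> s'"
        then have "fst s \<inter> fst s' \<subseteq> frontier (fst s) \<inter> frontier (fst s')"
          using 1(2) s(1,2) unfolding is_tiling_def by meson
        then show False using x by auto
      qed
    qed (use r in simp)
  next
    case 2
    obtain X lab where X: "delone X" "S = labelled_points X lab"
      using 2 unfolding is_labelled_delone_def by blast
    obtain e where e: "0 < e" "\<And>x y. x \<in> X \<Longrightarrow> y \<in> X \<Longrightarrow> dist x y < e \<Longrightarrow> x = y"
      using X unfolding delone_def uniform_discrete_def by blast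
    obtain p where p: "fst t = {p}" using 2 t by (auto simp: is_labelled_delone_def labelled_points_def)
    show ?thesis
    proof (rule unique[of "e/2"])
      fix s s' assume s: "s \<in> S" "s' \<in> S" "tile_dist dl t s < e/2" "tile_dist dl t s' < e/2"
      obtain q q' where q: "q \<in> X" "q' \<in> X" "s = ({q}, lab q)" "s' = ({q'}, lab q')"
        using s X by (auto simp: labelled_points_def)
      have "dist p q < e/2" "dist p q' < e/2"
        using tile_dist_lessD(1)[OF tr sr s(3)] tile_dist_lessD(1)[OF tr sr s(4)] s p q by auto
      then have "dist q q' < e" using dist_triangle3[of q q' p] by simp
      then show "s = s'" using e q by blast
    qed (use e in simp)
  next
    case 3
    then show ?thesis using tiling_not_delone[OF 3 t] near by (metis not_less)
  next
    case 4
    have "(\<Union>s\<in>S. fst s) = UNIV" using 4 by (simp add: is_tiling_def)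
    then obtain s where s: "s \<in> S" by blast
    show ?thesis using tiling_not_delone[OF 4(2,1) s] near'[OF _ s] by (metis not_less)
  qed
qed

text \<open>The next lemma justifies the use of \<open>Metric_space.mtopology\<close> in \<open>tiling_topology\<close>.\<close>

lemma Metric_space_all_tilings:
  "Metric_space (all_tilings L :: ('v::euclidean_space, 'l) tiling set) (tiling_dist dl)"
proof
  have comm: "tiling_dist dl T S = tiling_dist dl S T" for T S :: "('v, 'l) tiling"
    by (rule tiling_dist_commute)
  show "tiling_dist dl T S = tiling_dist dl S T" for T S :: "('v, 'l) tiling" by (rule comm)
  show "0 \<le> tiling_dist dl T S" for T S :: "('v, 'l) tiling" by (rule tiling_dist_bounds)
  fix T S R :: "('v, 'l) tiling"
  assume TS: "T \<in> all_tilings L" "S \<in> all_tilings L"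
  show "tiling_dist dl T S = 0 \<longleftrightarrow> T = S"
  proof
    assume 0: "tiling_dist dl T S = 0"
    then have "tiling_dist dl S T = 0" using comm[of S T] by simp
    with 0 show "T = S"
      using tiling_dist_zero_subset[OF TS] tiling_dist_zero_subset[OF TS(2,1)] by blast
  next
    assume "T = S"
    have "tiling_dist dl T S < e" if "0 < e" "e \<le> 1" for e
      unfolding tiling_dist_less_iff[OF that(2)] \<open>T = S\<close>
      using tiling_close_refl[OF TS(2)] that dense by blast
    then have "tiling_dist dl T S \<le> 0"
      by (metis tiling_dist_bounds(2) less_irrefl not_le)
    then show "tiling_dist dl T S = 0" using tiling_dist_bounds(1) by (metis order_antisym)
  qed
  assume R: "R \<in> all_tilings L"
  show "tiling_dist dl T R \<le> tiling_dist dl T S + tiling_dist dl S R"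
  proof (rule ccontr)
    assume "\<not> ?thesis"
    then obtain c where c: "tiling_dist dl T S + tiling_dist dl S R < c" "c < tiling_dist dl T R"
      using dense not_le by metis
    have c1: "c \<le> 1" using c(2) tiling_dist_bounds(2)[of T R] by simp
    define u where "u = tiling_dist dl T S + (c - tiling_dist dl T S - tiling_dist dl S R) / 2"
    have u: "tiling_dist dl T S < u" "tiling_dist dl S R < c - u" using c by (auto simp: u_def field_simps)
    have u1: "u \<le> 1" "c - u \<le> 1"
      using c1 u tiling_dist_bounds(1)[of T S] tiling_dist_bounds(1)[of S R] by auto
    obtain a b where ab: "0 < a" "a < u" "tiling_close dl a T S" "0 < b" "b < c - u" "tiling_close dl b S R"
      using u unfolding tiling_dist_less_iff[OF u1(1)] tiling_dist_less_iff[OF u1(2)] by blast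
    have "tiling_close dl (a + b) T R"
      by (rule tiling_close_triangle[OF TS R ab(3,6,1,4)]) (use ab c1 in simp)
    then have "tiling_dist dl T R < c"
      unfolding tiling_dist_less_iff[OF c1] using ab by (intro exI[of _ "a + b"]) auto
    then show False using c by simp
  qed
qed

end

end

theory Submission
  imports Defs
begin

text \<open>
An orbit equivalence \<open>h\<close> moves points along orbits by a displacement \<open>\<alpha>\<close>: \<open>h (T - u) = h T - \<alpha>(T, u)\<close>.
This displacement is a cocycle, \<open>\<alpha>(T, u + v) = \<alpha>(T, u) + \<alpha>(T - u, v)\<close>, and adding a coboundary
\<open>S(T - u) - S(T)\<close> to it corresponds to composing \<open>h\<close> with a quasi-translation. A cocycle that is
smooth in \<open>u\<close> is the integral of a closed weakly pattern-equivariant form, and if it is moreover a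
homeomorphism in \<open>u\<close>, then moving the points of a Delone set by it is a shape change. So the theorem
says that \<open>\<alpha>\<close> is cohomologous to a smooth cocycle \<open>A\<close> all of whose maps \<open>A(T, \<cdot>)\<close> are homeomorphisms.

Four points have to be settled.

The displacement exists and is continuous. For \<open>\<alpha>(T, u)\<close> to be unique, translations
must act freely on \<open>\<Omega>'\<close>, and this has to be proved. The inverse of \<open>h\<close> has a well-defined displacement because \<open>\<Omega>\<close> is
aperiodic; it is continuous by a Baire argument combined with the fact that in a compact free flow
a path on an orbit that stays close to its start in the space also stays close to it along the orbit
(\<open>continuous_cocycle_of_free_flow\<close>). Both \<open>h\<close> and its inverse stretch orbits at most linearly, so a
period in \<open>\<Omega>'\<close> would squeeze the \<open>d\<close>-dimensional orbits of \<open>\<Omega>\<close> into tubes of volume growth of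
order \<open>d - 1\<close>; counting lattice points rules this out (\<open>image_free\<close>). The same continuity theorem
then applies to \<open>h\<close> itself.

The displacement can be smoothed. Convolving \<open>\<alpha>(T, \<cdot>)\<close> with a smooth bump, or averaging it over a
cube, changes it by a coboundary only. After convolution the derivative at \<open>u\<close> is a continuous
matrix-valued function of \<open>T - u\<close>; this is the form, and closedness is the symmetry of
the second derivatives of the bump.

The smoothed displacement is a homeomorphism. After averaging over a cube, its derivative is the cube
average of a continuous function on \<open>\<Omega>\<close>. By unique ergodicity these averages converge uniformly to a
constant matrix \<open>B\<close> (\<open>uniform_cube_averages\<close>). The proof takes weak limits of empirical measures,
obtained by coding a compact metric space into the unit interval and applying Helly's
selection theorem (\<open>compact_weak_limit\<close>). Since \<open>|\<alpha>(T, u)|\<close> grows at least linearly in \<open>|u|\<close>, the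
matrix \<open>B\<close> is invertible, and a map with derivative everywhere close to \<open>B\<close> is a homeomorphism
with Lipschitz inverse (\<open>near_linear_homeomorphism\<close>).

There is a Delone set to move. In a space of tilings without finite local complexity the vertices may
accumulate, so each tile contributes one point, chosen continuously and deep inside the tile: the
minimum of a strongly convex function (\<open>center_perturb\<close>). Labelling the moved point \<open>A(T, p)\<close> by
\<open>T - p\<close> makes the map \<open>h\<^sub>s\<^sub>c\<close> injective, hence a homeomorphism onto its image \<open>\<Omega>''\<close>. Finally \<open>\<tau>(T) = T - u\<close>
with \<open>A(T, u) = - S(T)\<close>, and \<open>\<phi> = h\<^sub>s\<^sub>c \<circ> \<tau> \<circ> h\<^sup>-\<^sup>1\<close> commutes with translations because all the coboundaries cancel.

Tiling spaces are not types, so the dynamical part is carried out for compact subsets of metric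
types; a tiling space is transported there by its distances to a dense sequence.
\<close>

section \<open>Flows and their orbit cocycles\<close>

locale compact_flow =
  fixes X :: "'a::complete_space set" and act :: "'v::euclidean_space \<Rightarrow> 'a \<Rightarrow> 'a"
  assumes compact: "compact X"
    and act_in: "x \<in> X \<Longrightarrow> act v x \<in> X"
    and act_zero: "x \<in> X \<Longrightarrow> act 0 x = x"
    and act_act: "x \<in> X \<Longrightarrow> act w (act v x) = act (v + w) x"
    and act_cont: "continuous_on (X \<times> UNIV) (\<lambda>(x, v). act v x)"

definition free_on :: "'a set \<Rightarrow> ('v::zero \<Rightarrow> 'a \<Rightarrow> 'a) \<Rightarrow> bool" where
  "free_on X act \<longleftrightarrow> (\<forall>x\<in>X. \<forall>v. act v x = x \<longrightarrow> v = 0)"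

definition minimal_on :: "'a::topological_space set \<Rightarrow> ('v \<Rightarrow> 'a \<Rightarrow> 'a) \<Rightarrow> bool" where
  "minimal_on X act \<longleftrightarrow> (\<forall>x\<in>X. X \<subseteq> closure (range (\<lambda>v. act v x)))"

text \<open>
Continuity of displacements is always proved in this way: the closed graph supplies uniqueness of the
cluster point, and the real work is in the boundedness.
\<close>

lemma bounded_unique_cluster:
  fixes f :: "nat \<Rightarrow> 'v::euclidean_space"
  assumes bdd: "bounded (range f)"
    and uniq: "\<And>r l'. strict_mono (r :: nat \<Rightarrow> nat) \<Longrightarrow> (f \<circ> r) \<longlonglongrightarrow> l' \<Longrightarrow> l' = l"
  shows "f \<longlonglongrightarrow> l"
proof (rule ccontr)
  assume "\<not> f \<longlonglongrightarrow> l"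
  then obtain e where e: "0 < e" "\<exists>\<^sub>F n in sequentially. e \<le> dist (f n) l"
    unfolding tendsto_iff not_all not_imp not_eventually not_less by blast
  then have "infinite {n. e \<le> dist (f n) l}"
    using frequently_cofinite cofinite_eq_sequentially by metis
  then obtain r :: "nat \<Rightarrow> nat" where r: "strict_mono r" "\<And>n. e \<le> dist (f (r n)) l"
    using infinite_enumerate by (metis mem_Collect_eq)
  have "bounded (range (f \<circ> r))"
    by (rule bounded_subset[OF bdd]) auto
  then obtain l' r' where r': "strict_mono r'" "((f \<circ> r) \<circ> r') \<longlonglongrightarrow> l'"
    using bounded_imp_convergent_subsequence by blast
  then have "l' = l"
    using uniq[of "r \<circ> r'"] r(1) strict_mono_o by (metis comp_assoc)
  then have "\<forall>\<^sub>F n in sequentially. dist (((f \<circ> r) \<circ> r') n) l < e"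
    using r'(2) e(1) tendstoD by blast
  then show False
    using r(2) by (simp add: eventually_sequentially) (meson le_refl not_less)
qed

text \<open>
A form of Baire's theorem with ambient open sets, for covers indexed by a natural number that will be
a bound on a displacement.
\<close>

lemma Baire_countable_closed_cover:
  fixes S :: "'a::complete_space set" and F :: "nat \<Rightarrow> 'a set"
  assumes S: "closed S" "S \<noteq> {}" and F: "\<And>n. closed (F n)" "\<And>x. x \<in> S \<Longrightarrow> \<exists>n. x \<in> F n"
  shows "\<exists>n U. open U \<and> U \<inter> S \<noteq> {} \<and> U \<inter> S \<subseteq> F n"
proof -
  let ?G = "range (\<lambda>n. S \<inter> F n)"
  have "\<Union>?G = S" using F(2) by blast
  then have "top_of_set S interior_of \<Union>?G \<noteq> {}"
    using S(2) by (metis interior_of_topspace topspace_euclidean_subtopology)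
  moreover have "completely_metrizable_space (top_of_set S)"
    using S(1) by (simp add: completely_metrizable_space_closedin completely_metrizable_space_euclidean)
  moreover have "countable ?G" by simp
  ultimately have "\<not> (\<forall>G\<in>?G. closedin (top_of_set S) G \<and> top_of_set S interior_of G = {})"
    using Baire_category_alt[of "top_of_set S" ?G] by meson
  then obtain G where G: "G \<in> ?G" "\<not> (closedin (top_of_set S) G \<and> top_of_set S interior_of G = {})"
    by blast
  moreover have "closedin (top_of_set S) G" using G(1) F(1) by (auto simp: closedin_closed)
  ultimately obtain c where "c \<in> top_of_set S interior_of G" by blast
  then obtain U where "openin (top_of_set S) U" "c \<in> U" "U \<subseteq> G" unfolding interior_of_def by blast
  then obtain V where "open V" "U = S \<inter> V" "c \<in> U" "U \<subseteq> G" by (auto simp: openin_open)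
  moreover obtain n where "G = S \<inter> F n" using G(1) by blast
  ultimately show ?thesis by (intro exI[of _ n] exI[of _ V]) blast
qed

text \<open>
Used for the length of a displacement along a path: local freeness forbids lengths
between \<open>1\<close> and \<open>2\<close>, so a displacement that starts small stays small.
\<close>

lemma connected_avoid_gap:
  fixes f :: "'a::topological_space \<Rightarrow> real"
  assumes S: "connected S" "continuous_on S f" and s: "s \<in> S" "f s < 1" "t \<in> S"
    and gap: "\<And>u. u \<in> S \<Longrightarrow> \<not> (1 \<le> f u \<and> f u \<le> 2)"
  shows "f t < 1"
proof (rule ccontr)
  assume "\<not> f t < 1"
  have "connected (f ` S)" using S by (rule connected_continuous_image[rotated])
  then have "1 \<in> f ` S"
    using s \<open>\<not> f t < 1\<close> connected_contains_Icc[of "f ` S" "f s" "f t"] by force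
  then show False using gap by force
qed

context compact_flow
begin

lemma act_tendsto:
  assumes "\<And>n. x n \<in> X" "l \<in> X" "x \<longlonglongrightarrow> l" "v \<longlonglongrightarrow> w"
  shows "(\<lambda>n. act (v n) (x n)) \<longlonglongrightarrow> act w l"
proof -
  have "(\<lambda>n. (\<lambda>(x, v). act v x) (x n, v n)) \<longlonglongrightarrow> (\<lambda>(x, v). act v x) (l, w)"
    using assms by (intro continuous_on_tendsto_compose[OF act_cont] tendsto_Pair) auto
  then show ?thesis by simp
qed

lemma act_continuous:
  assumes "continuous_on S f" "continuous_on S g" "\<And>s. s \<in> S \<Longrightarrow> f s \<in> X"
  shows "continuous_on S (\<lambda>s. act (g s) (f s))"
proof -
  have "continuous_on S (\<lambda>s. (\<lambda>(x, v). act v x) (f s, g s))"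
    by (rule continuous_on_compose2[OF act_cont continuous_on_Pair[OF assms(1,2)]]) (use assms(3) in auto)
  then show ?thesis by simp
qed

lemma act_eqD:
  assumes "free_on X act" "x \<in> X" "act v x = act w x"
  shows "v = w"
proof -
  have "act (v - w) x = x"
    using act_act[OF assms(2), of "-w" v] act_act[OF assms(2), of "-w" w] act_zero[OF assms(2)] assms(3)
    by simp
  then show ?thesis using assms unfolding free_on_def by fastforce
qed

text \<open>
By compactness, translation by a vector of length in \<open>[1, 2]\<close> moves all points by a definite distance.
\<close>

lemma local_freeness:
  assumes "free_on X act"
  obtains e where "0 < e"
    "\<And>x v. x \<in> X \<Longrightarrow> norm v \<le> 2 \<Longrightarrow> dist x (act v x) < e \<Longrightarrow> norm v < 1"
proof -
  let ?K = "X \<times> (cball (0::'v) 2 - ball 0 1)"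
  have K: "compact ?K" using compact by (intro compact_Times compact_diff compact_cball open_ball)
  show ?thesis
  proof (cases "?K = {}")
    case True
    then show ?thesis using that[of 1] by fastforce
  next
    case False
    have "continuous_on ?K (\<lambda>p. dist (fst p) (case p of (x, v) \<Rightarrow> act v x))"
      using continuous_on_subset[OF act_cont, of ?K] by (intro continuous_intros) auto
    then obtain p where p: "p \<in> ?K"
      "\<And>q. q \<in> ?K \<Longrightarrow> dist (fst p) (case p of (x, v) \<Rightarrow> act v x) \<le> dist (fst q) (case q of (x, v) \<Rightarrow> act v x)"
      using continuous_attains_inf[OF K False] by blast
    obtain x v where xv: "p = (x, v)" "x \<in> X" "1 \<le> norm v" using p(1) by fastforce
    have "act v x \<noteq> x" using assms xv unfolding free_on_def by fastforce
    then have pos: "0 < dist x (act v x)" by (metis zero_less_dist_iff)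
    show ?thesis
    proof (rule that[OF pos])
      fix y w assume yw: "y \<in> X" "norm w \<le> 2" "dist y (act w y) < dist x (act v x)"
      show "norm w < 1"
      proof (rule ccontr)
        assume "\<not> norm w < 1"
        then show False using p(2)[of "(y, w)"] yw xv by simp
      qed
    qed
  qed
qed

end

text \<open>
A long translation is a composition of short ones, each of which costs at most \<open>N\<close>. The displacement is
existentially quantified because the lemma is also applied when it is not yet known to be unique.
\<close>

lemma linear_growth:
  fixes actY :: "'v::euclidean_space \<Rightarrow> 'b::complete_space \<Rightarrow> 'b"
    and actX :: "'w::euclidean_space \<Rightarrow> 'a::complete_space \<Rightarrow> 'a"
  assumes "compact_flow Y actY" "compact_flow X actX" and k: "k ` Y \<subseteq> X" and "0 < \<delta>"
    and small: "\<And>y v. y \<in> Y \<Longrightarrow> norm v < \<delta> \<Longrightarrow> \<exists>w. norm w \<le> N \<and> k (actY v y) = actX w (k y)"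
    and "y \<in> Y"
  shows "\<exists>w. norm w \<le> N * (norm v / \<delta> + 1) \<and> k (actY v y) = actX w (k y)"
proof -
  interpret Y: compact_flow Y actY by fact
  interpret X: compact_flow X actX by fact
  have "0 \<le> N" using small[OF \<open>y \<in> Y\<close>, of 0] \<open>0 < \<delta>\<close> by (metis norm_ge_zero norm_zero order_trans)
  have steps: "\<exists>w. norm w \<le> N * real (Suc m) \<and> k (actY v y) = actX w (k y)"
    if "norm v < real (Suc m) * \<delta>" for m v
    using that
  proof (induction m arbitrary: v)
    case 0
    then show ?case using small[OF \<open>y \<in> Y\<close>, of v] by simp
  next
    case (Suc m)
    let ?c = "real (Suc m) / real (Suc (Suc m))"
    let ?a = "?c *\<^sub>R v" and ?b = "(1 / real (Suc (Suc m))) *\<^sub>R v"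
    have c1: "?c + 1 / real (Suc (Suc m)) = 1" by (simp add: field_simps)
    have ab: "?a + ?b = v" by (simp only: scaleR_add_left[symmetric] c1 scaleR_one)
    have v: "norm v / real (Suc (Suc m)) < \<delta>"
      using Suc.prems by (subst pos_divide_less_eq) (auto simp: mult.commute)
    have na: "norm ?a = real (Suc m) * (norm v / real (Suc (Suc m)))" by simp
    have "norm ?a < real (Suc m) * \<delta>" unfolding na using v by (intro mult_strict_left_mono) auto
    then obtain w where w: "norm w \<le> N * real (Suc m)" "k (actY ?a y) = actX w (k y)"
      using Suc.IH by blast
    have "norm ?b < \<delta>" using v by simp
    then obtain w' where w': "norm w' \<le> N" "k (actY ?b (actY ?a y)) = actX w' (k (actY ?a y))"
      using small[OF Y.act_in[OF \<open>y \<in> Y\<close>]] by blast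
    have "k (actY v y) = actX (w + w') (k y)"
      using w'(2) w(2) k \<open>y \<in> Y\<close> unfolding Y.act_act[OF \<open>y \<in> Y\<close>] ab
      by (simp add: X.act_act image_subset_iff)
    moreover have "norm (w + w') \<le> N * real (Suc (Suc m))"
      using norm_triangle_ineq[of w w'] w(1) w'(1) by (simp add: algebra_simps)
    ultimately show ?case by blast
  qed
  define m where "m = nat \<lfloor>norm v / \<delta>\<rfloor>"
  have m: "real m \<le> norm v / \<delta>" "norm v / \<delta> < real m + 1"
    using \<open>0 < \<delta>\<close> unfolding m_def by (auto simp: floor_le_iff)
  have "norm v < real (Suc m) * \<delta>" using m(2) \<open>0 < \<delta>\<close> by (simp add: field_simps)
  then obtain w where "norm w \<le> N * real (Suc m)" "k (actY v y) = actX w (k y)"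
    using steps by blast
  moreover have "N * real (Suc m) \<le> N * (norm v / \<delta> + 1)"
    using m(1) \<open>0 \<le> N\<close> by (intro mult_left_mono) auto
  ultimately show ?thesis by (meson order_trans)
qed

text \<open>
Uniqueness of the displacement and continuity of \<open>k\<close> make the graph of \<open>\<beta>\<close> closed, so it suffices
to bound \<open>\<beta>\<close> locally. Along one orbit, consider the closed set of points near which \<open>\<beta>\<close> is
unbounded. If it were nonempty, then by Baire \<open>\<beta>\<close> would be bounded on a relatively open part of
it. A point outside the set is joined to it by a segment on which \<open>\<beta>\<close> is continuous and \<open>k\<close>
varies little, so by local freeness \<open>\<beta>\<close> varies by at most \<open>1\<close> up to the first point of the set: \<open>\<beta>\<close> is
bounded near that part after all. Once \<open>\<beta>\<close> is continuous along orbits, the same gap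
argument along rays gives a bound that is uniform over \<open>Y\<close>, and with it joint continuity.
\<close>

theorem continuous_cocycle_of_free_flow:
  fixes actY :: "'v::euclidean_space \<Rightarrow> 'b::complete_space \<Rightarrow> 'b"
    and actX :: "'w::euclidean_space \<Rightarrow> 'a::complete_space \<Rightarrow> 'a"
  assumes "compact_flow Y actY" "compact_flow X actX" and k: "continuous_on Y k" "k ` Y \<subseteq> X"
    and free: "free_on X actX"
    and orb: "\<And>y v. y \<in> Y \<Longrightarrow> \<exists>w. k (actY v y) = actX w (k y)"
  shows "\<exists>\<beta>. (\<forall>y\<in>Y. \<forall>v. k (actY v y) = actX (\<beta> y v) (k y)) \<and>
    continuous_on (Y \<times> UNIV) (\<lambda>(y, v). \<beta> y v)"
proof -
  interpret Y: compact_flow Y actY by fact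
  interpret X: compact_flow X actX by fact
  define \<beta> where "\<beta> y v = (SOME w. k (actY v y) = actX w (k y))" for y v
  have \<beta>: "k (actY v y) = actX (\<beta> y v) (k y)" if "y \<in> Y" for y v
    unfolding \<beta>_def by (rule someI_ex) (rule orb[OF that])
  have kX: "k y \<in> X" if "y \<in> Y" for y using k(2) that by blast
  have uniq: "w = \<beta> y v" if "y \<in> Y" "k (actY v y) = actX w (k y)" for y v w
    using X.act_eqD[OF free kX[OF that(1)]] \<beta>[OF that(1)] that(2) by metis
  have zero: "\<beta> y 0 = 0" if "y \<in> Y" for y
    using uniq[OF that, of 0 0] Y.act_zero[OF that] X.act_zero[OF kX[OF that]] by simp
  have diff: "k (actY v y) = actX (\<beta> y v - \<beta> y u) (k (actY u y))" if "y \<in> Y" for y u v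
    using \<beta>[OF that, of v] \<beta>[OF that, of u] X.act_act[OF kX[OF that], of "\<beta> y v - \<beta> y u" "\<beta> y u"] by simp
  have closed: "(\<lambda>n. \<beta> (y n) (v n)) \<longlonglongrightarrow> \<beta> l u"
    if y: "\<And>n. y n \<in> Y" "l \<in> Y" "y \<longlonglongrightarrow> l" "v \<longlonglongrightarrow> u"
      and bdd: "bounded (range (\<lambda>n. \<beta> (y n) (v n)))" for y :: "nat \<Rightarrow> 'b" and l v u
  proof (rule bounded_unique_cluster[OF bdd])
    fix r :: "nat \<Rightarrow> nat" and l' assume r: "strict_mono r" "((\<lambda>n. \<beta> (y n) (v n)) \<circ> r) \<longlonglongrightarrow> l'"
    have yr: "(y \<circ> r) \<longlonglongrightarrow> l" "(v \<circ> r) \<longlonglongrightarrow> u"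
      using LIMSEQ_subseq_LIMSEQ[OF y(3) r(1)] LIMSEQ_subseq_LIMSEQ[OF y(4) r(1)] by blast+
    have "(\<lambda>n. actY ((v \<circ> r) n) ((y \<circ> r) n)) \<longlonglongrightarrow> actY u l"
      using y(1,2) by (intro Y.act_tendsto yr) simp_all
    then have 1: "(\<lambda>n. k (actY ((v \<circ> r) n) ((y \<circ> r) n))) \<longlonglongrightarrow> k (actY u l)"
      using k(1) y(1,2) Y.act_in by (intro continuous_on_tendsto_compose[OF k(1)]) auto
    have "(\<lambda>n. k ((y \<circ> r) n)) \<longlonglongrightarrow> k l"
      using y(1,2) by (intro continuous_on_tendsto_compose[OF k(1)] yr) simp_all
    then have "(\<lambda>n. actX (\<beta> ((y \<circ> r) n) ((v \<circ> r) n)) (k ((y \<circ> r) n))) \<longlonglongrightarrow> actX l' (k l)"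
      using r(2) y kX by (intro X.act_tendsto) (auto simp: comp_def)
    then have "k (actY u l) = actX l' (k l)"
      using 1 \<beta>[OF y(1)] by (simp add: LIMSEQ_unique)
    then show "l' = \<beta> l u" using uniq y(2) by blast
  qed
  obtain e where e: "0 < e"
    "\<And>x v. x \<in> X \<Longrightarrow> norm v \<le> 2 \<Longrightarrow> dist x (actX v x) < e \<Longrightarrow> norm v < 1"
    using X.local_freeness[OF free] by metis
  have gap: "\<not> (1 \<le> norm (\<beta> y v - \<beta> y u) \<and> norm (\<beta> y v - \<beta> y u) \<le> 2)"
    if "y \<in> Y" "dist (k (actY u y)) (k (actY v y)) < e" for y u v
    using e(2)[of "k (actY u y)" "\<beta> y v - \<beta> y u"] diff[OF that(1), of v u] that kX Y.act_in by fastforce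

  \<comment> \<open>On a single orbit: the points of local unboundedness form a closed set \<open>Bad\<close>, which is shown to be empty.\<close>
  have pointwise: "continuous_on UNIV (\<beta> y)" if y: "y \<in> Y" for y
  proof -
    define lb where "lb v \<longleftrightarrow> (\<exists>r>0. \<exists>N. \<forall>u\<in>ball v r. norm (\<beta> y u) \<le> N)" for v
    define Bad where "Bad = {v. \<not> lb v}"
    have lb_near: "lb u" if "0 < r" "\<forall>u\<in>ball v r. norm (\<beta> y u) \<le> N" "u \<in> ball v r" for u v r N
    proof -
      have "ball u (r - dist v u) \<subseteq> ball v r" 
      proof
        fix w assume "w \<in> ball u (r - dist v u)"
        then show "w \<in> ball v r" using dist_triangle[of v w u] by simp
      qed
      then show ?thesis unfolding lb_def
        using that by (intro exI[of _ "r - dist v u"]) auto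
    qed
    have "open (- Bad)"
      unfolding open_contains_ball
    proof
      fix v assume "v \<in> - Bad"
      then obtain r N where r: "0 < r" "\<forall>u\<in>ball v r. norm (\<beta> y u) \<le> N" by (auto simp: Bad_def lb_def)
      then have "ball v r \<subseteq> - Bad" using lb_near[OF r] by (auto simp: Bad_def)
      then show "\<exists>r>0. ball v r \<subseteq> - Bad" using r(1) by blast
    qed
    then have Bad: "closed Bad" by (simp add: closed_def)
    have seq: "(\<lambda>n. \<beta> y (v n)) \<longlonglongrightarrow> \<beta> y u" if "v \<longlonglongrightarrow> u" "bounded (range (\<lambda>n. \<beta> y (v n)))" for v u
      using closed[of "\<lambda>_. y" y v u] that y by simp
    have good: "isCont (\<beta> y) u" if u: "u \<notin> Bad" for u
    proof -
      obtain r N where r: "0 < r" "\<And>w. w \<in> ball u r \<Longrightarrow> norm (\<beta> y w) \<le> N"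
        using u unfolding Bad_def lb_def by blast
      have "continuous_on (ball u r) (\<beta> y)"
        unfolding continuous_on_sequentially comp_def
      proof (intro ballI allI impI)
        fix v w assume w: "w \<in> ball u r" "(\<forall>n. v n \<in> ball u r) \<and> v \<longlonglongrightarrow> w"
        then have "bounded (range (\<lambda>n. \<beta> y (v n)))" using r(2) by (auto intro!: boundedI[of _ N])
        then show "(\<lambda>n. \<beta> y (v n)) \<longlonglongrightarrow> \<beta> y w" using w seq by blast
      qed
      then show ?thesis using r(1) by (simp add: continuous_on_eq_continuous_at)
    qed
    have F: "closed {v. norm (\<beta> y v) \<le> real n}" for n
      unfolding closed_sequential_limits
    proof (intro allI impI)
      fix v u assume v: "(\<forall>m. v m \<in> {v. norm (\<beta> y v) \<le> real n}) \<and> v \<longlonglongrightarrow> u"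
      then have "bounded (range (\<lambda>m. \<beta> y (v m)))" by (auto intro!: boundedI[of _ "real n"])
      then have "(\<lambda>m. \<beta> y (v m)) \<longlonglongrightarrow> \<beta> y u" using v seq by blast
      then have "norm (\<beta> y u) \<le> real n"
        using v by (intro Lim_bounded[OF tendsto_norm]) auto
      then show "u \<in> {v. norm (\<beta> y v) \<le> real n}" by simp
    qed
    have "Bad = {}"
    proof (rule ccontr)
      assume "Bad \<noteq> {}"
      have "\<exists>n. v \<in> {v. norm (\<beta> y v) \<le> real n}" for v
        using real_arch_simple by blast
      then obtain n V where V: "open V" "V \<inter> Bad \<noteq> {}" "V \<inter> Bad \<subseteq> {v. norm (\<beta> y v) \<le> real n}"
        using Baire_countable_closed_cover[OF Bad \<open>Bad \<noteq> {}\<close> F] by meson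
      then have n: "\<And>v. v \<in> Bad \<inter> V \<Longrightarrow> norm (\<beta> y v) \<le> real n" by blast
      obtain c where U: "c \<in> Bad \<inter> V" using V(2) by blast
      have "continuous_on UNIV (\<lambda>v. k (actY v y))"
        unfolding continuous_on_sequentially comp_def
      proof (intro ballI allI impI)
        fix v :: "nat \<Rightarrow> 'v" and u assume "(\<forall>n. v n \<in> UNIV) \<and> v \<longlonglongrightarrow> u"
        then show "(\<lambda>n. k (actY (v n) y)) \<longlonglongrightarrow> k (actY u y)"
          using y Y.act_in by (intro continuous_on_tendsto_compose[OF k(1)] Y.act_tendsto) auto
      qed
      then obtain d where d: "0 < d" "\<And>u. dist u c < d \<Longrightarrow> dist (k (actY u y)) (k (actY c y)) < e/2"
        using e(1) unfolding continuous_on_iff by (metis UNIV_I half_gt_zero)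
      obtain d' where d': "0 < d'" "ball c d' \<subseteq> V" using V(1) U by (meson Int_iff openE)
      define r where "r = min d d'"
      have r: "0 < r" using d d' by (simp add: r_def)
      have "norm (\<beta> y u) \<le> real n + 1" if u: "u \<in> ball c r" for u
      proof (cases "u \<in> Bad")
        case True
        then show ?thesis using n[of u] u d'(2) by (auto simp: r_def)
      next
        case False
        define p where "p t = u + t *\<^sub>R (c - u)" for t
        have p_ball: "p t \<in> ball c r" if "t \<in> {0..1}" for t
        proof -
          have "p t = (1 - t) *\<^sub>R u + t *\<^sub>R c" by (simp add: p_def algebra_simps)
          then show ?thesis using convexD[OF convex_ball[of c r] u, of c "1 - t" t] r that by simp
        qed
        have p_cont: "continuous_on S p" for S unfolding p_def by (intro continuous_intros)
        have "compact {t\<in>{0..1}. p t \<in> Bad}"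
          using continuous_closed_preimage[OF p_cont closed_real_atLeastAtMost Bad, of 0 1]
          by (auto simp: compact_eq_bounded_closed vimage_def Int_def intro: bounded_subset[of "{0..1}"])
        moreover have "c \<in> Bad" using U by blast
        then have "1 \<in> {t\<in>{0..1}. p t \<in> Bad}" by (simp add: p_def)
        ultimately obtain t where t: "t \<in> {0..1}" "p t \<in> Bad" "\<And>s. s \<in> {0..1} \<Longrightarrow> p s \<in> Bad \<Longrightarrow> t \<le> s"
          using compact_attains_inf[of "{t\<in>{0..1}. p t \<in> Bad}"] by (metis (no_types, lifting) emptyE mem_Collect_eq)
        have t0: "0 < t" using t False by (cases "t = 0") (auto simp: p_def)
        have near: "norm (\<beta> y (p s) - \<beta> y u) < 1" if s: "s \<in> {0..<t}" for s
        proof (rule connected_avoid_gap[where f = "\<lambda>s. norm (\<beta> y (p s) - \<beta> y u)" and S = "{0..<t}" and s = 0])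
          have "isCont (\<beta> y) (p q)" if "q \<in> {0..<t}" for q
            using that t by (intro good) force
          then have "continuous_on (p ` {0..<t}) (\<beta> y)"
            by (auto intro!: continuous_at_imp_continuous_on)
          then have "continuous_on {0..<t} (\<lambda>s. \<beta> y (p s))"
            using continuous_on_compose[OF p_cont, of "{0..<t}" "\<beta> y"] by (simp add: comp_def)
          then show "continuous_on {0..<t} (\<lambda>s. norm (\<beta> y (p s) - \<beta> y u))"
            by (intro continuous_intros)
          show "connected {0..<t}" by (simp add: convex_connected)
          fix q assume "q \<in> {0..<t}"
          then have "p q \<in> ball c r" using p_ball t(1) by auto
          then have "dist (k (actY (p q) y)) (k (actY c y)) < e/2" "dist (k (actY u y)) (k (actY c y)) < e/2"
            using u by (intro d(2); simp add: r_def dist_commute)+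
          then have "dist (k (actY u y)) (k (actY (p q) y)) < e"
            using dist_triangle2[of "k (actY u y)" "k (actY (p q) y)" "k (actY c y)"] by simp
          then show "\<not> (1 \<le> norm (\<beta> y (p q) - \<beta> y u) \<and> norm (\<beta> y (p q) - \<beta> y u) \<le> 2)"
            using gap[OF y] by blast
        qed (use s t0 in \<open>auto simp: p_def\<close>)
        define s where "s m = t * (1 - 1 / real (Suc m))" for m
        have s_in: "s m \<in> {0..<t}" for m using t0 by (auto simp: s_def field_simps)
        have "s \<longlonglongrightarrow> t * (1 - 0)"
          unfolding s_def by (intro tendsto_intros LIMSEQ_inverse_real_of_nat[unfolded inverse_eq_divide])
        then have "(\<lambda>m. p (s m)) \<longlonglongrightarrow> p t" unfolding p_def by (intro tendsto_intros) simp
        moreover have "norm (\<beta> y (p (s m))) \<le> norm (\<beta> y u) + 1" for m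
          using near[OF s_in[of m]] norm_triangle_ineq2[of "\<beta> y (p (s m))" "\<beta> y u"] by simp
        then have "bounded (range (\<lambda>m. \<beta> y (p (s m))))" by (auto intro!: boundedI)
        ultimately have "(\<lambda>m. \<beta> y (p (s m))) \<longlonglongrightarrow> \<beta> y (p t)" by (rule seq)
        then have "(\<lambda>m. norm (\<beta> y (p (s m)) - \<beta> y u)) \<longlonglongrightarrow> norm (\<beta> y (p t) - \<beta> y u)"
          by (intro tendsto_intros)
        then have "norm (\<beta> y (p t) - \<beta> y u) \<le> 1"
          by (rule Lim_bounded[where M = 0]) (use near[OF s_in] in \<open>auto intro: less_imp_le\<close>)
        moreover have "p t \<in> ball c r" using p_ball t(1) by simp
        then have "norm (\<beta> y (p t)) \<le> real n" using n t(2) d'(2) by (auto simp: r_def)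
        ultimately show ?thesis using norm_triangle_ineq3[of "\<beta> y (p t)" "\<beta> y u"] by linarith
      qed
      then have "lb c" unfolding lb_def using r by blast
      then show False using U by (auto simp: Bad_def)
    qed
    then show ?thesis by (auto intro!: continuous_at_imp_continuous_on good)
  qed

  have "continuous_on (Y \<times> cball (0::'v) 1) (\<lambda>(y, v). k (actY v y))"
    unfolding case_prod_unfold using k(1) continuous_on_subset[OF Y.act_cont, of "Y \<times> cball 0 1"]
    by (intro continuous_on_compose2[OF k(1)]) (auto simp: case_prod_unfold Y.act_in)
  then have "uniformly_continuous_on (Y \<times> cball (0::'v) 1) (\<lambda>(y, v). k (actY v y))"
    using Y.compact by (intro compact_uniformly_continuous compact_Times) auto
  then obtain d where d: "0 < d" "\<And>p q. p \<in> Y \<times> cball (0::'v) 1 \<Longrightarrow> q \<in> Y \<times> cball 0 1 \<Longrightarrow> dist q p < d \<Longrightarrow>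
      dist (case q of (y, v) \<Rightarrow> k (actY v y)) (case p of (y, v) \<Rightarrow> k (actY v y)) < e"
    using e(1) unfolding uniformly_continuous_on_def by meson
  \<comment> \<open>The uniform modulus of \<open>k\<close> along orbits, cut off at \<open>1\<close> because it was obtained on the unit ball.\<close>
  define \<delta> where "\<delta> = min 1 d"
  have \<delta>: "0 < \<delta>" using d by (simp add: \<delta>_def)
  have small: "norm (\<beta> y v) \<le> 1" if y: "y \<in> Y" and v: "norm v < \<delta>" for y v
  proof -
    have "norm (\<beta> y (1 *\<^sub>R v)) < 1"
    proof (rule connected_avoid_gap[where f = "\<lambda>s. norm (\<beta> y (s *\<^sub>R v))" and S = "{0..1}" and s = 0])
      show "continuous_on {0..1} (\<lambda>s. norm (\<beta> y (s *\<^sub>R v)))"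
        by (intro continuous_intros continuous_on_compose2[OF pointwise[OF y]]) auto
      fix s :: real assume s: "s \<in> {0..1}"
      have "norm (s *\<^sub>R v) \<le> norm v" using s by (simp add: mult_left_le_one_le)
      then have "dist (k (actY 0 y)) (k (actY (s *\<^sub>R v) y)) < e"
        using d(2)[of "(y, s *\<^sub>R v)" "(y, 0)"] y v by (simp add: \<delta>_def dist_Pair_Pair)
      from gap[OF y this] show "\<not> (1 \<le> norm (\<beta> y (s *\<^sub>R v)) \<and> norm (\<beta> y (s *\<^sub>R v)) \<le> 2)"
        using zero[OF y] by simp
    qed (use zero[OF y] in auto)
    then show ?thesis by simp
  qed
  have growth: "norm (\<beta> y v) \<le> 1 * (norm v / \<delta> + 1)" if y: "y \<in> Y" for y v
  proof -
    have "\<exists>w. norm w \<le> 1 * (norm v / \<delta> + 1) \<and> k (actY v y) = actX w (k y)"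
      by (rule linear_growth[OF assms(1,2) k(2) \<delta> _ y]) (use small \<beta> in blast)
    then show ?thesis using uniq[OF y] by blast
  qed
  have "continuous_on (Y \<times> UNIV) (\<lambda>(y, v). \<beta> y v)"
    unfolding continuous_on_sequentially comp_def
  proof (intro ballI allI impI)
    fix z :: "nat \<Rightarrow> 'b \<times> 'v" and l assume l: "l \<in> Y \<times> UNIV" "(\<forall>n. z n \<in> Y \<times> UNIV) \<and> z \<longlonglongrightarrow> l"
    then have z: "fst (z n) \<in> Y" "fst l \<in> Y" "(\<lambda>n. fst (z n)) \<longlonglongrightarrow> fst l" "(\<lambda>n. snd (z n)) \<longlonglongrightarrow> snd l" for n
      by (auto simp: mem_Times_iff intro: tendsto_fst tendsto_snd)
    have "bounded (range (\<lambda>n. snd (z n)))" using z(4) by (meson convergentI convergent_imp_bounded)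
    then obtain M where M: "\<And>n. norm (snd (z n)) \<le> M" unfolding bounded_iff by auto
    have "norm (\<beta> (fst (z n)) (snd (z n))) \<le> M / \<delta> + 1" for n
      using growth[OF z(1)[of n], of "snd (z n)"] M[of n] \<delta> by (simp add: field_simps)
    then have "bounded (range (\<lambda>n. \<beta> (fst (z n)) (snd (z n))))" by (auto intro!: boundedI)
    then show "(\<lambda>n. case z n of (y, v) \<Rightarrow> \<beta> y v) \<longlonglongrightarrow> (case l of (y, v) \<Rightarrow> \<beta> y v)"
      using closed[of "\<lambda>n. fst (z n)" "fst l" "\<lambda>n. snd (z n)" "snd l"] z by (simp add: case_prod_unfold)
  qed
  then show ?thesis using \<beta> by blast
qed


section \<open>Growth of an orbit equivalence along orbits\<close>

text \<open>
Locally around each point of a compact set the property holds for all small vectors; one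
smallness then works everywhere.
\<close>

lemma compact_locally_uniform_imp_uniform:
  fixes actX :: "'v::euclidean_space \<Rightarrow> 'a::complete_space \<Rightarrow> 'a"
  assumes "compact X"
    and loc: "\<And>x. x \<in> X \<Longrightarrow> \<exists>\<delta>>0. \<forall>z\<in>X. \<forall>v. dist z x < \<delta> \<longrightarrow> norm v < \<delta> \<longrightarrow> P z v"
  shows "\<exists>\<delta>>0. \<forall>z\<in>X. \<forall>v::'v. norm v < \<delta> \<longrightarrow> P z v"
proof (rule ccontr)
  assume "\<not> ?thesis"
  then have "\<forall>n. \<exists>z v. z \<in> X \<and> norm (v::'v) < 1 / real (Suc n) \<and> \<not> P z v"
    by (metis of_nat_0_less_iff zero_less_Suc zero_less_divide_1_iff)
  then obtain z v where zv: "\<And>n. z n \<in> X" "\<And>n. norm (v n :: 'v) < 1 / real (Suc n)" "\<And>n. \<not> P (z n) (v n)"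
    by metis
  obtain l r where l: "l \<in> X" "strict_mono r" "(z \<circ> r) \<longlonglongrightarrow> l"
    using \<open>compact X\<close> zv(1) unfolding compact_def by meson
  obtain d where d: "0 < d" "\<And>y u. y \<in> X \<Longrightarrow> dist y l < d \<Longrightarrow> norm u < d \<Longrightarrow> P y u"
    using loc[OF l(1)] by blast
  have "\<forall>\<^sub>F n in sequentially. dist ((z \<circ> r) n) l < d" using l(3) d(1) tendstoD by blast
  moreover have "(\<lambda>n. 1 / real (Suc n)) \<longlonglongrightarrow> 0"
    using LIMSEQ_inverse_real_of_nat by (simp add: inverse_eq_divide)
  then have "((\<lambda>n. 1 / real (Suc n)) \<circ> r) \<longlonglongrightarrow> 0" using l(2) by (rule LIMSEQ_subseq_LIMSEQ)
  then have "\<forall>\<^sub>F n in sequentially. ((\<lambda>n. 1 / real (Suc n)) \<circ> r) n < d" using d(1) by (rule order_tendstoD)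
  ultimately have "\<forall>\<^sub>F n in sequentially. False"
  proof eventually_elim
    case (elim n)
    then have "norm (v (r n)) < d" using zv(2)[of "r n"] by simp
    then show False using d(2)[of "z (r n)" "v (r n)"] elim(1) zv by simp
  qed
  then show False by simp
qed

text \<open>
The setting of the theorem for flows on compact subsets of metric types. Only the source flow is assumed to be
free; freeness of the target is a consequence (\<open>image_free\<close>).
\<close>

locale flow_orbit_equivalence =
  X: compact_flow X actX + Y: compact_flow Y actY
  for X :: "'a::complete_space set" and actX :: "real^'n::finite \<Rightarrow> 'a \<Rightarrow> 'a"
    and Y :: "'b::complete_space set" and actY :: "real^'n \<Rightarrow> 'b \<Rightarrow> 'b" +
  fixes h :: "'a \<Rightarrow> 'b" and k :: "'b \<Rightarrow> 'a"
  assumes homeo: "homeomorphism X Y h k"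
    and orbit_image: "x \<in> X \<Longrightarrow> h ` range (\<lambda>v. actX v x) = range (\<lambda>w. actY w (h x))"
    and free: "free_on X actX"
    and minimal: "minimal_on X actX"
begin

lemma h_in: "x \<in> X \<Longrightarrow> h x \<in> Y" and k_in: "y \<in> Y \<Longrightarrow> k y \<in> X"
  and kh: "x \<in> X \<Longrightarrow> k (h x) = x" and hk: "y \<in> Y \<Longrightarrow> h (k y) = y"
  and h_cont: "continuous_on X h" and k_cont: "continuous_on Y k"
  using homeo unfolding homeomorphism_def by blast+

lemma h_orbit: "x \<in> X \<Longrightarrow> \<exists>w. h (actX v x) = actY w (h x)"
  using orbit_image by blast

lemma k_orbit:
  assumes "y \<in> Y" shows "\<exists>w. k (actY v y) = actX w (k y)"
proof -
  have "actY v (h (k y)) \<in> h ` range (\<lambda>v. actX v (k y))"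
    using orbit_image[OF k_in[OF assms]] by blast
  then show ?thesis using hk kh k_in assms X.act_in by force
qed

text \<open>
The displacement of the inverse \<open>k\<close>; it is determined by \<open>k\<close> because the source flow is free.
\<close>

definition \<beta> :: "'b \<Rightarrow> real^'n \<Rightarrow> real^'n" where
  "\<beta> = (SOME \<beta>. (\<forall>y\<in>Y. \<forall>v. k (actY v y) = actX (\<beta> y v) (k y)) \<and> continuous_on (Y \<times> UNIV) (\<lambda>(y, v). \<beta> y v))"

lemma \<beta>: "y \<in> Y \<Longrightarrow> k (actY v y) = actX (\<beta> y v) (k y)"
  and \<beta>_cont: "continuous_on (Y \<times> UNIV) (\<lambda>(y, v). \<beta> y v)"
proof -
  let ?P = "\<lambda>\<beta>. (\<forall>y\<in>Y. \<forall>v. k (actY v y) = actX (\<beta> y v) (k y)) \<and> continuous_on (Y \<times> UNIV) (\<lambda>(y, v). \<beta> y v)"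
  have "k ` Y \<subseteq> X" using k_in by blast
  have "\<exists>\<beta>. ?P \<beta>"
  proof (rule continuous_cocycle_of_free_flow[of Y actY X actX k])
    show "\<exists>w. k (actY v y) = actX w (k y)" if "y \<in> Y" for y v using k_orbit[OF that] .
  qed (fact Y.compact_flow_axioms X.compact_flow_axioms k_cont \<open>k ` Y \<subseteq> X\<close> free)+
  then have "?P \<beta>" unfolding \<beta>_def by (rule someI_ex[of ?P])
  then show "y \<in> Y \<Longrightarrow> k (actY v y) = actX (\<beta> y v) (k y)"
    "continuous_on (Y \<times> UNIV) (\<lambda>(y, v). \<beta> y v)" by blast+
qed

lemma \<beta>_continuous:
  assumes "continuous_on S f" "continuous_on S g" "\<And>s. s \<in> S \<Longrightarrow> f s \<in> Y"
  shows "continuous_on S (\<lambda>s. \<beta> (f s) (g s))"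
proof -
  have "continuous_on S (\<lambda>s. (\<lambda>(y, v). \<beta> y v) (f s, g s))"
    by (rule continuous_on_compose2[OF \<beta>_cont continuous_on_Pair[OF assms(1,2)]]) (use assms(3) in auto)
  then show ?thesis by simp
qed

lemma \<beta>_growth: "\<exists>C>0. \<forall>y\<in>Y. \<forall>v. norm (\<beta> y v) \<le> C * (norm v + 1)"
proof -
  have "compact ((\<lambda>(y, v). \<beta> y v) ` (Y \<times> cball 0 1))"
    by (rule compact_continuous_image[OF continuous_on_subset[OF \<beta>_cont]])
      (auto intro: compact_Times[OF Y.compact])
  from compact_imp_bounded[OF this]
  obtain N where "\<forall>z \<in> (\<lambda>(y, v). \<beta> y v) ` (Y \<times> cball 0 1). norm z \<le> N"
    unfolding bounded_iff by metis
  then have N: "\<And>y v. y \<in> Y \<Longrightarrow> norm v \<le> 1 \<Longrightarrow> norm (\<beta> y v) \<le> N" by auto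
  have "norm (\<beta> y v) \<le> max N 1 * (norm v + 1)" if "y \<in> Y" for y v
  proof -
    have "\<exists>w. norm w \<le> N * (norm v / 1 + 1) \<and> k (actY v y) = actX w (k y)"
    proof (rule linear_growth[OF Y.compact_flow_axioms X.compact_flow_axioms _ _ _ that])
      show "\<exists>w. norm w \<le> N \<and> k (actY v y) = actX w (k y)" if "y \<in> Y" "norm v < 1" for y v
        using N[OF that(1), of v] \<beta>[OF that(1), of v] that(2) by auto
    qed (use k_in in auto)
    then obtain w where w: "norm w \<le> N * (norm v / 1 + 1)" "k (actY v y) = actX w (k y)" by blast
    then have "w = \<beta> y v" using X.act_eqD[OF free k_in[OF that]] \<beta>[OF that] by simp
    then have "norm (\<beta> y v) \<le> N * (norm v + 1)" using w by simp
    also have "\<dots> \<le> max N 1 * (norm v + 1)" by (intro mult_right_mono) auto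
    finally show ?thesis .
  qed
  then show ?thesis by (intro exI[of _ "max N 1"]) auto
qed

text \<open>
Displacements of \<open>h\<close> need not be unique at this stage, but the pairs that admit a displacement of length at
most \<open>n\<close> still form a closed set. These sets cover \<open>X \<times> UNIV\<close>, so by Baire one of them contains
a box, and translating the box turns the vectors near its center into vectors near \<open>0\<close>.
\<close>

lemma h_locally_bounded_open:
  assumes "X \<noteq> {}"
  obtains U r N where "open U" "U \<inter> X \<noteq> {}" "0 < r"
    "\<And>x u. x \<in> X \<Longrightarrow> x \<in> U \<Longrightarrow> norm u < r \<Longrightarrow> \<exists>w. norm w \<le> N \<and> h (actX u x) = actY w (h x)"
proof -
  let ?S = "X \<times> (UNIV :: (real^'n) set)"
  define F where "F n = {(x, u). x \<in> X \<and> (\<exists>w. norm w \<le> real n \<and> h (actX u x) = actY w (h x))}" for n :: nat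
  have S: "closed ?S" "?S \<noteq> {}" using X.compact assms by (auto intro: closed_Times[OF compact_imp_closed])
  have "closed (F n)" for n
    unfolding closed_sequential_limits
  proof (intro allI impI)
    fix z l assume z: "(\<forall>m. z m \<in> F n) \<and> z \<longlonglongrightarrow> l"
    define x u where "x m = fst (z m)" "u m = snd (z m)" for m
    have x: "x m \<in> X" and "\<exists>w. norm w \<le> real n \<and> h (actX (u m) (x m)) = actY w (h (x m))" for m
      using z unfolding F_def x_u_def by (auto simp: case_prod_unfold)
    then obtain w where w: "\<And>m. norm (w m) \<le> real n" "\<And>m. h (actX (u m) (x m)) = actY (w m) (h (x m))" by metis
    have lim: "x \<longlonglongrightarrow> fst l" "u \<longlonglongrightarrow> snd l" using z unfolding x_u_def by (auto intro: tendsto_fst tendsto_snd)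
    have lX: "fst l \<in> X" using closed_sequentially[OF compact_imp_closed[OF X.compact] _ lim(1)] x by blast
    have "\<forall>m. w m \<in> cball 0 (real n)" using w(1) by simp
    then obtain w' r where r: "w' \<in> cball 0 (real n)" "strict_mono r" "(w \<circ> r) \<longlonglongrightarrow> w'"
      using compact_cball[of 0 "real n"] unfolding compact_def by meson
    note lim' = LIMSEQ_subseq_LIMSEQ[OF lim(1) r(2)] LIMSEQ_subseq_LIMSEQ[OF lim(2) r(2)]
    have "(\<lambda>m. actX ((u \<circ> r) m) ((x \<circ> r) m)) \<longlonglongrightarrow> actX (snd l) (fst l)"
      using x lX by (intro X.act_tendsto lim') simp_all
    then have "(\<lambda>m. h (actX ((u \<circ> r) m) ((x \<circ> r) m))) \<longlonglongrightarrow> h (actX (snd l) (fst l))"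
      using x lX X.act_in by (intro continuous_on_tendsto_compose[OF h_cont]) auto
    moreover have "(\<lambda>m. h ((x \<circ> r) m)) \<longlonglongrightarrow> h (fst l)"
      using x lX by (intro continuous_on_tendsto_compose[OF h_cont] lim') simp_all
    then have "(\<lambda>m. actY ((w \<circ> r) m) (h ((x \<circ> r) m))) \<longlonglongrightarrow> actY w' (h (fst l))"
      using x lX h_in by (intro Y.act_tendsto r(3)) simp_all
    ultimately have "h (actX (snd l) (fst l)) = actY w' (h (fst l))"
      using w(2) by (simp add: LIMSEQ_unique)
    then show "l \<in> F n" unfolding F_def using lX r(1) by (auto simp: case_prod_unfold)
  qed
  moreover have "\<exists>n. p \<in> F n" if p: "p \<in> ?S" for p
  proof -
    obtain w where "h (actX (snd p) (fst p)) = actY w (h (fst p))" using h_orbit[of "fst p" "snd p"] p by (auto simp: mem_Times_iff)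
    moreover obtain n where "norm w \<le> real n" using real_arch_simple by blast
    ultimately show ?thesis using p unfolding F_def by (auto simp: case_prod_unfold)
  qed
  ultimately obtain n W where W: "open W" "W \<inter> ?S \<noteq> {}" "W \<inter> ?S \<subseteq> F n"
    using Baire_countable_closed_cover[OF S, of F] by meson
  then obtain x0 u0 where x0: "(x0, u0) \<in> W" "x0 \<in> X" by blast
  obtain A B where AB: "open A" "open B" "(x0, u0) \<in> A \<times> B" "A \<times> B \<subseteq> W"
    using open_prod_elim[OF W(1) x0(1)] by blast
  obtain r where r: "0 < r" "ball u0 r \<subseteq> B" using AB by (meson mem_Sigma_iff openE)
  have bound: "\<exists>w. norm w \<le> real n \<and> h (actX u x) = actY w (h x)" if "x \<in> X" "x \<in> A" "u \<in> ball u0 r" for x u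
  proof -
    have "(x, u) \<in> F n" using W(3) AB(4) r(2) that by blast
    then show ?thesis by (simp add: F_def)
  qed
  have "continuous_on X (\<lambda>x. actX (-u0) x)"
    by (intro X.act_continuous continuous_intros)
  then have "openin (top_of_set X) (X \<inter> (\<lambda>x. actX (-u0) x) -` A)"
    using AB(1) continuous_openin_preimage_gen by blast
  then obtain U where U: "open U" "X \<inter> (\<lambda>x. actX (-u0) x) -` A = X \<inter> U" by (auto simp: openin_open)
  show ?thesis
  proof (rule that[of U r "2 * real n"])
    have "actX (-u0) (actX u0 x0) = x0" using X.act_act X.act_zero x0(2) by simp
    then have "actX u0 x0 \<in> X \<inter> (\<lambda>x. actX (-u0) x) -` A" using AB(3) X.act_in[OF x0(2)] by simp
    then show "U \<inter> X \<noteq> {}" using U(2) by blast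
    fix x and u :: "real^'n" assume x: "x \<in> X" "x \<in> U" and u: "norm u < r"
    define z where "z = actX (-u0) x"
    have z: "z \<in> X" "z \<in> A" "actX u0 z = x"
      using x U(2) X.act_in X.act_act[OF x(1)] X.act_zero[OF x(1)] unfolding z_def by auto
    obtain w0 where w0: "norm w0 \<le> real n" "h x = actY w0 (h z)"
      using bound[OF z(1,2), of u0] r(1) z(3) by auto
    obtain w1 where w1: "norm w1 \<le> real n" "h (actX (u0 + u) z) = actY w1 (h z)"
      using bound[OF z(1,2), of "u0 + u"] u by (auto simp: dist_norm)
    have "actX (u0 + u) z = actX u x" using z X.act_act[OF z(1), of u u0] by simp
    then have "h (actX u x) = actY (w1 - w0) (h x)"
      using w0(2) w1(2) Y.act_act[OF h_in[OF z(1)], of "w1 - w0" w0] by simp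
    moreover have "norm (w1 - w0) \<le> 2 * real n" using norm_triangle_ineq4[of w1 w0] w0 w1 by simp
    ultimately show "\<exists>w. norm w \<le> 2 * real n \<and> h (actX u x) = actY w (h x)" by blast
  qed (use U r in auto)
qed

text \<open>
The bound on the open set \<open>U\<close> spreads to all of \<open>X\<close>. By minimality some \<open>w'\<close> moves \<open>h x\<close> into
the image of \<open>U\<close>, and by continuity of \<open>\<beta>\<close> the same \<open>w'\<close> works for all points near \<open>x\<close>, with nearly
the same displacement of the source. So a short translation of a point near \<open>x\<close> can be compared with a
short translation inside \<open>U\<close>, and \<open>w'\<close> cancels.
\<close>

lemma h_growth:
  assumes "X \<noteq> {}"
  shows "\<exists>C>0. \<forall>x\<in>X. \<forall>u. \<exists>w. norm w \<le> C * (norm u + 1) \<and> h (actX u x) = actY w (h x)"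
proof -
  obtain U r N where U: "open U" "U \<inter> X \<noteq> {}" "0 < r" and
    bound: "\<And>x u. x \<in> X \<Longrightarrow> x \<in> U \<Longrightarrow> norm u < r \<Longrightarrow> \<exists>w. norm w \<le> N \<and> h (actX u x) = actY w (h x)"
    using h_locally_bounded_open[OF assms] by metis
  have "\<exists>\<delta>>0. \<forall>z\<in>X. \<forall>u. norm u < \<delta> \<longrightarrow> (\<exists>w. norm w \<le> N \<and> h (actX u z) = actY w (h z))"
  proof (rule compact_locally_uniform_imp_uniform[OF X.compact])
    fix x assume x: "x \<in> X"
    have "x0 \<in> closure (range (\<lambda>v. actX v x))" if "x0 \<in> X" for x0
      using minimal x that unfolding minimal_on_def by blast
    then obtain v where v: "actX v x \<in> U"
      using U(1,2) open_Int_closure_eq_empty[OF U(1), of "range (\<lambda>v. actX v x)"] by blast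
    then obtain w' where w': "actX v x = k (actY w' (h x))" using h_orbit[OF x, of v] kh[OF X.act_in[OF x, of v]] by metis
    have zc: "continuous_on (X \<times> UNIV) (\<lambda>(z, u). \<beta> (h (actX u z)) w')"
      unfolding case_prod_unfold
    proof (intro \<beta>_continuous continuous_on_const)
      show "continuous_on (X \<times> UNIV) (\<lambda>p. h (actX (snd p) (fst p)))"
        by (rule continuous_on_compose2[OF h_cont]) (auto intro!: X.act_continuous continuous_intros X.act_in)
    qed (use h_in X.act_in in \<open>auto simp del: split_paired_All\<close>)
    have gc: "continuous_on X (\<lambda>z. k (actY w' (h z)))"
      by (rule continuous_on_compose2[OF k_cont])
        (auto intro!: Y.act_continuous h_cont continuous_intros Y.act_in h_in)
    have "\<exists>d>0. \<forall>q\<in>X \<times> UNIV. dist q (x, 0) < d \<longrightarrow>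
        dist (case q of (z, u) \<Rightarrow> \<beta> (h (actX u z)) w') (case (x, 0) of (z, u) \<Rightarrow> \<beta> (h (actX u z)) w') < r/3"
      using zc[unfolded continuous_on_iff, rule_format, of "(x, 0)" "r/3"] x U(3) by simp
    then obtain d1 where d1: "0 < d1" "\<And>z u. z \<in> X \<Longrightarrow> dist (z, u) (x, 0) < d1 \<Longrightarrow>
        dist (\<beta> (h (actX u z)) w') (\<beta> (h (actX 0 x)) w') < r/3" by force
    have "openin (top_of_set X) (X \<inter> (\<lambda>z. k (actY w' (h z))) -` U)"
      using gc U(1) continuous_openin_preimage_gen by blast
    moreover have "x \<in> X \<inter> (\<lambda>z. k (actY w' (h z))) -` U" using v w' x by simp
    ultimately obtain d2 where d2: "0 < d2" "\<And>z. z \<in> X \<Longrightarrow> dist z x < d2 \<Longrightarrow> k (actY w' (h z)) \<in> U"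
      unfolding openin_euclidean_subtopology_iff by (metis IntD2 vimageE)
    define \<delta> where "\<delta> = min (min (d1/2) d2) (r/3)"
    show "\<exists>\<delta>>0. \<forall>z\<in>X. \<forall>u. dist z x < \<delta> \<longrightarrow> norm u < \<delta> \<longrightarrow> (\<exists>w. norm w \<le> N \<and> h (actX u z) = actY w (h z))"
    proof (intro exI[of _ \<delta>] conjI ballI allI impI)
      show "0 < \<delta>" using d1 d2 U by (simp add: \<delta>_def)
      fix z and u :: "real^'n" assume z: "z \<in> X" "dist z x < \<delta>" and u: "norm u < \<delta>"
      define a b where "a = \<beta> (h z) w'" "b = \<beta> (h (actX u z)) w'"
      have "dist (z, t) (x, 0) < d1" if "norm t < \<delta>" for t :: "real^'n"
        using z(2) that sqrt_sum_squares_le_sum_abs[of "dist z x" "norm t"] by (simp add: dist_Pair_Pair \<delta>_def)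
      from d1(2)[OF z(1) this, of u] d1(2)[OF z(1) this, of 0] u \<open>0 < \<delta>\<close>
      have "dist b (\<beta> (h (actX 0 x)) w') < r/3" "dist a (\<beta> (h (actX 0 x)) w') < r/3"
        using X.act_zero[OF z(1)] by (simp_all add: a_b_def)
      then have "dist b a < 2 * (r/3)" using dist_triangle2[of b a "\<beta> (h (actX 0 x)) w'"] by simp
      then have small: "norm (u + b - a) < r"
        using norm_triangle_ineq[of u "b - a"] u by (simp add: \<delta>_def dist_norm add_diff_eq)
      have za: "k (actY w' (h z)) = actX a z" using \<beta>[OF h_in[OF z(1)]] kh z(1) by (simp add: a_b_def)
      then have "actX a z \<in> U" using d2(2)[OF z(1)] z(2) by (simp add: \<delta>_def)
      then obtain w where w: "norm w \<le> N" "h (actX (u + b - a) (actX a z)) = actY w (h (actX a z))"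
        using bound[OF X.act_in[OF z(1)] _ small] by blast
      have hz: "h (actX a z) = actY w' (h z)"
        using za hk Y.act_in h_in z(1) by metis
      have "k (actY w' (h (actX u z))) = actX b (actX u z)"
        using \<beta>[OF h_in[OF X.act_in[OF z(1)]]] kh X.act_in[OF z(1)] by (simp add: a_b_def)
      then have "h (actX b (actX u z)) = actY w' (h (actX u z))"
        using hk Y.act_in h_in X.act_in z(1) by metis
      then have "actY w' (h (actX u z)) = actY w (actY w' (h z))"
        using w(2) hz X.act_act[OF z(1)] by (simp add: add.commute)
      then have "actY (-w') (actY w' (h (actX u z))) = actY (-w') (actY w (actY w' (h z)))" by simp
      then have "h (actX u z) = actY w (h z)"
        using Y.act_act Y.act_zero Y.act_in h_in X.act_in z(1) by simp
      then show "\<exists>w. norm w \<le> N \<and> h (actX u z) = actY w (h z)" using w(1) by blast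
    qed
  qed
  then obtain \<delta> where \<delta>: "0 < \<delta>" "\<And>z u. z \<in> X \<Longrightarrow> norm u < \<delta> \<Longrightarrow> \<exists>w. norm w \<le> N \<and> h (actX u z) = actY w (h z)"
    by blast
  obtain x0 where "x0 \<in> X" using assms by blast
  then have "0 \<le> N" using \<delta>(2)[of x0 0] \<delta>(1) by (metis norm_ge_zero norm_zero order_trans)
  define C where "C = N * (1 + 1 / \<delta>) + 1"
  have "\<exists>w. norm w \<le> C * (norm u + 1) \<and> h (actX u x) = actY w (h x)" if x: "x \<in> X" for x u
  proof -
    obtain w where w: "norm w \<le> N * (norm u / \<delta> + 1)" "h (actX u x) = actY w (h x)"
      using linear_growth[OF X.compact_flow_axioms Y.compact_flow_axioms _ \<delta>(1) _ x, of h N u] \<delta>(2) h_in by blast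
    have "N * (norm u / \<delta> + 1) \<le> C * (norm u + 1)"
    proof -
      have "C * (norm u + 1) - N * (norm u / \<delta> + 1) = (N + 1) * norm u + 1 + N / \<delta>" by (simp add: C_def algebra_simps add_divide_distrib)
      also have "\<dots> \<ge> 0" using \<open>0 \<le> N\<close> \<delta>(1) by simp
      finally show ?thesis by simp
    qed
    then show ?thesis using w by (meson order_trans)
  qed
  moreover have "0 < C" using \<open>0 \<le> N\<close> \<delta>(1) by (simp add: C_def add_nonneg_pos)
  ultimately show ?thesis by blast
qed

end


section \<open>The image of a free flow is free\<close>

text \<open>
The pigeonhole principle behind the comparison of volume growth: a cubical grid with side \<open>n + 1\<close>
has more points than a box with one side of fixed length and all other sides of order \<open>n\<close>.
\<close>

lemma grid_no_thin_coding:
  fixes j :: "'n::finite" and b c :: nat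
  assumes g: "\<And>n. \<exists>g :: ('n \<Rightarrow> nat) \<Rightarrow> ('n \<Rightarrow> int). inj_on g {p. \<forall>i. p i \<le> n} \<and>
      (\<forall>p i. (\<forall>i. p i \<le> n) \<longrightarrow> \<bar>g p i\<bar> \<le> int (if i = j then b else c * (n + 1)))"
  shows False
proof -
  define n where "n = (2 * b + 1) * (2 * c + 1) ^ (CARD('n) - 1)"
  obtain g :: "('n \<Rightarrow> nat) \<Rightarrow> ('n \<Rightarrow> int)" where g: "inj_on g {p. \<forall>i. p i \<le> n}"
    "\<And>p i. (\<forall>i. p i \<le> n) \<Longrightarrow> \<bar>g p i\<bar> \<le> int (if i = j then b else c * (n + 1))"
    using g[of n] by blast
  define m where "m i = (if i = j then b else c * (n + 1))" for i
  let ?P = "PiE UNIV (\<lambda>_::'n. {..n})" and ?Q = "PiE UNIV (\<lambda>i. {- int (m i)..int (m i)})"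
  have P: "{p. \<forall>i. p i \<le> n} = ?P" by (auto simp: PiE_def Pi_def)
  have "g p i \<in> {- int (m i)..int (m i)}" if "\<forall>i. p i \<le> n" for p i
    using g(2)[OF that, of i] unfolding m_def by (auto simp: abs_le_iff)
  then have "g ` {p. \<forall>i. p i \<le> n} \<subseteq> ?Q" by (simp add: image_subset_iff PiE_def Pi_def del: atLeastAtMost_iff)
  moreover have "finite ?Q" by (intro finite_PiE) auto
  ultimately have "card ?P \<le> card ?Q" using card_inj_on_le[OF g(1)] unfolding P by blast
  also have "card ?Q = (\<Prod>i\<in>UNIV. 2 * m i + 1)" by (simp add: card_PiE nat_add_distrib nat_mult_distrib)
  also have "\<dots> = (2 * m j + 1) * (\<Prod>i\<in>UNIV - {j}. 2 * m i + 1)" by (rule prod.remove) auto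
  also have "\<dots> \<le> (2 * b + 1) * (\<Prod>i\<in>UNIV - {j}. (2 * c + 1) * (n + 1))"
    by (intro mult_mono prod_mono) (auto simp: m_def)
  also have "\<dots> = (2 * b + 1) * ((2 * c + 1) * (n + 1)) ^ (CARD('n) - 1)"
    by (simp add: card_Diff_singleton del: mult_Suc mult_Suc_right)
  also have "\<dots> = ((2 * b + 1) * (2 * c + 1) ^ (CARD('n) - 1)) * (n + 1) ^ (CARD('n) - 1)"
    by (simp only: power_mult_distrib mult.assoc)
  also have "\<dots> = n * (n + 1) ^ (CARD('n) - 1)" by (simp only: n_def[symmetric])
  also have "\<dots> < (n + 1) * (n + 1) ^ (CARD('n) - 1)" by simp
  also have "\<dots> = (n + 1) ^ CARD('n)" by (simp add: power_eq_if)
  finally show False by (simp add: card_PiE)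
qed

context flow_orbit_equivalence
begin

text \<open>
Suppose \<open>v\<close> is a period of \<open>y\<close>. Translate \<open>k y\<close> by the points of a coarse grid with \<open>(n + 1)\<^sup>d\<close>
elements. The corresponding displacements on the side of \<open>y\<close> have length of order \<open>n\<close>, and modulo multiples
of \<open>v\<close> one of their coordinates can be bounded independently of \<open>n\<close>. Rounding them to
integer vectors is injective on the grid, because nearby points on the orbit of \<open>y\<close> correspond to
nearby points on the orbit of \<open>k y\<close>, while distinct grid points are far apart. This contradicts \<open>grid_no_thin_coding\<close>.
\<close>

lemma image_free:
  assumes "X \<noteq> {}"
  shows "free_on Y actY"
  unfolding free_on_def
proof (intro ballI allI impI)
  fix y v assume y: "y \<in> Y" and v: "actY v y = y"
  show "v = 0"
  proof (rule ccontr)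
    assume "v \<noteq> 0"
    then obtain j where j: "v $ j \<noteq> 0" by (metis vec_eq_iff zero_index)
    obtain C1 where C1: "0 < C1" "\<forall>y\<in>Y. \<forall>v. norm (\<beta> y v) \<le> C1 * (norm v + 1)" using \<beta>_growth by blast
    obtain C2 where C2: "0 < C2" "\<forall>x\<in>X. \<forall>u. \<exists>w. norm w \<le> C2 * (norm u + 1) \<and> h (actX u x) = actY w (h x)"
      using h_growth[OF assms] by blast
    define d where "d = real CARD('n)"
    \<comment> \<open>The mesh \<open>K\<close> exceeds every distance that the rounding of a displacement can hide.\<close>
    define K where "K = C1 * (d + 1) + 1"
    define q where "q = norm v / \<bar>v $ j\<bar>"
    have d: "1 \<le> d" unfolding d_def by (simp add: Suc_le_eq)
    have K: "0 < K" using C1(1) d by (simp add: K_def add_pos_pos)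
    have q: "0 \<le> q" by (simp add: q_def)
    define c where "c = nat \<lceil>C2 * (K * d + 1) * (1 + q) + norm v + 1\<rceil>"
    define b where "b = nat \<lceil>\<bar>v $ j\<bar> + 1\<rceil>"
    define x where "x = k y"
    have x: "x \<in> X" "h x = y" using y k_in hk by (auto simp: x_def)
    have per: "actY (of_int m *\<^sub>R v) y = y" for m
    proof -
      have add: "actY (s + t) y = y" if "actY s y = y" "actY t y = y" for s t
        using Y.act_act[OF y, of t s] that by simp
      have neg: "actY (- v) y = y" using Y.act_act[OF y, of "-v" v] Y.act_zero[OF y] v by simp
      show ?thesis
      proof (induction m rule: int_induct[of _ 0])
        case base then show ?case using Y.act_zero[OF y] by simp
      next
        case (step1 i) then show ?case using add[OF _ v] by (simp add: scaleR_add_left)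
      next
        case (step2 i) then show ?case using add[OF _ neg] by (simp add: scaleR_diff_left)
      qed
    qed
    \<comment> \<open>The grid, and displacements of \<open>h\<close> to its points.\<close>
    define u where "u p = K *\<^sub>R (\<chi> i. real (p i))" for p :: "'n \<Rightarrow> nat"
    have "\<exists>w. norm w \<le> C2 * (norm (u p) + 1) \<and> h (actX (u p) x) = actY w y" for p
      using C2(2) x by metis
    then obtain w where w: "\<And>p. norm (w p) \<le> C2 * (norm (u p) + 1)" "\<And>p. h (actX (u p) x) = actY (w p) y"
      by metis
    \<comment> \<open>Subtracting the multiple \<open>m p\<close> of the period bounds the \<open>j\<close>-th coordinate by \<open>\<bar>v $ j\<bar>\<close>.\<close>
    define m where "m p = \<lfloor>w p $ j / v $ j\<rfloor>" for p
    define w' where "w' p = w p - of_int (m p) *\<^sub>R v" for p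
    have w'_act: "actX (u p) x = k (actY (w' p) y)" for p
    proof -
      have "actY (w' p) y = actY (w p) y"
        using Y.act_act[OF y, of "w' p" "of_int (m p) *\<^sub>R v"] per[of "m p"] by (simp add: w'_def)
      then show ?thesis using w(2)[of p] kh X.act_in x(1) by metis
    qed
    have w'_j: "\<bar>w' p $ j\<bar> \<le> \<bar>v $ j\<bar>" for p
    proof -
      have "w' p $ j = (w p $ j / v $ j - of_int (m p)) * v $ j" using j by (simp add: w'_def field_simps)
      moreover have "\<bar>w p $ j / v $ j - of_int (m p)\<bar> \<le> 1" unfolding m_def by linarith
      ultimately show ?thesis by (simp add: abs_mult mult_left_le_one_le)
    qed
    have w'_norm: "norm (w' p) \<le> norm (w p) * (1 + q) + norm v" for p
    proof -
      have "\<bar>of_int (m p)\<bar> \<le> \<bar>w p $ j / v $ j\<bar> + 1" unfolding m_def by linarith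
      also have "\<dots> \<le> norm (w p) / \<bar>v $ j\<bar> + 1"
        using component_le_norm_cart[of "w p" j] by (simp add: abs_divide divide_right_mono)
      finally have "\<bar>of_int (m p)\<bar> * norm v \<le> (norm (w p) / \<bar>v $ j\<bar> + 1) * norm v"
        by (rule mult_right_mono) simp
      also have "\<dots> = norm (w p) * q + norm v" by (simp add: q_def algebra_simps)
      finally have "\<bar>of_int (m p)\<bar> * norm v \<le> norm (w p) * q + norm v" .
      then show ?thesis
        using norm_triangle_ineq4[of "w p" "of_int (m p) *\<^sub>R v"] by (simp add: w'_def algebra_simps)
    qed
    have u_norm: "norm (u p) \<le> K * d * real n" if "\<forall>i. p i \<le> n" for p n
    proof -
      have "norm (\<chi> i. real (p i)) \<le> (\<Sum>i\<in>UNIV. \<bar>(\<chi> i. real (p i)) $ i\<bar>)" by (rule norm_le_l1_cart)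
      also have "\<dots> \<le> (\<Sum>i\<in>(UNIV::'n set). real n)" using that by (intro sum_mono) simp
      also have "\<dots> = d * real n" by (simp add: d_def)
      finally show ?thesis using K by (simp add: u_def)
    qed
    define g where "g p i = \<lfloor>w' p $ i\<rfloor>" for p i
    have "inj_on g {p. \<forall>i. p i \<le> n}" for n
    proof (rule inj_onI)
      fix p p' assume "g p = g p'"
      then have fl: "\<lfloor>w' p $ i\<rfloor> = \<lfloor>w' p' $ i\<rfloor>" for i unfolding g_def by metis
      have "\<bar>(w' p - w' p') $ i\<bar> \<le> 1" for i using fl[of i] by simp linarith
      then have "(\<Sum>i\<in>UNIV. \<bar>(w' p - w' p') $ i\<bar>) \<le> (\<Sum>i\<in>(UNIV::'n set). 1)" by (intro sum_mono) simp
      then have wd: "norm (w' p - w' p') \<le> d"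
        using norm_le_l1_cart[of "w' p - w' p'"] by (simp add: d_def)
      define z where "z = actY (w' p') y"
      have z: "z \<in> Y" using Y.act_in y by (simp add: z_def)
      have "actX (u p) x = k (actY (w' p - w' p') z)"
        using w'_act[of p] Y.act_act[OF y] by (simp add: z_def)
      also have "\<dots> = actX (\<beta> z (w' p - w' p')) (actX (u p') x)"
        using \<beta>[OF z] w'_act[of p'] by (simp add: z_def)
      also have "\<dots> = actX (u p' + \<beta> z (w' p - w' p')) x" using X.act_act[OF x(1)] by simp
      finally have "u p - u p' = \<beta> z (w' p - w' p')" using X.act_eqD[OF free x(1)] by fastforce
      then have "norm (u p - u p') \<le> C1 * (norm (w' p - w' p') + 1)" using C1(2) z by simp
      also have "\<dots> \<le> C1 * (d + 1)" using wd C1(1) by (intro mult_left_mono) auto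
      finally have ud: "norm (u p - u p') < K" by (simp add: K_def)
      show "p = p'"
      proof (rule ccontr)
        assume "p \<noteq> p'"
        then obtain i where "p i \<noteq> p' i" by blast
        then have "1 \<le> \<bar>real (p i) - real (p' i)\<bar>" by linarith
        then have "K * 1 \<le> K * \<bar>real (p i) - real (p' i)\<bar>" using K by (intro mult_left_mono) auto
        also have "\<dots> = \<bar>(u p - u p') $ i\<bar>" using K by (simp add: u_def abs_mult right_diff_distrib[symmetric])
        also have "\<dots> \<le> norm (u p - u p')" by (rule component_le_norm_cart)
        finally show False using ud by simp
      qed
    qed
    moreover have "\<bar>g p i\<bar> \<le> int (if i = j then b else c * (n + 1))" if p: "\<forall>i. p i \<le> n" for p i n
    proof -
      have fl: "\<bar>g p i\<bar> \<le> \<bar>w' p $ i\<bar> + 1" unfolding g_def by linarith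
      show ?thesis
      proof (cases "i = j")
        case True
        have "\<bar>w' p $ j\<bar> + 1 \<le> real b" using w'_j[of p] unfolding b_def by linarith
        then show ?thesis using True fl by simp
      next
        case False
        have "norm (w p) \<le> C2 * (K * d * real n + 1)"
          using w(1)[of p] u_norm[OF p] C2(1) by (smt (verit) mult_left_mono)
        also have "\<dots> \<le> C2 * ((K * d + 1) * (real n + 1))"
          using C2(1) K d by (intro mult_left_mono) (auto simp: algebra_simps)
        finally have "norm (w p) * (1 + q) \<le> C2 * ((K * d + 1) * (real n + 1)) * (1 + q)"
          using q by (intro mult_right_mono) auto
        moreover have "norm v + 1 \<le> (norm v + 1) * (real n + 1)" by (simp add: algebra_simps)
        ultimately have "norm (w' p) + 1 \<le> C2 * ((K * d + 1) * (real n + 1)) * (1 + q) + (norm v + 1) * (real n + 1)"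
          using w'_norm[of p] by linarith
        also have "\<dots> = (C2 * (K * d + 1) * (1 + q) + norm v + 1) * (real n + 1)" by (simp add: algebra_simps)
        also have "\<dots> \<le> real c * (real n + 1)" unfolding c_def by (intro mult_right_mono) linarith+
        finally have "\<bar>w' p $ i\<bar> + 1 \<le> real (c * (n + 1))"
          using component_le_norm_cart[of "w' p" i] by (simp add: algebra_simps)
        then have "real_of_int \<bar>g p i\<bar> \<le> real (c * (n + 1))" using fl by linarith
        then have "\<bar>g p i\<bar> \<le> int (c * (n + 1))" by linarith
        then show ?thesis using False by simp
      qed
    qed
    ultimately have "\<exists>g :: ('n \<Rightarrow> nat) \<Rightarrow> ('n \<Rightarrow> int). inj_on g {p. \<forall>i. p i \<le> n} \<and>
      (\<forall>p i. (\<forall>i. p i \<le> n) \<longrightarrow> \<bar>g p i\<bar> \<le> int (if i = j then b else c * (n + 1)))" for n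
      by (intro exI[of _ g]) blast
    then show False by (rule grid_no_thin_coding)
  qed
qed

text \<open>
The lower bound on the growth of \<open>\<alpha>\<close> is the upper bound on the growth of the inverse displacement.
\<close>

lemma orbit_cocycle:
  assumes "X \<noteq> {}"
  obtains \<alpha> C where
    "\<And>x u. x \<in> X \<Longrightarrow> h (actX u x) = actY (\<alpha> x u) (h x)"
    "continuous_on (X \<times> UNIV) (\<lambda>(x, u). \<alpha> x u)"
    "\<And>x u v. x \<in> X \<Longrightarrow> \<alpha> x (u + v) = \<alpha> x u + \<alpha> (actX u x) v"
    "\<And>x. x \<in> X \<Longrightarrow> bij (\<alpha> x)"
    "0 < C" "\<And>x u. x \<in> X \<Longrightarrow> norm u \<le> C * (norm (\<alpha> x u) + 1)"
proof -
  note Yfree = image_free[OF assms]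
  have "\<exists>\<alpha>. (\<forall>x\<in>X. \<forall>u. h (actX u x) = actY (\<alpha> x u) (h x)) \<and>
      continuous_on (X \<times> UNIV) (\<lambda>(x, u). \<alpha> x u)"
  proof (rule continuous_cocycle_of_free_flow[of X actX Y actY h])
    show "\<exists>w. h (actX v x) = actY w (h x)" if "x \<in> X" for x v using h_orbit[OF that] .
    show "h ` X \<subseteq> Y" using h_in by blast
  qed (fact X.compact_flow_axioms Y.compact_flow_axioms h_cont Yfree)+
  then obtain \<alpha> where \<alpha>: "\<And>x u. x \<in> X \<Longrightarrow> h (actX u x) = actY (\<alpha> x u) (h x)"
    and cont: "continuous_on (X \<times> UNIV) (\<lambda>(x, u). \<alpha> x u)" by metis
  obtain C where C: "0 < C" "\<forall>y\<in>Y. \<forall>v. norm (\<beta> y v) \<le> C * (norm v + 1)" using \<beta>_growth by blast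
  have \<beta>\<alpha>: "\<beta> (h x) (\<alpha> x u) = u" if x: "x \<in> X" for x u
  proof -
    have "actX (\<beta> (h x) (\<alpha> x u)) x = actX u x"
      using \<beta>[OF h_in[OF x], of "\<alpha> x u"] \<alpha>[OF x, of u] kh[OF x] kh[OF X.act_in[OF x, of u]] by simp
    then show ?thesis by (rule X.act_eqD[OF free x])
  qed
  have \<alpha>\<beta>: "\<alpha> x (\<beta> (h x) w) = w" if x: "x \<in> X" for x w
  proof -
    have "actY (\<alpha> x (\<beta> (h x) w)) (h x) = actY w (h x)"
      using \<beta>[OF h_in[OF x], of w] \<alpha>[OF x, of "\<beta> (h x) w"] kh[OF x] hk[OF Y.act_in[OF h_in[OF x], of w]] by simp
    then show ?thesis by (rule Y.act_eqD[OF Yfree h_in[OF x]])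
  qed
  show ?thesis
  proof (rule that[OF \<alpha> cont _ _ C(1)])
    fix x u v assume x: "x \<in> X"
    have "actY (\<alpha> x (u + v)) (h x) = h (actX v (actX u x))" using \<alpha>[OF x] X.act_act[OF x] by simp
    also have "\<dots> = actY (\<alpha> (actX u x) v) (actY (\<alpha> x u) (h x))" using \<alpha> x X.act_in by simp
    also have "\<dots> = actY (\<alpha> x u + \<alpha> (actX u x) v) (h x)" using Y.act_act h_in x by simp
    finally show "\<alpha> x (u + v) = \<alpha> x u + \<alpha> (actX u x) v" by (rule Y.act_eqD[OF Yfree h_in[OF x]])
    show "bij (\<alpha> x)" using \<beta>\<alpha>[OF x] \<alpha>\<beta>[OF x] by (rule o_bij[OF ext ext, unfolded comp_def id_def])
    show "norm u \<le> C * (norm (\<alpha> x u) + 1)" using C(2) h_in[OF x] \<beta>\<alpha>[OF x, of u] by metis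
  qed
qed

end


section \<open>Weak limits of probability measures on compact spaces\<close>

text \<open>
The sigma-algebra is generated by relatively open sets, the form in which invariant measures on tiling
spaces are given.
\<close>

definition relative_borel :: "'a::topological_space set \<Rightarrow> 'a measure" where
  "relative_borel X = sigma X {U. openin (top_of_set X) U}"

lemma space_relative_borel [simp]: "space (relative_borel X) = X"
  by (simp add: relative_borel_def space_measure_of_conv)

lemma sets_relative_borel: "sets (relative_borel X) = sigma_sets X {U. openin (top_of_set X) U}"
  unfolding relative_borel_def by (rule sets_measure_of) (auto dest: openin_imp_subset)

lemma borel_measurable_relative_borel:
  fixes F :: "'a::topological_space \<Rightarrow> 'b::topological_space"
  assumes "continuous_on X F"
  shows "F \<in> borel_measurable (relative_borel X)"
proof (rule borel_measurableI)
  fix S :: "'b set" assume "open S"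
  then have "openin (top_of_set X) (X \<inter> F -` S)" using assms continuous_openin_preimage_gen by blast
  then show "F -` S \<inter> space (relative_borel X) \<in> sets (relative_borel X)"
    by (simp add: sets_relative_borel sigma_sets.Basic Int_commute)
qed

lemma measurable_into_relative_borel:
  assumes "f \<in> borel_measurable M" "f \<in> space M \<rightarrow> X"
  shows "f \<in> M \<rightarrow>\<^sub>M relative_borel X"
  unfolding relative_borel_def
proof (rule measurable_measure_of)
  fix U assume "U \<in> {U. openin (top_of_set X) U}"
  then obtain V where "open V" "U = X \<inter> V" by (auto simp: openin_open)
  moreover from this have "f -` U \<inter> space M = f -` V \<inter> space M" using assms(2) by blast
  ultimately show "f -` U \<inter> space M \<in> sets M" using assms(1) by (metis borel_open measurable_sets)
qed (use assms in \<open>auto dest: openin_imp_subset\<close>)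

lemma integral_uniform_measure_eq:
  fixes f :: "'a \<Rightarrow> real"
  assumes "A \<in> sets M" "emeasure M A = ennreal c" "0 < c" "f \<in> borel_measurable M"
  shows "integral\<^sup>L (uniform_measure M A) f = (LINT x:A|M. f x) / c"
proof -
  have "(\<lambda>x. indicator A x / emeasure M A) = (\<lambda>x. ennreal (indicator A x / c))"
    using assms(2,3) by (simp add: divide_ennreal[symmetric] ennreal_indicator)
  then have "integral\<^sup>L (uniform_measure M A) f = integral\<^sup>L M (\<lambda>x. (indicator A x / c) *\<^sub>R f x)"
    unfolding uniform_measure_def using assms by (simp add: integral_density)
  also have "\<dots> = integral\<^sup>L M (\<lambda>x. (indicator A x *\<^sub>R f x) / c)" by simp
  finally show ?thesis by (simp add: set_lebesgue_integral_def)
qed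

text \<open>
Points of the Cantor set are determined by their ternary digits, and continuously so: at the first
index where two digit sequences differ, the difference is at least twice as large as all later ones together.
\<close>

lemma ternary_code_separates:
  fixes a b :: "nat \<Rightarrow> bool"
  defines "s \<equiv> \<lambda>a. \<Sum>n. 2 * of_bool (a n) / 3 ^ Suc n :: real"
  assumes "\<bar>s a - s b\<bar> < 1 / 3 ^ Suc N" "n \<le> N"
  shows "a n = b n"
proof (rule ccontr)
  define t where "t a n = (2 * of_bool (a n) / 3 ^ Suc n :: real)" for a n
  have geo: "summable (\<lambda>n. 2 / 3 * (1 / 3) ^ n :: real)" by (rule summable_mult[OF summable_geometric]) simp
  have summ: "summable (t a)" for a
    by (rule summable_comparison_test'[OF geo, of 0]) (simp add: t_def power_divide of_bool_def)
  assume "a n \<noteq> b n"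
  define m where "m = (LEAST n. a n \<noteq> b n)"
  have m: "a m \<noteq> b m" unfolding m_def by (rule LeastI) fact
  have below: "a i = b i" if "i < m" for i using not_less_Least[of i "\<lambda>n. a n \<noteq> b n"] that unfolding m_def by blast
  have "m \<le> n" unfolding m_def by (rule Least_le) fact
  \<comment> \<open>The first differing term has absolute value \<open>2 / 3 ^ Suc m\<close>, the later ones sum up to at most \<open>1 / 3 ^ Suc m\<close>.\<close>
  define d where "d i = t a i - t b i" for i
  have d_summ: "summable d" unfolding d_def by (intro summable_diff summ)
  have "s a - s b = suminf d"
    unfolding s_def d_def t_def[symmetric] by (rule suminf_diff[OF summ summ])
  also have "\<dots> = (\<Sum>i. d (i + Suc m)) + (\<Sum>i<Suc m. d i)" by (rule suminf_split_initial_segment[OF d_summ])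
  also have "(\<Sum>i<Suc m. d i) = d m" using below by (simp add: d_def t_def)
  finally have split: "s a - s b = (\<Sum>i. d (i + Suc m)) + d m" .
  have dm: "\<bar>d m\<bar> = 2 / 3 ^ Suc m" using m by (auto simp: d_def t_def)
  have geo': "(\<lambda>i. (2 / 3 / 3 ^ Suc m) * (1 / 3) ^ i) sums (1 / 3 ^ Suc m :: real)"
  proof -
    have "(\<lambda>i. (2 / 3 / 3 ^ Suc m) * (1 / 3) ^ i) sums ((2 / 3 / 3 ^ Suc m) * (1 / (1 - 1 / 3)) :: real)"
      by (rule sums_mult[OF geometric_sums]) simp
    then show ?thesis by simp
  qed
  have "\<bar>\<Sum>i. d (i + Suc m)\<bar> \<le> (\<Sum>i. (2 / 3 / 3 ^ Suc m) * (1 / 3) ^ i)"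
  proof -
    have bd: "norm (d (i + Suc m)) \<le> (2 / 3 / 3 ^ Suc m) * (1 / 3) ^ i" for i
      by (simp add: d_def t_def power_divide power_add of_bool_def mult_ac)
    have "norm (\<Sum>i. d (i + Suc m)) \<le> (\<Sum>i. (2 / 3 / 3 ^ Suc m) * (1 / 3) ^ i)"
      by (rule norm_suminf_le[OF bd sums_summable[OF geo']])
    then show ?thesis by simp
  qed
  also have "\<dots> = 1 / 3 ^ Suc m" using geo' by (rule sums_unique[symmetric])
  finally have "1 / 3 ^ Suc m \<le> \<bar>s a - s b\<bar>" using split dm by linarith
  moreover have "1 / 3 ^ Suc N \<le> (1 / 3 ^ Suc m :: real)"
    using \<open>m \<le> n\<close> assms(3) by (intro divide_left_mono power_increasing) auto
  ultimately show False using assms(2) by linarith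
qed

text \<open>
The digits of the code of \<open>x\<close> record in which balls of finite covers with radii tending to \<open>0\<close> the
point lies. If the digits of \<open>x\<close> and \<open>y\<close> agree for all balls of one cover, then \<open>x\<close> and \<open>y\<close> share a
ball of this cover. The code is only Borel, but its inverse is uniformly continuous, and that is what the
transport of weak limits needs.
\<close>

lemma compact_borel_code:
  fixes X :: "'a::metric_space set"
  assumes "compact X"
  obtains \<sigma> :: "'a \<Rightarrow> real" where "\<sigma> \<in> borel_measurable borel" "\<And>x. 0 \<le> \<sigma> x \<and> \<sigma> x \<le> 1"
    "\<And>e. 0 < e \<Longrightarrow> \<exists>\<delta>>0. \<forall>x\<in>X. \<forall>y\<in>X. \<bar>\<sigma> x - \<sigma> y\<bar> < \<delta> \<longrightarrow> dist x y < e"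
proof -
  have "\<exists>k. finite k \<and> X \<subseteq> (\<Union>x\<in>k. ball x (1 / real (Suc m)))" for m
    using assms unfolding compact_eq_totally_bounded by simp
  then obtain k where k: "\<And>m. finite (k m)" "\<And>m. X \<subseteq> (\<Union>x\<in>k m. ball x (1 / real (Suc m)))" by metis
  define B where "B = insert {} (\<Union>m. (\<lambda>x. ball x (1 / real (Suc m))) ` k m)"
  have B: "countable B" "B \<noteq> {}"
    unfolding B_def by (intro countable_insert countable_UN countable_image) (auto intro: countable_finite k(1))
  define U where "U = from_nat_into B"
  have U: "range U = B" using B by (simp add: U_def)
  have openU: "open (U n)" for n
  proof -
    have "U n \<in> B" using U by blast
    then show ?thesis by (auto simp: B_def)
  qed
  define \<sigma> where "\<sigma> x = (\<Sum>n. 2 * of_bool (x \<in> U n) / 3 ^ Suc n :: real)" for x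
  have geo: "(\<lambda>n. 2 / 3 * (1 / 3) ^ n) sums (1::real)"
  proof -
    have "(\<lambda>n. (2 / 3) * (1 / 3) ^ n) sums ((2 / 3) * (1 / (1 - 1 / 3)) :: real)"
      by (rule sums_mult[OF geometric_sums]) simp
    then show ?thesis by simp
  qed
  have summ: "summable (\<lambda>n. 2 * of_bool (x \<in> U n) / 3 ^ Suc n :: real)" for x
    by (rule summable_comparison_test'[OF sums_summable[OF geo], of 0]) (simp add: power_divide of_bool_def)
  have "\<sigma> \<in> borel_measurable borel"
  proof -
    have "(\<lambda>x. \<Sum>n. 2 * indicator (U n) x / 3 ^ Suc n :: real) \<in> borel_measurable borel"
      using openU by (intro borel_measurable_suminf) (auto intro!: borel_measurable_times borel_measurable_divide)
    then show ?thesis unfolding \<sigma>_def by (simp add: indicator_def of_bool_def)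
  qed
  moreover have "0 \<le> \<sigma> x \<and> \<sigma> x \<le> 1" for x
  proof
    show "0 \<le> \<sigma> x" unfolding \<sigma>_def by (rule suminf_nonneg[OF summ]) simp
    have "\<sigma> x \<le> (\<Sum>n. 2 / 3 * (1 / 3) ^ n)"
      unfolding \<sigma>_def by (rule suminf_le[OF _ summ sums_summable[OF geo]]) (simp add: power_divide of_bool_def)
    then show "\<sigma> x \<le> 1" using sums_unique[OF geo] by simp
  qed
  moreover have "\<exists>\<delta>>0. \<forall>x\<in>X. \<forall>y\<in>X. \<bar>\<sigma> x - \<sigma> y\<bar> < \<delta> \<longrightarrow> dist x y < e" if "0 < e" for e
  proof -
    obtain m where m: "1 / real (Suc m) < e / 2" using \<open>0 < e\<close> nat_approx_posE by (metis half_gt_zero)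
    have "\<forall>x\<in>k m. \<exists>n. U n = ball x (1 / real (Suc m))"
    proof
      fix x assume "x \<in> k m"
      then have "ball x (1 / real (Suc m)) \<in> range U" unfolding U B_def by blast
      then show "\<exists>n. U n = ball x (1 / real (Suc m))" by force
    qed
    then obtain i where i: "\<And>x. x \<in> k m \<Longrightarrow> U (i x) = ball x (1 / real (Suc m))" by metis
    define N where "N = Max (insert 0 (i ` k m))"
    have N: "i x \<le> N" if "x \<in> k m" for x using k(1) that by (simp add: N_def)
    have "dist x y < e" if xy: "x \<in> X" "y \<in> X" "\<bar>\<sigma> x - \<sigma> y\<bar> < 1 / 3 ^ Suc N" for x y
    proof -
      obtain z where z: "z \<in> k m" "x \<in> ball z (1 / real (Suc m))" using k(2) xy(1) by blast
      have "(x \<in> U (i z)) = (y \<in> U (i z))"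
        by (rule ternary_code_separates[OF _ N[OF z(1)]]) (use xy(3) in \<open>simp add: \<sigma>_def\<close>)
      then have "y \<in> ball z (1 / real (Suc m))" using z i by simp
      then show ?thesis using z(2) m dist_triangle3[of x y z] by simp
    qed
    then show ?thesis by (intro exI[of _ "1 / 3 ^ Suc N"]) simp
  qed
  ultimately show ?thesis by (rule that)
qed

text \<open>
Prokhorov's theorem for a compact metric space. The measures are pushed to the unit interval by the code
\<open>\<sigma>\<close>, where Helly's theorem gives a weakly convergent subsequence. The inverse of \<open>\<sigma>\<close> extends
continuously to the closure \<open>C\<close> of the range, the limit measure lives on \<open>C\<close>, and it is pushed back
by this extension. A continuous function on \<open>X\<close> becomes a continuous function on \<open>C\<close>, which
Tietze's theorem extends to the line.
\<close>

theorem compact_weak_limit: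
  fixes X :: "'a::complete_space set" and \<mu> :: "nat \<Rightarrow> 'a measure"
  assumes X: "compact X" "X \<noteq> {}"
    and \<mu>: "\<And>k. prob_space (\<mu> k)" "\<And>k. sets (\<mu> k) = sets (relative_borel X)"
  shows "\<exists>r N. strict_mono (r :: nat \<Rightarrow> nat) \<and> prob_space N \<and> sets N = sets (relative_borel X) \<and>
    (\<forall>F :: 'a \<Rightarrow> real. continuous_on X F \<longrightarrow> (\<lambda>k. integral\<^sup>L (\<mu> (r k)) F) \<longlonglongrightarrow> integral\<^sup>L N F)"
proof -
  obtain \<sigma> :: "'a \<Rightarrow> real" where \<sigma>: "\<sigma> \<in> borel_measurable borel" "\<And>x. 0 \<le> \<sigma> x \<and> \<sigma> x \<le> 1"
    "\<And>e. 0 < e \<Longrightarrow> \<exists>\<delta>>0. \<forall>x\<in>X. \<forall>y\<in>X. \<bar>\<sigma> x - \<sigma> y\<bar> < \<delta> \<longrightarrow> dist x y < e"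
    using compact_borel_code[OF X(1)] by blast
  have space: "space (\<mu> k) = X" for k using sets_eq_imp_space_eq[OF \<mu>(2)] by simp
  have id_m: "(\<lambda>x. x) \<in> borel_measurable (\<mu> k)" for k
    using borel_measurable_relative_borel[OF continuous_on_id, of X] measurable_cong_sets[OF \<mu>(2) refl] by blast
  have \<sigma>_m: "\<sigma> \<in> borel_measurable (\<mu> k)" for k
    using measurable_compose[OF id_m \<sigma>(1)] by simp
  define \<nu> where "\<nu> k = distr (\<mu> k) borel \<sigma>" for k
  have \<nu>: "real_distribution (\<nu> k)" for k
    unfolding \<nu>_def real_distribution_def real_distribution_axioms_def
    using prob_space.prob_space_distr[OF \<mu>(1) \<sigma>_m] by simp
  have "tight \<nu>"
    unfolding tight_def
  proof (intro conjI allI impI \<nu>)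
    fix e :: real assume "0 < e"
    have "measure (\<nu> k) {-1<..1} = 1" for k
    proof -
      have "-1 < \<sigma> x \<and> \<sigma> x \<le> 1" for x using \<sigma>(2)[of x] by auto
      then have "\<sigma> -` {-1<..1} \<inter> space (\<mu> k) = space (\<mu> k)" by auto
      then show ?thesis unfolding \<nu>_def using prob_space.prob_space[OF \<mu>(1)] by (simp add: measure_distr[OF \<sigma>_m])
    qed
    then have "(-1 :: real) < 1 \<and> (\<forall>n. 1 - e < measure (\<nu> n) {-1<..1})" using \<open>0 < e\<close> by simp
    then show "\<exists>a b. a < b \<and> (\<forall>n. 1 - e < measure (\<nu> n) {a<..b})" by blast
  qed
  then obtain r M where r: "strict_mono (r :: nat \<Rightarrow> nat)" "real_distribution M" "weak_conv_m (\<nu> \<circ> id \<circ> r) M"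
    using tight_imp_convergent_subsubsequence[of \<nu> id] by (auto simp: strict_mono_id)
  interpret M: real_distribution M by fact
  have conv: "(\<lambda>k. integral\<^sup>L (\<nu> (r k)) G) \<longlonglongrightarrow> integral\<^sup>L M G"
    if "\<And>x. isCont G x" "\<And>x. norm (G x) \<le> B" for G :: "real \<Rightarrow> real" and B
    using weak_conv_imp_integral_bdd_continuous_conv[of "\<nu> \<circ> id \<circ> r" M, OF _ r(2,3) that] \<nu>
    by (simp add: comp_def)
  have inj: "x = y" if "x \<in> X" "y \<in> X" "\<sigma> x = \<sigma> y" for x y
  proof (rule ccontr)
    assume "x \<noteq> y"
    then obtain d where "0 < d" "\<forall>x'\<in>X. \<forall>y'\<in>X. \<bar>\<sigma> x' - \<sigma> y'\<bar> < d \<longrightarrow> dist x' y' < dist x y"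
      using \<sigma>(3)[of "dist x y"] by auto
    then show False using that by force
  qed
  then have inv: "inv_into X \<sigma> (\<sigma> x) = x" if "x \<in> X" for x
    using that by (intro inv_into_f_f inj_onI) blast+
  define C where "C = closure (\<sigma> ` X)"
  have "uniformly_continuous_on (\<sigma> ` X) (inv_into X \<sigma>)"
    unfolding uniformly_continuous_on_def
  proof (intro allI impI)
    fix e :: real assume "0 < e"
    then obtain d where d: "0 < d" "\<forall>x\<in>X. \<forall>y\<in>X. \<bar>\<sigma> x - \<sigma> y\<bar> < d \<longrightarrow> dist x y < e" using \<sigma>(3) by blast
    show "\<exists>d>0. \<forall>x\<in>\<sigma> ` X. \<forall>x'\<in>\<sigma> ` X. dist x' x < d \<longrightarrow> dist (inv_into X \<sigma> x') (inv_into X \<sigma> x) < e"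
      using d inv by (intro exI[of _ d]) (auto simp: dist_real_def)
  qed
  then obtain g where g: "uniformly_continuous_on C g" "\<And>t. t \<in> \<sigma> ` X \<Longrightarrow> inv_into X \<sigma> t = g t"
    using uniformly_continuous_on_extension_on_closure unfolding C_def by (metis (no_types))
  have g\<sigma>: "g (\<sigma> x) = x" if "x \<in> X" for x using g(2)[of "\<sigma> x"] inv[OF that] that by simp
  have g_cont: "continuous_on C g" using g(1) by (rule uniformly_continuous_imp_continuous)
  have gX: "g ` C \<subseteq> X"
    unfolding C_def by (rule image_closure_subset) (use g_cont g\<sigma> compact_imp_closed[OF X(1)] in \<open>auto simp: C_def\<close>)
  obtain x0 where x0: "x0 \<in> X" using X(2) by blast
  have Cne: "C \<noteq> {}" "closed C" and \<sigma>C: "\<And>x. x \<in> X \<Longrightarrow> \<sigma> x \<in> C"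
    using x0 closure_subset[of "\<sigma> ` X"] by (auto simp: C_def)
  have AE_C: "AE t in M. t \<in> C"
  proof -
    define G where "G t = min 1 (infdist t C)" for t :: real
    have G: "isCont G t" "norm (G t) \<le> 1" "0 \<le> G t" for t
      unfolding G_def by (intro continuous_intros) (auto simp: infdist_nonneg)
    have "integral\<^sup>L (\<nu> k) G = 0" for k
    proof -
      have "integral\<^sup>L (\<nu> k) G = integral\<^sup>L (\<mu> k) (\<lambda>x. G (\<sigma> x))"
        unfolding \<nu>_def using G(1) by (intro integral_distr \<sigma>_m borel_measurable_continuous_onI continuous_at_imp_continuous_on) auto
      also have "\<dots> = integral\<^sup>L (\<mu> k) (\<lambda>x. 0)"
        by (intro Bochner_Integration.integral_cong) (auto simp: G_def space \<sigma>C infdist_zero)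
      finally show ?thesis by simp
    qed
    then have "integral\<^sup>L M G = 0" using conv[OF G(1,2)] by (simp add: LIMSEQ_const_iff)
    moreover have "G \<in> borel_measurable borel"
      using G(1) by (intro borel_measurable_continuous_onI continuous_at_imp_continuous_on) auto
    then have "integrable M G" using G(2) by (intro M.integrable_const_bound[of _ 1]) auto
    ultimately have "AE t in M. G t = 0" using integral_nonneg_eq_0_iff_AE G(3) by blast
    then show ?thesis
      by eventually_elim (use Cne infdist_nonneg[of _ C] in \<open>auto simp: G_def in_closed_iff_infdist_zero min_def split: if_splits\<close>)
  qed
  \<comment> \<open>The limit measure is carried by \<open>C\<close>, so any point of \<open>X\<close> will do as a value elsewhere.\<close>
  define g' where "g' t = (if t \<in> C then g t else x0)" for t
  have "g' \<in> borel_measurable borel"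
    unfolding g'_def using Cne(2) g_cont by (intro borel_measurable_continuous_on_if) auto
  then have g'_m: "g' \<in> M \<rightarrow>\<^sub>M relative_borel X"
    using gX x0 by (intro measurable_into_relative_borel) (auto simp: g'_def image_subset_iff)
  define N where "N = distr M (relative_borel X) g'"
  show ?thesis
  proof (intro exI[of _ r] exI[of _ N] conjI allI impI)
    show "prob_space N" unfolding N_def using g'_m by (rule M.prob_space_distr)
    show "sets N = sets (relative_borel X)" by (simp add: N_def)
    fix F :: "'a \<Rightarrow> real" assume F: "continuous_on X F"
    obtain B where "\<forall>y \<in> F ` X. norm y \<le> B"
      using compact_imp_bounded[OF compact_continuous_image[OF F X(1)]] unfolding bounded_iff by metis
    then have B: "\<And>x. x \<in> X \<Longrightarrow> norm (F x) \<le> B" by blast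
    have "continuous_on C (\<lambda>t. F (g t))" using F g_cont gX by (intro continuous_on_compose2[OF F g_cont]) auto
    moreover have "closedin (top_of_set UNIV) C" using Cne by (simp add: closed_closedin[symmetric])
    moreover have "0 \<le> B" using B[OF x0] norm_ge_zero order_trans by blast
    moreover have "norm (F (g t)) \<le> B" if "t \<in> C" for t using B gX that by blast
    ultimately obtain G where G: "continuous_on UNIV G" "\<And>t. t \<in> C \<Longrightarrow> G t = F (g t)" "\<And>t. t \<in> UNIV \<Longrightarrow> norm (G t) \<le> B"
      using Tietze[of C "\<lambda>t. F (g t)" UNIV B] by metis
    have Gm: "G \<in> borel_measurable borel" using G(1) by (rule borel_measurable_continuous_onI)
    have F_m: "F \<in> borel_measurable (relative_borel X)" using F by (rule borel_measurable_relative_borel)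
    have "integral\<^sup>L (\<mu> k) F = integral\<^sup>L (\<nu> k) G" for k
    proof -
      have "integral\<^sup>L (\<nu> k) G = integral\<^sup>L (\<mu> k) (\<lambda>x. G (\<sigma> x))"
        unfolding \<nu>_def by (intro integral_distr \<sigma>_m Gm)
      also have "\<dots> = integral\<^sup>L (\<mu> k) F"
        by (intro Bochner_Integration.integral_cong) (auto simp: space G(2) \<sigma>C g\<sigma>)
      finally show ?thesis by simp
    qed
    moreover have "integral\<^sup>L N F = integral\<^sup>L M G"
    proof -
      have "integral\<^sup>L N F = integral\<^sup>L M (\<lambda>t. F (g' t))" unfolding N_def by (rule integral_distr[OF g'_m F_m])
      also have "\<dots> = integral\<^sup>L M G"
        using AE_C measurable_compose[OF g'_m F_m] Gm
        by (intro integral_cong_AE) (auto simp: g'_def G(2))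
      finally show ?thesis .
    qed
    ultimately show "(\<lambda>k. integral\<^sup>L (\<mu> (r k)) F) \<longlonglongrightarrow> integral\<^sup>L N F"
      using conv[of G B] G by (simp add: continuous_on_eq_continuous_at)
  qed (fact r)
qed


section \<open>Unique ergodicity and averages over cubes\<close>

text \<open>
The indicator of a relatively open set is the limit of the bounded continuous functions
\<open>min 1 (n * infdist x (- V))\<close>.
\<close>

lemma measure_eqI_continuous_integrals:
  fixes X :: "'a::metric_space set"
  assumes "prob_space M" "prob_space N" and M: "sets M = sets (relative_borel X)" and N: "sets N = sets (relative_borel X)"
    and int: "\<And>F :: 'a \<Rightarrow> real. continuous_on X F \<Longrightarrow> integral\<^sup>L M F = integral\<^sup>L N F"
  shows "M = N"
proof (rule measure_eqI_generator_eq)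
  interpret M: prob_space M by fact
  interpret N: prob_space N by fact
  let ?E = "{U. openin (top_of_set X) U}"
  have sM: "space M = X" and sN: "space N = X" using sets_eq_imp_space_eq[OF M] sets_eq_imp_space_eq[OF N] by simp_all
  show "Int_stable ?E" by (auto simp: Int_stable_def)
  show "?E \<subseteq> Pow X" by (auto dest: openin_imp_subset)
  show "sets M = sigma_sets X ?E" "sets N = sigma_sets X ?E" using M N by (simp_all add: sets_relative_borel)
  show "range (\<lambda>_::nat. X) \<subseteq> ?E" "(\<Union>_::nat. X) = X" "emeasure M X \<noteq> \<infinity>" by auto
  fix U assume "U \<in> ?E"
  then obtain V where V: "open V" "U = X \<inter> V" by (auto simp: openin_open)
  have U: "U \<in> sets M" "U \<in> sets N" using \<open>U \<in> ?E\<close> M N by (auto simp: sets_relative_borel sigma_sets.Basic)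
  show "emeasure M U = emeasure N U"
  proof (cases "V = UNIV")
    case True
    then show ?thesis using V M.emeasure_space_1 N.emeasure_space_1 sM sN by simp
  next
    case False
    define f where "f n x = min 1 (real n * infdist x (- V))" for n x
    have f: "continuous_on X (f n)" "0 \<le> f n x" "f n x \<le> 1" for n x
      unfolding f_def by (intro continuous_intros) (auto simp: infdist_nonneg)
    have lim: "(\<lambda>n. f n x) \<longlonglongrightarrow> indicator U x" if "x \<in> X" for x
    proof (cases "x \<in> V")
      case True
      then have pos: "0 < infdist x (- V)"
        using V(1) False infdist_pos_not_in_closed[of "- V" x] by auto
      obtain n0 :: nat where n0: "1 / infdist x (- V) < real n0" using reals_Archimedean2 by blast
      have "f n x = 1" if "n0 \<le> n" for n
      proof -
        have "1 / infdist x (- V) \<le> real n" using n0 that by simp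
        then have "1 \<le> real n * infdist x (- V)" using pos by (simp add: field_simps)
        then show ?thesis by (simp add: f_def)
      qed
      then have "\<forall>\<^sub>F n in sequentially. f n x = 1" unfolding eventually_sequentially by blast
      then have "(\<lambda>n. f n x) \<longlonglongrightarrow> 1" by (rule tendsto_eventually)
      then show ?thesis using True that V by simp
    next
      case False
      then show ?thesis using V by (simp add: f_def)
    qed
    have conv: "(\<lambda>n. integral\<^sup>L P (f n)) \<longlonglongrightarrow> measure P U" if P: "prob_space P" "sets P = sets (relative_borel X)" "U \<in> sets P" for P
    proof -
      interpret P: prob_space P by fact
      have sP: "space P = X" using sets_eq_imp_space_eq[OF P(2)] by simp
      have "(\<lambda>n. integral\<^sup>L P (f n)) \<longlonglongrightarrow> integral\<^sup>L P (indicator U)"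
      proof (rule integral_dominated_convergence[where w = "\<lambda>_. 1"])
        show "f n \<in> borel_measurable P" for n
          using borel_measurable_relative_borel[OF f(1)] measurable_cong_sets[OF P(2) refl] by blast
      qed (use P(3) f lim sP in auto)
      then show ?thesis using P(3) sP sets.sets_into_space[OF P(3)] by (simp add: Int_absorb2)
    qed
    have "measure M U = measure N U"
      using LIMSEQ_unique[OF conv[OF assms(1) M U(1)]] conv[OF assms(2) N U(2)] int[OF f(1)] by simp
    then show ?thesis by (simp add: M.emeasure_eq_measure N.emeasure_eq_measure)
  qed
qed

definition invariant_prob :: "'a::topological_space set \<Rightarrow> ('v \<Rightarrow> 'a \<Rightarrow> 'a) \<Rightarrow> 'a measure \<Rightarrow> bool" where
  "invariant_prob X act M \<longleftrightarrow> prob_space M \<and> sets M = sets (relative_borel X) \<and>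
     (\<forall>v. \<forall>B\<in>sets M. emeasure M (act v ` B) = emeasure M B)"

lemma integral_box_diff_bound:
  fixes f :: "'v::euclidean_space \<Rightarrow> real"
  assumes f: "continuous_on UNIV f" "\<And>z. \<bar>f z\<bar> \<le> B" and sub: "cbox a b \<subseteq> cbox c d"
  shows "\<bar>integral (cbox c d) f - integral (cbox a b) f\<bar> \<le> B * (measure lborel (cbox c d) - measure lborel (cbox a b))"
proof -
  have int: "g integrable_on cbox u v" if "continuous_on UNIV g" for g :: "'v \<Rightarrow> real" and u v
    using that by (intro integrable_continuous) (auto intro: continuous_on_subset)
  have mono: "integral (cbox a b) g \<le> integral (cbox c d) g" if "continuous_on UNIV g" "\<And>z. 0 \<le> g z" for g :: "'v \<Rightarrow> real"
    by (rule integral_subset_le[OF sub int int]) (use that in auto)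
  have "integral (cbox a b) (\<lambda>z. B - f z) \<le> integral (cbox c d) (\<lambda>z. B - f z)"
    using f(2) by (intro mono continuous_intros f(1)) (auto simp: abs_le_iff)
  moreover have "integral (cbox a b) (\<lambda>z. B + f z) \<le> integral (cbox c d) (\<lambda>z. B + f z)"
    using f(2) by (intro mono continuous_intros f(1)) (smt (verit))
  moreover have "integral (cbox u v) (\<lambda>z. B - f z) = measure lborel (cbox u v) * B - integral (cbox u v) f"
    "integral (cbox u v) (\<lambda>z. B + f z) = measure lborel (cbox u v) * B + integral (cbox u v) f" for u v
    using int[OF f(1)] by (simp_all add: integral_diff[OF integrable_const] integral_add[OF integrable_const])
  ultimately show ?thesis unfolding abs_le_iff by (simp add: algebra_simps)
qed

definition cube :: "real \<Rightarrow> 'v::euclidean_space set" where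
  "cube R = cbox (- R *\<^sub>R One) (R *\<^sub>R One)"

lemma content_cube: "0 \<le> R \<Longrightarrow> measure lborel (cube R :: 'v::euclidean_space set) = (2 * R) ^ DIM('v)"
  unfolding cube_def by (subst content_cbox) (auto simp: inner_sum_left_Basis)

context compact_flow
begin

definition cube_average :: "real \<Rightarrow> ('a \<Rightarrow> real) \<Rightarrow> 'a \<Rightarrow> real" where
  "cube_average R F x = integral (cube R) (\<lambda>z. F (act z x)) / measure lborel (cube R :: 'v set)"

lemma continuous_along_orbit:
  assumes "continuous_on X F" "x \<in> X"
  shows "continuous_on S (\<lambda>z. F (act z x))"
  by (rule continuous_on_compose2[OF assms(1) act_continuous]) (use assms(2) in \<open>auto intro!: continuous_intros act_in\<close>)

text \<open>
Cubes form a Folner sequence: a cube and its translate by \<open>v\<close> both lie in the cube enlarged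
by \<open>norm v\<close>, whose relative excess volume tends to \<open>0\<close>.
\<close>

lemma cube_average_translate:
  fixes F :: "'a \<Rightarrow> real"
  assumes F: "continuous_on X F"
  shows "\<exists>B. \<forall>x\<in>X. \<forall>v R. 0 < R \<longrightarrow>
    \<bar>cube_average R F (act v x) - cube_average R F x\<bar> \<le> B * ((1 + norm v / R) ^ DIM('v) - 1)"
proof -
  obtain B where "\<forall>y \<in> F ` X. norm y \<le> B"
    using compact_imp_bounded[OF compact_continuous_image[OF F compact]] unfolding bounded_iff by metis
  then have B: "\<bar>F x\<bar> \<le> B" if "x \<in> X" for x using that by auto
  have "\<bar>cube_average R F (act v x) - cube_average R F x\<bar> \<le> 2 * B * ((1 + norm v / R) ^ DIM('v) - 1)"
    if x: "x \<in> X" and R: "0 < R" for x v R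
  proof -
    define f where "f z = F (act z x)" for z
    have f: "continuous_on UNIV f" "\<And>z. \<bar>f z\<bar> \<le> B"
      unfolding f_def using continuous_along_orbit[OF F x] B act_in[OF x] by blast+
    define r where "r = norm v"
    let ?Q = "cube R :: 'v set" and ?P = "cube (R + r) :: 'v set"
    let ?S = "cbox (- R *\<^sub>R One + v) (R *\<^sub>R One + v) :: 'v set"
    have vb: "\<bar>v \<bullet> b\<bar> \<le> r" if "b \<in> Basis" for b using Basis_le_norm[OF that] by (simp add: r_def)
    have sub: "?Q \<subseteq> ?P" "?S \<subseteq> ?P"
      using vb unfolding cube_def by (auto simp: subset_box inner_sum_left_Basis inner_add_left inner_diff_left r_def abs_le_iff)
        (smt (verit) norm_ge_zero)+
    have cS: "measure lborel ?S = measure lborel ?Q" 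
      unfolding cube_def content_cbox_cases by (simp add: inner_add_left inner_diff_left)
    have "integral ?S f = integral ?Q (f \<circ> (+) v)"
      unfolding cube_def by (rule integral_shift_cbox_plus[symmetric])
    also have "\<dots> = integral ?Q (\<lambda>z. F (act z (act v x)))"
      by (simp add: f_def act_act[OF x] comp_def)
    finally have shift: "integral ?Q (\<lambda>z. F (act z (act v x))) = integral ?S f" by simp
    have "\<bar>integral ?P f - integral ?S f\<bar> \<le> B * (measure lborel ?P - measure lborel ?Q)"
      using integral_box_diff_bound[OF f sub(2)[unfolded cube_def]] cS unfolding cube_def by simp
    moreover have "\<bar>integral ?P f - integral ?Q f\<bar> \<le> B * (measure lborel ?P - measure lborel ?Q)"
      using integral_box_diff_bound[OF f sub(1)[unfolded cube_def]] unfolding cube_def by simp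
    ultimately have "\<bar>integral ?S f - integral ?Q f\<bar> \<le> 2 * B * (measure lborel ?P - measure lborel ?Q)" by linarith
    moreover have pos: "0 < measure lborel ?Q" using R by (simp add: content_cube)
    ultimately have "\<bar>integral ?S f - integral ?Q f\<bar> / measure lborel ?Q \<le> 2 * B * (measure lborel ?P - measure lborel ?Q) / measure lborel ?Q"
      by (intro divide_right_mono) auto
    also have "\<dots> = 2 * B * (measure lborel ?P / measure lborel ?Q - 1)" using pos by (simp add: field_simps)
    also have "measure lborel ?P / measure lborel ?Q = (1 + norm v / R) ^ DIM('v)"
    proof -
      have "measure lborel ?P / measure lborel ?Q = ((2 * (R + r)) / (2 * R)) ^ DIM('v)"
        using R content_cube[of "R + r", where 'v = 'v] content_cube[of R, where 'v = 'v]
        unfolding power_divide by (simp add: r_def)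
      moreover have "(2 * (R + r)) / (2 * R) = 1 + norm v / R" using R by (simp add: r_def field_simps)
      ultimately show ?thesis by simp
    qed
    finally show ?thesis
      using pos by (simp add: cube_average_def shift f_def[symmetric] diff_divide_distrib[symmetric] abs_divide)
  qed
  then show ?thesis by blast
qed

lemma empirical_measure:
  assumes "x \<in> X" "0 < R"
  obtains \<mu> where "prob_space \<mu>" "sets \<mu> = sets (relative_borel X)"
    "\<And>F :: 'a \<Rightarrow> real. continuous_on X F \<Longrightarrow> integral\<^sup>L \<mu> F = cube_average R F x"
proof -
  let ?Q = "cube R :: 'v set"
  let ?U = "uniform_measure lborel ?Q"
  have "emeasure lborel ?Q \<noteq> top" using emeasure_lborel_cbox_finite[of "- R *\<^sub>R One :: 'v" "R *\<^sub>R One"] unfolding cube_def by auto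
  then have Q: "?Q \<in> sets lborel" "emeasure lborel ?Q = ennreal (measure lborel ?Q)" "0 < measure lborel ?Q"
    using assms(2) by (auto simp: emeasure_eq_ennreal_measure content_cube) (simp add: cube_def)
  interpret U: prob_space ?U using Q by (intro prob_space_uniform_measure) auto
  have m: "(\<lambda>z. act z x) \<in> ?U \<rightarrow>\<^sub>M relative_borel X"
  proof (rule measurable_into_relative_borel)
    have "continuous_on UNIV (\<lambda>z. act z x)" using assms(1) by (intro act_continuous continuous_intros)
    then have "(\<lambda>z. act z x) \<in> borel_measurable borel" by (rule borel_measurable_continuous_onI)
    moreover have "sets ?U = sets borel" by simp
    ultimately show "(\<lambda>z. act z x) \<in> borel_measurable ?U" using measurable_cong_sets by blast
  qed (use act_in assms(1) in auto)
  show ?thesis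
  proof (rule that[of "distr ?U (relative_borel X) (\<lambda>z. act z x)"])
    show "prob_space (distr ?U (relative_borel X) (\<lambda>z. act z x))" by (rule U.prob_space_distr[OF m])
    fix F :: "'a \<Rightarrow> real" assume F: "continuous_on X F"
    have cont: "continuous_on UNIV (\<lambda>z. F (act z x))" by (rule continuous_along_orbit[OF F assms(1)])
    have "integral\<^sup>L (distr ?U (relative_borel X) (\<lambda>z. act z x)) F = integral\<^sup>L ?U (\<lambda>z. F (act z x))"
      by (rule integral_distr[OF m borel_measurable_relative_borel[OF F]])
    also have "\<dots> = (LINT z:?Q|lborel. F (act z x)) / measure lborel ?Q"
      using cont by (intro integral_uniform_measure_eq Q) (simp add: borel_measurable_continuous_onI)
    also have "(LINT z:?Q|lborel. F (act z x)) = integral ?Q (\<lambda>z. F (act z x))"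
      using continuous_on_subset[OF cont] unfolding cube_def
      by (intro set_borel_integral_eq_integral borel_integrable_compact[unfolded set_integrable_def[symmetric]]) auto
    finally show "integral\<^sup>L (distr ?U (relative_borel X) (\<lambda>z. act z x)) F = cube_average R F x"
      by (simp add: cube_average_def)
  qed simp
qed

text \<open>
Pushing \<open>N\<close> forward by a translation does not change integrals of continuous functions, hence does not
change \<open>N\<close>.
\<close>

lemma invariant_probI:
  assumes N: "prob_space N" "sets N = sets (relative_borel X)"
    and inv: "\<And>(F :: 'a \<Rightarrow> real) v. continuous_on X F \<Longrightarrow> integral\<^sup>L N (\<lambda>x. F (act v x)) = integral\<^sup>L N F"
  shows "invariant_prob X act N"
  unfolding invariant_prob_def
proof (intro conjI N allI ballI)
  interpret N: prob_space N by fact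
  have sN: "space N = X" using sets_eq_imp_space_eq[OF N(2)] by simp
  fix v B assume B: "B \<in> sets N"
  have m: "act w \<in> N \<rightarrow>\<^sub>M relative_borel X" for w
  proof (rule measurable_into_relative_borel)
    have "continuous_on X (act w)" using act_continuous[OF continuous_on_id continuous_on_const, of X w] by simp
    then show "act w \<in> borel_measurable N"
      using borel_measurable_relative_borel measurable_cong_sets[OF N(2) refl] by blast
  qed (use act_in sN in auto)
  have eq: "distr N (relative_borel X) (act w) = N" for w
  proof (rule measure_eqI_continuous_integrals[OF N.prob_space_distr[OF m] N(1) _ N(2)])
    fix F :: "'a \<Rightarrow> real" assume F: "continuous_on X F"
    show "integral\<^sup>L (distr N (relative_borel X) (act w)) F = integral\<^sup>L N F"
      using inv[OF F] integral_distr[OF m borel_measurable_relative_borel[OF F]] by simp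
  qed simp
  have "B \<subseteq> X" using B sets.sets_into_space sN by blast
  have "act v ` B = act (- v) -` B \<inter> space N"
  proof (intro equalityI subsetI)
    fix y assume "y \<in> act v ` B"
    then show "y \<in> act (- v) -` B \<inter> space N" using \<open>B \<subseteq> X\<close> act_act act_zero act_in sN by fastforce
  next
    fix y assume y: "y \<in> act (- v) -` B \<inter> space N"
    then have "y = act v (act (- v) y)" using act_act[of y v "-v"] act_zero sN by simp
    then show "y \<in> act v ` B" using y by blast
  qed
  then have "emeasure N (act v ` B) = emeasure (distr N (relative_borel X) (act (- v))) B"
    using B N(2) by (simp add: emeasure_distr[OF m])
  then show "emeasure N (act v ` B) = emeasure N B" by (simp add: eq)
qed

text \<open>
If the convergence were not uniform, there would be cubes of sizes tending to infinity and base points for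
which the averages of \<open>F\<close> stay away from the integral. A weak limit of these empirical measures is
invariant, since cubes are asymptotically invariant, so it is the only invariant measure; but it gives
\<open>F\<close> a different integral.
\<close>

theorem uniform_cube_averages:
  fixes F :: "'a \<Rightarrow> real"
  assumes unique: "\<And>N. invariant_prob X act N \<Longrightarrow> N = M"
    and F: "continuous_on X F" and "0 < e"
  shows "\<exists>R0. \<forall>R\<ge>R0. \<forall>x\<in>X. \<bar>cube_average R F x - integral\<^sup>L M F\<bar> < e"
proof (rule ccontr)
  assume "\<not> ?thesis"
  then have "\<exists>R x. real (Suc k) \<le> R \<and> x \<in> X \<and> \<not> \<bar>cube_average R F x - integral\<^sup>L M F\<bar> < e" for k by blast
  then obtain R x where Rx: "\<And>k. real (Suc k) \<le> R k" "\<And>k. x k \<in> X"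
    "\<And>k. \<not> \<bar>cube_average (R k) F (x k) - integral\<^sup>L M F\<bar> < e" by metis
  have Rpos: "0 < R k" for k using Rx(1)[of k] by simp
  have "\<exists>\<mu>. prob_space \<mu> \<and> sets \<mu> = sets (relative_borel X) \<and>
      (\<forall>F :: 'a \<Rightarrow> real. continuous_on X F \<longrightarrow> integral\<^sup>L \<mu> F = cube_average (R k) F (x k))" for k
    using empirical_measure[OF Rx(2) Rpos] by metis
  then obtain \<mu> where \<mu>: "\<And>k. prob_space (\<mu> k)" "\<And>k. sets (\<mu> k) = sets (relative_borel X)"
    "\<And>k (F :: 'a \<Rightarrow> real). continuous_on X F \<Longrightarrow> integral\<^sup>L (\<mu> k) F = cube_average (R k) F (x k)" by metis
  have "X \<noteq> {}" using Rx(2) by blast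
  obtain r N where r: "strict_mono (r :: nat \<Rightarrow> nat)" and N: "prob_space N" "sets N = sets (relative_borel X)"
    and lim: "\<And>F :: 'a \<Rightarrow> real. continuous_on X F \<Longrightarrow> (\<lambda>k. integral\<^sup>L (\<mu> (r k)) F) \<longlonglongrightarrow> integral\<^sup>L N F"
    using compact_weak_limit[of X \<mu>, OF compact \<open>X \<noteq> {}\<close> \<mu>(1,2)] by metis
  have avg: "(\<lambda>k. cube_average (R (r k)) G (x (r k))) \<longlonglongrightarrow> integral\<^sup>L N G" if "continuous_on X G" for G
    using lim[OF that] \<mu>(3)[OF that] by simp
  have Rlim: "filterlim (\<lambda>k. R (r k)) at_top sequentially"
  proof (rule filterlim_at_top_mono[OF filterlim_real_sequentially])
    show "\<forall>\<^sub>F k in sequentially. real k \<le> R (r k)"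
      using Rx(1) seq_suble[OF r] by (intro always_eventually allI) (metis le_Suc_eq of_nat_mono order_trans)
  qed
  have "invariant_prob X act N"
  proof (rule invariant_probI[OF N])
    fix G :: "'a \<Rightarrow> real" and v assume G: "continuous_on X G"
    have Gv: "continuous_on X (\<lambda>x. G (act v x))"
      by (rule continuous_on_compose2[OF G act_continuous]) (auto intro!: continuous_intros act_in)
    have swap: "cube_average (R k) (\<lambda>x. G (act v x)) (x k) = cube_average (R k) G (act v (x k))" for k
      using act_act[OF Rx(2)] by (simp add: cube_average_def add.commute)
    obtain B where B: "\<forall>x\<in>X. \<forall>v R. 0 < R \<longrightarrow>
        \<bar>cube_average R G (act v x) - cube_average R G x\<bar> \<le> B * ((1 + norm v / R) ^ DIM('v) - 1)"
      using cube_average_translate[OF G] by blast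
    have "(\<lambda>k. norm v / R (r k)) \<longlonglongrightarrow> 0"
      by (rule real_tendsto_divide_at_top[OF tendsto_const Rlim])
    then have "(\<lambda>k. B * ((1 + norm v / R (r k)) ^ DIM('v) - 1)) \<longlonglongrightarrow> B * ((1 + 0) ^ DIM('v) - 1)"
      by (intro tendsto_intros)
    note bound_lim = this
    have "(\<lambda>k. cube_average (R (r k)) G (act v (x (r k))) - cube_average (R (r k)) G (x (r k))) \<longlonglongrightarrow> 0"
    proof (rule Lim_null_comparison[rotated])
      show "(\<lambda>k. B * ((1 + norm v / R (r k)) ^ DIM('v) - 1)) \<longlonglongrightarrow> 0" using bound_lim by simp
      show "\<forall>\<^sub>F k in sequentially. norm (cube_average (R (r k)) G (act v (x (r k))) - cube_average (R (r k)) G (x (r k)))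
          \<le> B * ((1 + norm v / R (r k)) ^ DIM('v) - 1)"
        using B Rx(2) Rpos by (intro always_eventually allI) simp
    qed
    from tendsto_add[OF this avg[OF G]]
    have "(\<lambda>k. cube_average (R (r k)) (\<lambda>x. G (act v x)) (x (r k))) \<longlonglongrightarrow> integral\<^sup>L N G"
      by (simp add: swap)
    then show "integral\<^sup>L N (\<lambda>x. G (act v x)) = integral\<^sup>L N G"
      using avg[OF Gv] LIMSEQ_unique by blast
  qed
  then have "N = M" by (rule unique)
  then have "(\<lambda>k. cube_average (R (r k)) F (x (r k))) \<longlonglongrightarrow> integral\<^sup>L M F" using avg[OF F] by simp
  then have "\<forall>\<^sub>F k in sequentially. dist (cube_average (R (r k)) F (x (r k))) (integral\<^sup>L M F) < e"
    using \<open>0 < e\<close> tendstoD by blast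
  then show False using Rx(3) by (simp add: dist_real_def eventually_sequentially)
qed

end


section \<open>Smooth kernels and convolution\<close>

text \<open>
All derivatives of the standard function that is flat at \<open>0\<close> have this form, with varying \<open>p\<close>.
\<close>

definition flat_exp :: "real poly \<Rightarrow> real \<Rightarrow> real" where
  "flat_exp p t = (if 0 < t then poly p (1 / t) * exp (- (1 / t)) else 0)"

lemma poly_over_exp_tendsto_0: "((\<lambda>u::real. poly p u * exp (- u)) \<longlongrightarrow> 0) at_top"
proof -
  have "((\<lambda>u::real. \<Sum>i\<le>degree p. coeff p i * (u ^ i / exp u)) \<longlongrightarrow> (\<Sum>i\<le>degree p. coeff p i * 0)) at_top"
    by (intro tendsto_sum tendsto_mult tendsto_const tendsto_power_div_exp_0)
  then show ?thesis by (simp add: poly_altdef sum_distrib_right exp_minus divide_inverse mult.assoc)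
qed

lemma flat_exp_has_derivative:
  "(flat_exp p has_real_derivative flat_exp (monom 1 2 * (p - pderiv p)) t) (at t)"
proof -
  consider "0 < t" | "t < 0" | "t = 0" by linarith
  then show ?thesis
  proof cases
    case 1
    have inv: "((\<lambda>t. 1 / t) has_real_derivative - (1 / t\<^sup>2)) (at t)"
      using 1 by (auto intro!: derivative_eq_intros simp: power2_eq_square)
    have "((\<lambda>t. poly p (1 / t) * exp (- (1 / t))) has_real_derivative
        (poly (pderiv p) (1 / t) * - (1 / t\<^sup>2)) * exp (- (1 / t)) + exp (- (1 / t)) * - (- (1 / t\<^sup>2)) * poly p (1 / t)) (at t)"
      by (intro DERIV_mult DERIV_chain2[OF poly_DERIV inv] DERIV_chain2[OF DERIV_exp] DERIV_minus inv)
    then have "((\<lambda>t. poly p (1 / t) * exp (- (1 / t))) has_real_derivative flat_exp (monom 1 2 * (p - pderiv p)) t) (at t)"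
      by (rule DERIV_cong) (use 1 in \<open>simp add: flat_exp_def poly_monom power_one_over algebra_simps\<close>)
    then show ?thesis
      by (rule has_field_derivative_transform_within_open[of _ _ _ "{0<..}"]) (use 1 in \<open>auto simp: flat_exp_def\<close>)
  next
    case 2
    have "(flat_exp p has_real_derivative 0) (at t)"
      by (rule has_field_derivative_transform_within_open[where S = "{..<0}", OF DERIV_const[of 0]])
        (use 2 in \<open>simp_all add: flat_exp_def\<close>)
    then show ?thesis using 2 by (simp add: flat_exp_def)
  next
    case 3
    have "((\<lambda>h. flat_exp p h / h) \<longlongrightarrow> 0) (at_left 0)"
      by (rule tendsto_eventually) (auto simp: flat_exp_def eventually_at_left_field intro: exI[of _ "-1"])
    moreover have "((\<lambda>h. flat_exp p h / h) \<longlongrightarrow> 0) (at_right 0)"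
    proof -
      have "((\<lambda>h::real. poly (pCons 0 p) (inverse h) * exp (- (inverse h))) \<longlongrightarrow> 0) (at_right 0)"
        by (rule filterlim_compose[OF poly_over_exp_tendsto_0 filterlim_inverse_at_top_right])
      moreover have "\<forall>\<^sub>F h in at_right 0. poly (pCons 0 p) (inverse h) * exp (- (inverse h)) = flat_exp p h / h"
        by (auto simp: flat_exp_def eventually_at_right_field inverse_eq_divide intro: exI[of _ 1])
      ultimately show ?thesis by (rule Lim_transform_eventually)
    qed
    ultimately have "((\<lambda>h. flat_exp p h / h) \<longlongrightarrow> 0) (at 0)" by (rule filterlim_split_at)
    then show ?thesis using 3 by (simp add: DERIV_def flat_exp_def)
  qed
qed

lemma partial_of_has_derivative:
  fixes f :: "real^'n::finite \<Rightarrow> real"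
  assumes "(f has_derivative f') (at z)"
  shows "partial j f z = f' (axis j 1)"
  using frechet_derivative_at[OF assms] by (simp add: partial_def)

lemma has_derivative_partials:
  fixes f :: "real^'n::finite \<Rightarrow> real"
  assumes "f differentiable (at z)"
  shows "(f has_derivative (\<lambda>v. \<Sum>j\<in>UNIV. partial j f z * v $ j)) (at z)"
proof -
  let ?f' = "frechet_derivative f (at z)"
  have f': "(f has_derivative ?f') (at z)" using assms frechet_derivative_works by blast
  have "?f' v = (\<Sum>j\<in>UNIV. partial j f z * v $ j)" for v
  proof -
    have lin: "linear ?f'" by (rule has_derivative_linear[OF f'])
    have "?f' v = ?f' (\<Sum>j\<in>UNIV. v $ j *\<^sub>R axis j 1)"
      using basis_expansion[of v] by (simp add: scalar_mult_eq_scaleR)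
    also have "\<dots> = (\<Sum>j\<in>UNIV. v $ j * ?f' (axis j 1))"
      by (simp add: linear_sum[OF lin] linear_cmul[OF lin])
    finally show ?thesis by (simp add: partial_def mult.commute)
  qed
  then have "?f' = (\<lambda>v. \<Sum>j\<in>UNIV. partial j f z * v $ j)" by blast
  then show ?thesis using f' by simp
qed

lemma partial_add:
  fixes f g :: "real^'n::finite \<Rightarrow> real"
  assumes "\<And>z. f differentiable (at z)" "\<And>z. g differentiable (at z)"
  shows "partial j (\<lambda>z. f z + g z) = (\<lambda>z. partial j f z + partial j g z)"
proof
  fix z show "partial j (\<lambda>z. f z + g z) z = partial j f z + partial j g z"
    using assms[of z] unfolding frechet_derivative_works
    by (subst partial_of_has_derivative[OF has_derivative_add]) (auto simp: partial_def)
qed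

lemma partial_mult:
  fixes f g :: "real^'n::finite \<Rightarrow> real"
  assumes "\<And>z. f differentiable (at z)" "\<And>z. g differentiable (at z)"
  shows "partial j (\<lambda>z. f z * g z) = (\<lambda>z. f z * partial j g z + partial j f z * g z)"
proof
  fix z show "partial j (\<lambda>z. f z * g z) z = f z * partial j g z + partial j f z * g z"
    using assms[of z] unfolding frechet_derivative_works
    by (subst partial_of_has_derivative[OF has_derivative_mult]) (auto simp: partial_def)
qed

lemma partial_cmult:
  fixes f :: "real^'n::finite \<Rightarrow> real"
  assumes "\<And>z. f differentiable (at z)"
  shows "partial j (\<lambda>z. c * f z) = (\<lambda>z. c * partial j f z)"
proof
  fix z show "partial j (\<lambda>z. c * f z) z = c * partial j f z"
    using assms[of z] unfolding frechet_derivative_works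
    by (subst partial_of_has_derivative[OF has_derivative_mult_right]) (auto simp: partial_def)
qed

lemma partial_const: "partial j (\<lambda>_. c) = (\<lambda>_. 0)"
  by (rule ext) (simp add: partial_of_has_derivative[OF has_derivative_const])

lemma partial_coord: "partial j (\<lambda>z. z $ i) = (\<lambda>_. if i = j then 1 else 0)"
  by (rule ext) (simp add: partial_of_has_derivative[OF bounded_linear_imp_has_derivative[OF bounded_linear_vec_nth]] axis_def)

lemma flat_exp_radial_has_derivative:
  fixes z :: "real^'n::finite"
  shows "((\<lambda>z. flat_exp p (1 - z \<bullet> z)) has_derivative
    (\<lambda>v. flat_exp (monom 1 2 * (p - pderiv p)) (1 - z \<bullet> z) * (- (2 * (z \<bullet> v))))) (at z)"
proof -
  have "((\<lambda>z. 1 - z \<bullet> z) has_derivative (\<lambda>v. - (2 * (z \<bullet> v)))) (at z)"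
    by (auto intro!: derivative_eq_intros simp: inner_commute)
  from has_derivative_compose[OF this flat_exp_has_derivative[of p "1 - z \<bullet> z", unfolded has_field_derivative_def]]
  show ?thesis .
qed

lemma partial_flat_exp_radial:
  "partial j (\<lambda>z. flat_exp p (1 - z \<bullet> z)) =
    (\<lambda>z. flat_exp (monom 1 2 * (p - pderiv p)) (1 - z \<bullet> z) * (- 2 * z $ j))"
  by (rule ext) (simp add: partial_of_has_derivative[OF flat_exp_radial_has_derivative] inner_axis)

text \<open>
An algebra of functions that contains the bump \<open>exp (- 1 / (1 - z \<bullet> z))\<close> on the unit ball. It is closed
under partial derivatives, so all its members are smooth; and the symmetry of second
derivatives follows by induction over the generators.
\<close>

inductive_set radial_algebra :: "(real^'n::finite \<Rightarrow> real) set" where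
  const: "(\<lambda>_. c) \<in> radial_algebra"
| coord: "(\<lambda>z. z $ i) \<in> radial_algebra"
| flat: "(\<lambda>z. flat_exp p (1 - z \<bullet> z)) \<in> radial_algebra"
| add: "f \<in> radial_algebra \<Longrightarrow> g \<in> radial_algebra \<Longrightarrow> (\<lambda>z. f z + g z) \<in> radial_algebra"
| mult: "f \<in> radial_algebra \<Longrightarrow> g \<in> radial_algebra \<Longrightarrow> (\<lambda>z. f z * g z) \<in> radial_algebra"

lemma radial_algebra_differentiable:
  "f \<in> radial_algebra \<Longrightarrow> f differentiable (at z)"
proof (induction rule: radial_algebra.induct)
  case (coord i)
  then show ?case using bounded_linear_imp_has_derivative[OF bounded_linear_vec_nth] differentiableI by blast
next
  case (flat p)
  then show ?case using flat_exp_radial_has_derivative differentiableI by blast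
qed (auto intro: differentiable_add differentiable_mult)

lemma radial_algebra_partial: "f \<in> radial_algebra \<Longrightarrow> partial j f \<in> radial_algebra"
proof (induction rule: radial_algebra.induct)
  case (flat p)
  then show ?case unfolding partial_flat_exp_radial
    by (intro radial_algebra.mult radial_algebra.flat radial_algebra.mult[OF radial_algebra.const radial_algebra.coord])
qed (auto simp: partial_const partial_coord partial_add partial_mult radial_algebra_differentiable
      intro: radial_algebra.intros)

lemma radial_algebra_partial_commute:
  fixes f :: "real^'n::finite \<Rightarrow> real"
  assumes "f \<in> radial_algebra"
  shows "partial j (partial k f) = partial k (partial j f)"
  using assms
proof (induction rule: radial_algebra.induct)
  case (flat p)
  have d: "(\<lambda>z. - 2 * z $ i) differentiable (at z)" for i and z :: "real^'n"
    using radial_algebra_differentiable[OF radial_algebra.mult[OF radial_algebra.const[of "-2"] radial_algebra.coord[of i]]] .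
  have pd: "partial j (\<lambda>z. - 2 * z $ i) = (\<lambda>_. - 2 * (if i = j then 1 else 0))" for i j :: 'n
    by (subst partial_cmult[OF radial_algebra_differentiable[OF radial_algebra.coord]]) (simp only: partial_coord)
  have pf: "partial j (\<lambda>z. flat_exp q (1 - z \<bullet> z) * (- 2 * z $ i)) = (\<lambda>z. flat_exp q (1 - z \<bullet> z) * (- 2 * (if i = j then 1 else 0)) +
      flat_exp (monom 1 2 * (q - pderiv q)) (1 - z \<bullet> z) * (- 2 * z $ j) * (- 2 * z $ i))" for q and i j :: 'n
    by (simp only: partial_mult[OF radial_algebra_differentiable[OF radial_algebra.flat] d] pd partial_flat_exp_radial)
  show ?case unfolding partial_flat_exp_radial pf by (auto simp: fun_eq_iff)
next
  case (add f g)
  then show ?case by (simp add: partial_add radial_algebra_differentiable radial_algebra_partial)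
next
  case (mult f g)
  then show ?case
    by (simp add: partial_mult partial_add radial_algebra_differentiable radial_algebra_partial
        radial_algebra.mult algebra_simps)
qed (simp_all add: partial_const partial_coord)

text \<open>
The support lies in the unit cube, rather than in the unit ball, because integrals are taken over boxes.
\<close>

definition kernel :: "(real^'n::finite \<Rightarrow> real) \<Rightarrow> bool" where
  "kernel \<kappa> \<longleftrightarrow> \<kappa> \<in> radial_algebra \<and> (\<forall>z. z \<notin> cube 1 \<longrightarrow> \<kappa> z = 0)"

lemma kernel_differentiable: "kernel \<kappa> \<Longrightarrow> \<kappa> differentiable (at z)"
  by (simp add: kernel_def radial_algebra_differentiable)

lemma kernel_continuous: "kernel \<kappa> \<Longrightarrow> continuous_on S \<kappa>"
  using kernel_differentiable differentiable_imp_continuous_within continuous_at_imp_continuous_on by blast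

lemma kernel_partial: 
  assumes "kernel \<kappa>" shows "kernel (partial j \<kappa>)"
proof -
  have "partial j \<kappa> z = 0" if "z \<notin> cube 1" for z
  proof -
    have "open (- cube 1 :: (real^'n) set)" unfolding cube_def by (intro open_Compl closed_cbox)
    then have "(\<kappa> has_derivative (\<lambda>_. 0)) (at z)"
      by (rule has_derivative_transform_within_open[OF has_derivative_const[of 0]])
        (use that assms in \<open>auto simp: kernel_def\<close>)
    then show ?thesis by (simp add: partial_of_has_derivative)
  qed
  then show ?thesis using assms by (simp add: kernel_def radial_algebra_partial)
qed

lemma mem_cube: "z \<in> cube R \<longleftrightarrow> (\<forall>i. \<bar>z $ i\<bar> \<le> R)" for z :: "real^'n::finite"
proof -
  have "z \<in> cube R \<longleftrightarrow> (\<forall>b\<in>Basis. \<bar>z \<bullet> b\<bar> \<le> R)"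
    by (auto simp: cube_def mem_box inner_sum_left_Basis abs_le_iff)
  also have "\<dots> \<longleftrightarrow> (\<forall>i. \<bar>z $ i\<bar> \<le> R)" by (auto simp: Basis_vec_def inner_axis)
  finally show ?thesis .
qed

lemma kernel_exists:
  obtains \<rho> :: "real^'n::finite \<Rightarrow> real" where "kernel \<rho>" "integral (cube 1) \<rho> = 1"
proof -
  define f where "f z = flat_exp 1 (1 - z \<bullet> z)" for z :: "real^'n"
  have K: "kernel f"
    unfolding kernel_def f_def
  proof (intro conjI allI impI radial_algebra.flat)
    fix z :: "real^'n" assume "z \<notin> cube 1"
    then obtain i where "1 < \<bar>z $ i\<bar>" unfolding mem_cube by (auto simp: not_le)
    then have "1 < norm z" using component_le_norm_cart[of z i] by linarith
    then have "1 \<le> z \<bullet> z" by (simp add: dot_square_norm one_le_power)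
    then show "flat_exp 1 (1 - z \<bullet> z) = 0" by (simp add: flat_exp_def)
  qed
  have cont: "continuous_on (cube 1) f" by (rule kernel_continuous[OF K])
  have int: "f integrable_on cube 1" using cont unfolding cube_def by (rule integrable_continuous)
  have nn: "0 \<le> f z" for z by (simp add: f_def flat_exp_def)
  have "integral (cube 1) f \<noteq> 0"
  proof
    assume "integral (cube 1) f = 0"
    then have "(f has_integral 0) (cube 1)" using int by (metis integrable_integral)
    moreover have "box (- 1 *\<^sub>R One) (1 *\<^sub>R One) \<noteq> ({} :: (real^'n) set)" by (simp add: box_ne_empty inner_sum_left_Basis)
    ultimately have "f 0 = 0"
      using has_integral_0_cbox_imp_0[of "- 1 *\<^sub>R One" "1 *\<^sub>R One" f 0] cont nn mem_cube[of 0 1] unfolding cube_def by auto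
    then show False by (simp add: f_def flat_exp_def)
  qed
  then show ?thesis
  proof (intro that[of "\<lambda>z. (1 / integral (cube 1) f) * f z"])
    show "kernel (\<lambda>z. (1 / integral (cube 1) f) * f z)"
      unfolding kernel_def using K by (intro conjI radial_algebra.mult radial_algebra.const) (auto simp: kernel_def)
  qed simp
qed

definition convolve :: "(real^'n::finite \<Rightarrow> real) \<Rightarrow> (real^'n \<Rightarrow> real) \<Rightarrow> real^'n \<Rightarrow> real" where
  "convolve \<kappa> a x = integral (cube 1) (\<lambda>z. \<kappa> z * a (x + z))"

text \<open>
Moving the variable from \<open>a\<close> to the kernel puts the derivative on the kernel. The minus sign appears because \<open>x\<close> enters as \<open>\<kappa> (w - x)\<close>. Near \<open>x0\<close> all these
integrals are taken over one fixed cube \<open>Q\<close>, so that differentiation under the integral sign applies.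
\<close>

theorem convolve_has_derivative:
  fixes a :: "real^'n::finite \<Rightarrow> real"
  assumes K: "kernel \<kappa>" and a: "continuous_on UNIV a"
  shows "(convolve \<kappa> a has_derivative (\<lambda>v. \<Sum>j\<in>UNIV. - convolve (partial j \<kappa>) a x0 * v $ j)) (at x0)"
proof -
  define R where "R = norm x0 + 2"
  define Q where "Q = (cube R :: (real^'n) set)"
  have a_c: "continuous_on S (\<lambda>w. a (g w))" if "continuous_on S g" for S and g :: "'c::topological_space \<Rightarrow> real^'n"
    using continuous_on_compose2[OF a that] by simp
  have k_c: "continuous_on S (\<lambda>w. \<kappa> (g w))" if "kernel \<kappa>" "continuous_on S g" for \<kappa> S and g :: "'c::topological_space \<Rightarrow> real^'n"
    using continuous_on_compose2[OF kernel_continuous[OF that(1)] that(2), of UNIV] by simp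
  have conv: "convolve \<kappa> a x = integral Q (\<lambda>w. \<kappa> (w - x) * a w)" if K: "kernel \<kappa>" and x: "x \<in> ball x0 1" for \<kappa> x
  proof -
    let ?S = "cbox (- 1 *\<^sub>R One + x) (1 *\<^sub>R One + x)"
    have S: "w \<in> ?S \<longleftrightarrow> w - x \<in> cube 1" for w
      by (auto simp: cube_def mem_box inner_diff_left inner_add_left)
    have nx: "norm x < norm x0 + 1" using x norm_triangle_ineq2[of x x0] by (simp add: dist_norm norm_minus_commute)
    have "?S \<subseteq> Q"
    proof
      fix w assume "w \<in> ?S"
      then have w: "\<bar>(w - x) $ i\<bar> \<le> 1" for i unfolding S mem_cube by blast
      have "\<bar>w $ i\<bar> \<le> R" for i using w[of i] component_le_norm_cart[of x i] nx by (simp add: R_def)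
      then show "w \<in> Q" unfolding Q_def mem_cube by blast
    qed
    have "convolve \<kappa> a x = integral (cbox (- 1 *\<^sub>R One) (1 *\<^sub>R One)) ((\<lambda>w. \<kappa> (w - x) * a w) \<circ> (+) x)"
      by (simp add: convolve_def cube_def comp_def)
    also have "\<dots> = integral ?S (\<lambda>w. \<kappa> (w - x) * a w)" by (rule integral_shift_cbox_plus)
    also have "\<dots> = integral UNIV (\<lambda>w. if w \<in> ?S then \<kappa> (w - x) * a w else 0)"
      by (rule integral_restrict_UNIV[symmetric])
    also have "(\<lambda>w. if w \<in> ?S then \<kappa> (w - x) * a w else 0) = (\<lambda>w. if w \<in> Q then \<kappa> (w - x) * a w else 0)"
      using subsetD[OF \<open>?S \<subseteq> Q\<close>] K unfolding S kernel_def by (auto simp: fun_eq_iff)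
    also have "integral UNIV \<dots> = integral Q (\<lambda>w. \<kappa> (w - x) * a w)" by (rule integral_restrict_UNIV)
    finally show ?thesis .
  qed
  define D :: "real^'n \<Rightarrow> real^'n \<Rightarrow> ((real^'n) \<Rightarrow>\<^sub>L real)"
    where "D x w = (\<Sum>j\<in>UNIV. (- partial j \<kappa> (w - x) * a w) *\<^sub>R blinfun_inner_right (axis j 1))" for x w
  have D_apply: "blinfun_apply (D x w) v = (\<Sum>j\<in>UNIV. - partial j \<kappa> (w - x) * a w * v $ j)" for x w v
    by (simp add: D_def blinfun.sum_left blinfun.scaleR_left blinfun.minus_left inner_axis')
  have D_cont: "continuous_on S (\<lambda>p. D (fst p) (snd p))" for S
    unfolding D_def by (intro continuous_intros k_c a_c kernel_partial[OF K])
  have "((\<lambda>x. integral Q (\<lambda>w. \<kappa> (w - x) * a w)) has_derivative blinfun_apply (integral Q (D x0))) (at x0 within ball x0 1)"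
    unfolding Q_def cube_def
  proof (rule leibniz_rule)
    fix x w :: "real^'n"
    have "((\<lambda>x. w - x) has_derivative (\<lambda>v. - v)) (at x)" by (auto intro!: derivative_eq_intros)
    from has_derivative_compose[OF this has_derivative_partials[OF kernel_differentiable[OF K]]]
    have "((\<lambda>x. \<kappa> (w - x)) has_derivative (\<lambda>v. \<Sum>j\<in>UNIV. partial j \<kappa> (w - x) * (- v) $ j)) (at x)" .
    from has_derivative_mult_left[OF this, of "a w"]
    have "((\<lambda>x. \<kappa> (w - x) * a w) has_derivative blinfun_apply (D x w)) (at x)"
      by (rule has_derivative_eq_rhs) (simp add: fun_eq_iff D_apply sum_distrib_left sum_distrib_right mult_ac sum_negf)
    then show "((\<lambda>x. \<kappa> (w - x) * a w) has_derivative blinfun_apply (D x w)) (at x within ball x0 1)"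
      by (rule has_derivative_at_withinI)
  next
    show "(\<lambda>w. \<kappa> (w - x) * a w) integrable_on cbox (- R *\<^sub>R One) (R *\<^sub>R One)" for x
      by (intro integrable_continuous continuous_intros k_c[OF K] a_c)
    show "continuous_on (ball x0 1 \<times> cbox (- R *\<^sub>R One) (R *\<^sub>R One)) (\<lambda>(x, w). D x w)"
      using D_cont by (simp add: case_prod_unfold)
  qed auto
  moreover have "blinfun_apply (integral Q (D x0)) v = (\<Sum>j\<in>UNIV. - convolve (partial j \<kappa>) a x0 * v $ j)" for v
  proof -
    have Dint: "D x0 integrable_on Q"
      unfolding Q_def cube_def
    proof (rule integrable_continuous)
      have "continuous_on S (Pair x0)" for S :: "(real^'n) set" by (intro continuous_intros)
      from continuous_on_compose2[OF D_cont[of UNIV] this]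
      show "continuous_on (cbox (- R *\<^sub>R One) (R *\<^sub>R One)) (D x0)" by simp
    qed
    have pint: "(\<lambda>w. partial j \<kappa> (w - x0) * a w) integrable_on Q" for j
      unfolding Q_def cube_def by (intro integrable_continuous continuous_intros k_c[OF kernel_partial[OF K]] a_c)
    have "blinfun_apply (integral Q (D x0)) v = integral Q (\<lambda>w. blinfun_apply (D x0 w) v)"
      by (rule blinfun_apply_integral[OF Dint])
    also have "\<dots> = integral Q (\<lambda>w. \<Sum>j\<in>UNIV. (- v $ j) * (partial j \<kappa> (w - x0) * a w))"
      by (simp add: D_apply mult_ac)
    also have "\<dots> = (\<Sum>j\<in>UNIV. integral Q (\<lambda>w. (- v $ j) * (partial j \<kappa> (w - x0) * a w)))"
      using pint by (intro integral_sum integrable_on_mult_right) auto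
    also have "\<dots> = (\<Sum>j\<in>UNIV. - convolve (partial j \<kappa>) a x0 * v $ j)"
      by (simp add: conv[OF kernel_partial[OF K]] mult.commute)
    finally show ?thesis .
  qed
  then have "blinfun_apply (integral Q (D x0)) = (\<lambda>v. \<Sum>j\<in>UNIV. - convolve (partial j \<kappa>) a x0 * v $ j)" by blast
  ultimately have "((\<lambda>x. integral Q (\<lambda>w. \<kappa> (w - x) * a w)) has_derivative
      (\<lambda>v. \<Sum>j\<in>UNIV. - convolve (partial j \<kappa>) a x0 * v $ j)) (at x0)"
    by (simp add: at_within_open[of x0 "ball x0 1"])
  then show ?thesis
    by (rule has_derivative_transform_within_open[where s = "ball x0 1"]) (auto simp: conv[OF K])
qed

lemma convolve_differentiable: "kernel \<kappa> \<Longrightarrow> continuous_on UNIV a \<Longrightarrow> convolve \<kappa> a differentiable (at x)"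
  using convolve_has_derivative differentiableI by blast

lemma partial_convolve:
  assumes "kernel \<kappa>" "continuous_on UNIV a"
  shows "partial j (convolve \<kappa> a) = (\<lambda>x. - convolve (partial j \<kappa>) a x)"
proof
  fix x
  show "partial j (convolve \<kappa> a) x = - convolve (partial j \<kappa>) a x"
    unfolding partial_of_has_derivative[OF convolve_has_derivative[OF assms]]
    by (simp add: axis_def if_distrib cong: if_cong)
qed

lemma kernel_foldr_partial: "kernel \<kappa> \<Longrightarrow> kernel (foldr partial js \<kappa>)"
  by (induction js) (auto intro: kernel_partial)

lemma foldr_partial_convolve:
  assumes "kernel \<kappa>" "continuous_on UNIV a"
  shows "foldr partial js (\<lambda>x. c * convolve \<kappa> a x) = (\<lambda>x. c * (-1) ^ length js * convolve (foldr partial js \<kappa>) a x)"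
proof (induction js)
  case (Cons j js)
  have "foldr partial (j # js) (\<lambda>x. c * convolve \<kappa> a x) =
      partial j (\<lambda>x. c * (-1) ^ length js * convolve (foldr partial js \<kappa>) a x)"
    using Cons.IH by simp
  also have "\<dots> = (\<lambda>x. c * (-1) ^ length js * partial j (convolve (foldr partial js \<kappa>) a) x)"
    by (rule partial_cmult) (rule convolve_differentiable[OF kernel_foldr_partial[OF assms(1)] assms(2)])
  also have "\<dots> = (\<lambda>x. c * (-1) ^ length (j # js) * convolve (foldr partial (j # js) \<kappa>) a x)"
    by (simp add: partial_convolve[OF kernel_foldr_partial[OF assms(1)] assms(2)])
  finally show ?case .
qed simp

text \<open>
Convolution with a constant function is constant, so its derivative vanishes.
\<close>

lemma integral_partial_kernel:
  assumes "kernel \<kappa>" shows "integral (cube 1) (partial j \<kappa>) = 0"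
proof -
  have "convolve \<kappa> (\<lambda>_. 1) = (\<lambda>_. integral (cube 1) \<kappa>)" by (rule ext) (simp add: convolve_def)
  then have "partial j (convolve \<kappa> (\<lambda>_. 1)) = (\<lambda>_. 0)" by (simp add: partial_const)
  then have "convolve (partial j \<kappa>) (\<lambda>_. 1) 0 = 0"
    using partial_convolve[OF assms continuous_on_const, of j 1] by (metis neg_equal_0_iff_equal)
  then show ?thesis by (simp add: convolve_def)
qed


section \<open>Smoothing a cocycle\<close>

lemma kernel_compose_continuous:
  assumes "kernel \<kappa>" "continuous_on S f"
  shows "continuous_on S (\<lambda>s. \<kappa> (f s))"
  by (rule continuous_on_compose2[OF kernel_continuous[OF assms(1)] assms(2), of UNIV]) simp

definition kernel_moment :: "('a \<Rightarrow> real^'n::finite \<Rightarrow> real^'n) \<Rightarrow> (real^'n \<Rightarrow> real) \<Rightarrow> 'n \<Rightarrow> 'a \<Rightarrow> real" where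
  "kernel_moment \<alpha> \<kappa> i x = integral (cube 1) (\<lambda>z. \<kappa> z * \<alpha> x z $ i)"

text \<open>
The derivative at \<open>0\<close> of the cocycle \<open>\<alpha>\<close> after convolution with \<open>\<rho>\<close>.
\<close>

definition slope :: "('a \<Rightarrow> real^'n::finite \<Rightarrow> real^'n) \<Rightarrow> (real^'n \<Rightarrow> real) \<Rightarrow> 'a \<Rightarrow> real^'n^'n" where
  "slope \<alpha> \<rho> x = (\<chi> i j. - kernel_moment \<alpha> (partial j \<rho>) i x)"

text \<open>
The transfer function of the coboundary by which convolution with \<open>\<rho>\<close> changes \<open>\<alpha>\<close>.
\<close>

definition kernel_shift :: "('a \<Rightarrow> real^'n::finite \<Rightarrow> real^'n) \<Rightarrow> (real^'n \<Rightarrow> real) \<Rightarrow> 'a \<Rightarrow> real^'n" where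
  "kernel_shift \<alpha> \<rho> x = (\<chi> i. kernel_moment \<alpha> \<rho> i x)"

locale flow_cocycle = compact_flow X act
  for X :: "'a::complete_space set" and act :: "real^'n::finite \<Rightarrow> 'a \<Rightarrow> 'a" +
  fixes \<alpha> :: "'a \<Rightarrow> real^'n \<Rightarrow> real^'n"
  assumes cocycle_cont: "continuous_on (X \<times> UNIV) (\<lambda>(x, u). \<alpha> x u)"
    and cocycle_add: "x \<in> X \<Longrightarrow> \<alpha> x (u + v) = \<alpha> x u + \<alpha> (act u x) v"
begin

lemma cocycle_continuous:
  assumes "continuous_on S f" "continuous_on S g" "\<And>s. s \<in> S \<Longrightarrow> f s \<in> X"
  shows "continuous_on S (\<lambda>s. \<alpha> (f s) (g s))"
proof -
  have "continuous_on S (\<lambda>s. (\<lambda>(x, v). \<alpha> x v) (f s, g s))"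
    by (rule continuous_on_compose2[OF cocycle_cont continuous_on_Pair[OF assms(1,2)]]) (use assms(3) in auto)
  then show ?thesis by simp
qed

lemma cocycle_along_orbit:
  assumes "x \<in> X" shows "continuous_on S (\<lambda>u. \<alpha> x u $ i)"
  by (intro continuous_intros cocycle_continuous) (use assms in auto)

lemma cocycle_0: "x \<in> X \<Longrightarrow> \<alpha> x 0 = 0"
  using cocycle_add[of x 0 0] act_zero[of x] by simp

lemma kernel_moment_continuous:
  assumes "kernel \<kappa>"
  shows "continuous_on X (kernel_moment \<alpha> \<kappa> i)"
proof -
  have "continuous_on X (\<lambda>x. integral (cbox (- 1 *\<^sub>R One) (1 *\<^sub>R One)) (\<lambda>z. \<kappa> z * \<alpha> x z $ i))"
  proof (rule integral_continuous_on_param)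
    show "continuous_on (X \<times> cbox (- 1 *\<^sub>R One) (1 *\<^sub>R One)) (\<lambda>(x, z). \<kappa> z * \<alpha> x z $ i)"
      unfolding case_prod_unfold by (intro continuous_intros kernel_compose_continuous assms cocycle_continuous) auto
  qed
  then show ?thesis by (simp add: kernel_moment_def[abs_def] cube_def)
qed

text \<open>
Along an orbit the convolution of a cocycle splits into a multiple of the cocycle and a function of the
point reached. For kernels of integral \<open>0\<close>, such as partial derivatives, only the latter remains:
this is what makes the derivatives pattern-equivariant.
\<close>

lemma convolve_cocycle:
  assumes "kernel \<kappa>" "x \<in> X"
  shows "convolve \<kappa> (\<lambda>u. \<alpha> x u $ i) u = integral (cube 1) \<kappa> * \<alpha> x u $ i + kernel_moment \<alpha> \<kappa> i (act u x)"
proof -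
  have "(\<lambda>z. \<kappa> z * \<alpha> x (u + z) $ i) = (\<lambda>z. \<kappa> z * \<alpha> x u $ i + \<kappa> z * \<alpha> (act u x) z $ i)"
    by (rule ext) (simp add: cocycle_add[OF assms(2), of u] distrib_left)
  then have "convolve \<kappa> (\<lambda>u. \<alpha> x u $ i) u = integral (cube 1) (\<lambda>z. \<kappa> z * \<alpha> x u $ i + \<kappa> z * \<alpha> (act u x) z $ i)"
    by (simp add: convolve_def)
  also have "\<dots> = integral (cube 1) (\<lambda>z. \<kappa> z * \<alpha> x u $ i) + integral (cube 1) (\<lambda>z. \<kappa> z * \<alpha> (act u x) z $ i)"
    unfolding cube_def
    by (rule integral_add; rule integrable_continuous; rule continuous_on_mult)
      (rule kernel_continuous[OF assms(1)] continuous_on_const cocycle_along_orbit[OF act_in[OF assms(2)]])+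
  finally show ?thesis by (simp add: kernel_moment_def)
qed

lemma smoothed_cocycle_has_derivative:
  assumes \<rho>: "kernel \<rho>" "integral (cube 1) \<rho> = 1" and x: "x \<in> X"
  shows "((\<lambda>u. \<alpha> x u + kernel_shift \<alpha> \<rho> (act u x) - kernel_shift \<alpha> \<rho> x) has_derivative
    (\<lambda>v. slope \<alpha> \<rho> (act u x) *v v)) (at u)"
proof (subst has_derivative_componentwise_within, rule ballI)
  fix b :: "real^'n" assume "b \<in> Basis"
  then obtain i where b: "b = axis i 1" by (auto simp: Basis_vec_def)
  have "((\<lambda>u. convolve \<rho> (\<lambda>u. \<alpha> x u $ i) u - kernel_moment \<alpha> \<rho> i x) has_derivative
      (\<lambda>v. \<Sum>j\<in>UNIV. - convolve (partial j \<rho>) (\<lambda>u. \<alpha> x u $ i) u * v $ j)) (at u)"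
    by (rule has_derivative_diff[OF convolve_has_derivative[OF \<rho>(1) cocycle_along_orbit[OF x]] has_derivative_const, THEN has_derivative_eq_rhs]) simp
  then show "((\<lambda>u. (\<alpha> x u + kernel_shift \<alpha> \<rho> (act u x) - kernel_shift \<alpha> \<rho> x) \<bullet> b) has_derivative
      (\<lambda>v. (slope \<alpha> \<rho> (act u x) *v v) \<bullet> b)) (at u)"
    by (simp add: b inner_axis kernel_shift_def convolve_cocycle[OF \<rho>(1) x] \<rho>(2) slope_def
        matrix_vector_mult_def convolve_cocycle[OF kernel_partial[OF \<rho>(1)] x] integral_partial_kernel[OF \<rho>(1)])
qed

lemma slope_eq_convolve:
  assumes "kernel \<rho>" "x \<in> X"
  shows "slope \<alpha> \<rho> (act u x) $ i $ j = (- 1) * convolve (partial j \<rho>) (\<lambda>u. \<alpha> x u $ i) u"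
  by (simp add: slope_def convolve_cocycle[OF kernel_partial[OF assms(1)] assms(2)] integral_partial_kernel[OF assms(1)])

lemma slope_iterated_partials:
  assumes \<rho>: "kernel \<rho>"
  shows "\<exists>G. continuous_on X G \<and>
    (\<forall>x\<in>X. \<forall>u. foldr partial js (\<lambda>u. slope \<alpha> \<rho> (act u x) $ i $ j) u = G (act u x))"
proof (intro exI conjI ballI allI)
  let ?\<kappa> = "foldr partial js (partial j \<rho>)"
  have k: "kernel ?\<kappa>" by (intro kernel_foldr_partial kernel_partial \<rho>)
  have z: "integral (cube 1) ?\<kappa> = 0"
    by (cases js) (auto intro!: integral_partial_kernel kernel_foldr_partial kernel_partial \<rho>)
  show "continuous_on X (\<lambda>y. - 1 * (- 1) ^ length js * kernel_moment \<alpha> ?\<kappa> i y)"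
    by (intro continuous_intros kernel_moment_continuous k)
  fix x u assume x: "x \<in> X"
  show "foldr partial js (\<lambda>u. slope \<alpha> \<rho> (act u x) $ i $ j) u =
      - 1 * (- 1) ^ length js * kernel_moment \<alpha> ?\<kappa> i (act u x)"
    unfolding slope_eq_convolve[OF \<rho> x] foldr_partial_convolve[OF kernel_partial[OF \<rho>] cocycle_along_orbit[OF x]]
      convolve_cocycle[OF k x] z by simp
qed

lemma slope_smooth:
  assumes \<rho>: "kernel \<rho>" and x: "x \<in> X"
  shows "smooth (\<lambda>u. slope \<alpha> \<rho> (act u x) $ i $ j)"
  unfolding smooth_def
proof
  fix js
  have d: "(\<lambda>u. c * convolve (foldr partial js (partial j \<rho>)) (\<lambda>u. \<alpha> x u $ i) u) differentiable at u" for c u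
    by (intro differentiable_mult differentiable_const convolve_differentiable kernel_foldr_partial kernel_partial \<rho> cocycle_along_orbit x)
  show "foldr partial js (\<lambda>u. slope \<alpha> \<rho> (act u x) $ i $ j) differentiable_on UNIV"
    unfolding slope_eq_convolve[OF \<rho> x] foldr_partial_convolve[OF kernel_partial[OF \<rho>] cocycle_along_orbit[OF x]]
      differentiable_on_def
    by (intro ballI d)
qed

lemma slope_closed:
  assumes \<rho>: "kernel \<rho>" and x: "x \<in> X"
  shows "closed_form (\<lambda>u. slope \<alpha> \<rho> (act u x))"
  unfolding closed_form_def
proof (intro allI)
  fix u i j k
  have "partial k (\<lambda>y. slope \<alpha> \<rho> (act y x) $ i $ j) u = convolve (partial k (partial j \<rho>)) (\<lambda>u. \<alpha> x u $ i) u" for j k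
    unfolding slope_eq_convolve[OF \<rho> x]
    by (subst partial_cmult[OF convolve_differentiable[OF kernel_partial[OF \<rho>] cocycle_along_orbit[OF x]]])
      (simp add: partial_convolve[OF kernel_partial[OF \<rho>] cocycle_along_orbit[OF x]])
  then show "partial k (\<lambda>y. slope \<alpha> \<rho> (act y x) $ i $ j) u = partial j (\<lambda>y. slope \<alpha> \<rho> (act y x) $ i $ k) u"
    using radial_algebra_partial_commute[of \<rho> k j] \<rho> by (simp add: kernel_def)
qed

text \<open>
The transfer function of the coboundary by which averaging over a cube changes \<open>\<alpha>\<close>.
\<close>

definition cube_shift :: "real \<Rightarrow> 'a \<Rightarrow> real^'n" where
  "cube_shift R x = integral (cube R) (\<alpha> x) /\<^sub>R measure lborel (cube R :: (real^'n) set)"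

definition cube_mean :: "real \<Rightarrow> 'a \<Rightarrow> real^'n \<Rightarrow> real^'n" where
  "cube_mean R x u = \<alpha> x u + cube_shift R (act u x) - cube_shift R x"

lemma cube_shift_continuous: "continuous_on X (cube_shift R)"
proof -
  have "continuous_on X (\<lambda>x. integral (cbox (- R *\<^sub>R One) (R *\<^sub>R One)) (\<alpha> x))"
    by (rule integral_continuous_on_param) (rule continuous_on_subset[OF cocycle_cont], auto)
  then show ?thesis unfolding cube_shift_def[abs_def] cube_def by (intro continuous_intros)
qed

lemma cohomologous_cocycle:
  assumes "continuous_on X s"
  shows "flow_cocycle X act (\<lambda>x u. \<alpha> x u + s (act u x) - s x)"
proof
  have "continuous_on (X \<times> UNIV) (\<lambda>p. act (snd p) (fst p))"
    by (intro act_continuous continuous_intros) auto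
  then show "continuous_on (X \<times> UNIV) (\<lambda>(x, u). \<alpha> x u + s (act u x) - s x)"
    unfolding case_prod_unfold
    by (intro continuous_intros cocycle_continuous continuous_on_compose2[OF assms]) (auto intro: act_in)
qed (simp add: cocycle_add act_act)

text \<open>
By the cocycle identity \<open>\<alpha> (act z x) u - \<alpha> x u = \<alpha> (act u x) z - \<alpha> x z\<close>, so \<open>cube_mean\<close> really is
the mean of the displacements \<open>\<alpha> (act z x) u\<close> over \<open>z\<close> in the cube.
\<close>

lemma cube_mean_component:
  assumes x: "x \<in> X" and R: "0 < R"
  shows "cube_mean R x u $ i = integral (cube R) (\<lambda>z. \<alpha> (act z x) u $ i) / measure lborel (cube R :: (real^'n) set)"
proof -
  let ?m = "measure lborel (cube R :: (real^'n) set)"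
  have m: "0 < ?m" using R by (simp add: content_cube)
  have int: "\<alpha> y integrable_on cube R" if "y \<in> X" for y
    unfolding cube_def using that by (intro integrable_continuous cocycle_continuous continuous_intros) auto
  have comp: "integral (cube R) (\<alpha> y) $ i = integral (cube R) (\<lambda>z. \<alpha> y z $ i)"
    and inti: "(\<lambda>z. \<alpha> y z $ i) integrable_on cube R" if "y \<in> X" for y
    using integral_component_eq_cart[OF int[OF that], of i] integrable_component[OF int[OF that], of "axis i 1"]
    by (simp_all add: inner_axis)
  have const: "integral (cube R) (\<lambda>z::real^'n. c) = ?m * c" "(\<lambda>z::real^'n. c) integrable_on cube R" for c :: real
    by (simp_all add: cube_def integrable_const)
  have "\<alpha> (act z x) u $ i = (\<alpha> x u $ i + \<alpha> (act u x) z $ i) - \<alpha> x z $ i" for z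
    using cocycle_add[OF x, of z u] cocycle_add[OF x, of u z] by (simp add: vec_eq_iff add.commute)
  then have "integral (cube R) (\<lambda>z. \<alpha> (act z x) u $ i) =
      integral (cube R) (\<lambda>z. (\<alpha> x u $ i + \<alpha> (act u x) z $ i) - \<alpha> x z $ i)" by simp
  also have "\<dots> = (?m * \<alpha> x u $ i + integral (cube R) (\<alpha> (act u x)) $ i) - integral (cube R) (\<alpha> x) $ i"
    by (simp add: integral_diff integral_add integrable_add const inti comp x act_in)
  finally have eq: "integral (cube R) (\<lambda>z. \<alpha> (act z x) u $ i) =
      (?m * \<alpha> x u $ i + integral (cube R) (\<alpha> (act u x)) $ i) - integral (cube R) (\<alpha> x) $ i" .
  show ?thesis
    unfolding eq using m
    by (simp add: cube_mean_def cube_shift_def divide_inverse_commute distrib_left right_diff_distrib mult.assoc[symmetric])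
qed

text \<open>
Fubini's theorem: first averaging over a cube and then convolving has the averaged slope.
\<close>

lemma slope_cube_mean:
  assumes x: "x \<in> X" and R: "0 < R" and \<rho>: "kernel \<rho>"
  shows "slope (cube_mean R) \<rho> x $ i $ j = cube_average R (\<lambda>y. slope \<alpha> \<rho> y $ i $ j) x"
proof -
  let ?m = "measure lborel (cube R :: (real^'n) set)" and ?\<kappa> = "partial j \<rho>"
  have m: "0 < ?m" using R by (simp add: content_cube)
  have "kernel_moment (cube_mean R) ?\<kappa> i x = integral (cube 1) (\<lambda>u. integral (cube R) (\<lambda>z. ?\<kappa> u * \<alpha> (act z x) u $ i) / ?m)"
    by (simp add: kernel_moment_def cube_mean_component[OF x R])
  also have "\<dots> = integral (cube 1) (\<lambda>u. integral (cube R) (\<lambda>z. ?\<kappa> u * \<alpha> (act z x) u $ i)) / ?m"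
    by simp
  also have "integral (cube 1) (\<lambda>u. integral (cube R) (\<lambda>z. ?\<kappa> u * \<alpha> (act z x) u $ i)) =
      integral (cube R) (\<lambda>z. integral (cube 1) (\<lambda>u. ?\<kappa> u * \<alpha> (act z x) u $ i))"
    unfolding cube_def
  proof (rule integral_swap_continuous)
    have "continuous_on UNIV (\<lambda>p. ?\<kappa> (fst p) * \<alpha> (act (snd p) x) (fst p) $ i)"
      using x by (intro continuous_intros kernel_compose_continuous kernel_partial \<rho> cocycle_continuous act_continuous) (auto intro: act_in)
    then show "continuous_on (cbox (- 1 *\<^sub>R One, - R *\<^sub>R One) (1 *\<^sub>R One, R *\<^sub>R One)) (\<lambda>(u, z). ?\<kappa> u * \<alpha> (act z x) u $ i)"
      unfolding case_prod_unfold by (rule continuous_on_subset) simp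
  qed
  finally show ?thesis by (simp add: slope_def cube_average_def kernel_moment_def)
qed

end

lemma matrix_entries_bound:
  fixes M :: "real^'n::finite^'n"
  assumes "\<And>i j. \<bar>M $ i $ j\<bar> \<le> e"
  shows "norm (M *v v) \<le> real CARD('n) ^ 2 * e * norm v"
proof -
  have "\<bar>(M *v v) $ i\<bar> \<le> real CARD('n) * (e * norm v)" for i
  proof -
    have "\<bar>(M *v v) $ i\<bar> \<le> (\<Sum>j\<in>UNIV. \<bar>M $ i $ j * v $ j\<bar>)"
      unfolding matrix_vector_mult_def by (simp add: sum_abs)
    also have "\<dots> \<le> (\<Sum>j\<in>(UNIV::'n set). e * norm v)"
      unfolding abs_mult using assms order_trans[OF abs_ge_zero assms]
      by (intro sum_mono mult_mono component_le_norm_cart) auto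
    finally show ?thesis by simp
  qed
  then have "(\<Sum>i\<in>UNIV. \<bar>(M *v v) $ i\<bar>) \<le> (\<Sum>i\<in>(UNIV::'n set). real CARD('n) * (e * norm v))"
    by (intro sum_mono)
  then show ?thesis using norm_le_l1_cart[of "M *v v"] by (simp add: power2_eq_square mult.assoc)
qed

text \<open>
Write \<open>A u = B u + g u\<close>, where \<open>g\<close> has a small Lipschitz constant. The growth condition, applied
to large multiples of a vector, shows that \<open>B\<close> expands all vectors by a factor that dominates this
constant. Hence \<open>A\<close> is expanding up to a constant factor, and \<open>A u = y\<close> is a fixed point problem for a contraction.
\<close>

lemma near_linear_homeomorphism:
  fixes A :: "real^'n::finite \<Rightarrow> real^'n" and B :: "real^'n^'n" and D :: "real^'n \<Rightarrow> real^'n^'n"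
  assumes der: "\<And>u. (A has_derivative (\<lambda>v. D u *v v)) (at u)"
    and close: "\<And>u i j. \<bar>D u $ i $ j - B $ i $ j\<bar> \<le> e"
    and growth: "\<And>u. norm u \<le> C * (norm (A u) + M)" and C: "0 < C"
    and e: "C * (real CARD('n) ^ 2 * e) \<le> 1 / 4"
  shows "bij A" "\<And>u v. norm (u - v) \<le> 2 * C * norm (A u - A v)"
proof -
  define q where "q = real CARD('n) ^ 2 * e"
  have "0 \<le> e" using close[of 0] by (meson abs_ge_zero order_trans)
  then have q: "0 \<le> q" "C * q \<le> 1 / 4" using e by (simp_all add: q_def)
  define g where "g u = A u - B *v u" for u
  have gder: "(g has_derivative (\<lambda>v. (D u - B) *v v)) (at u)" for u
    unfolding g_def matrix_vector_mult_diff_rdistrib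
    by (intro has_derivative_diff der bounded_linear_imp_has_derivative matrix_vector_mul_bounded_linear)
  have glip: "norm (g u - g v) \<le> q * norm (u - v)" for u v
  proof (rule differentiable_bound[of UNIV g "\<lambda>u v. (D u - B) *v v"])
    show "onorm (\<lambda>v. (D u - B) *v v) \<le> q" for u
      using matrix_entries_bound[of "D u - B" e] close unfolding q_def by (intro onorm_le) auto
  qed (use gder in \<open>auto intro: has_derivative_at_withinI\<close>)
  have A_le: "norm (A u) \<le> norm (B *v u) + q * norm u + norm (A 0)" for u
  proof -
    have "norm (A u) \<le> norm (B *v u) + norm (g u)" using norm_triangle_ineq[of "B *v u" "g u"] by (simp add: g_def)
    also have "norm (g u) \<le> norm (g u - g 0) + norm (g 0)" using norm_triangle_ineq[of "g u - g 0" "g 0"] by simp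
    also have "norm (g u - g 0) \<le> q * norm u" using glip[of u 0] by simp
    finally show ?thesis by (simp add: g_def)
  qed
  have B_lower: "3 * norm u \<le> 4 * C * norm (B *v u)" for u
  proof (rule ccontr)
    assume "\<not> ?thesis"
    then have pos: "0 < 3 * norm u - 4 * C * norm (B *v u)" by simp
    obtain k :: nat where "4 * C * (norm (A 0) + M) / (3 * norm u - 4 * C * norm (B *v u)) < real k"
      using reals_Archimedean2 by blast
    then have k: "4 * C * (norm (A 0) + M) < real k * (3 * norm u - 4 * C * norm (B *v u))"
      using pos by (simp add: pos_divide_less_eq)
    have "real k * norm u = norm (real k *\<^sub>R u)" by simp
    also have "\<dots> \<le> C * (norm (A (real k *\<^sub>R u)) + M)" by (rule growth)
    also have "\<dots> \<le> C * ((norm (B *v (real k *\<^sub>R u)) + q * norm (real k *\<^sub>R u) + norm (A 0)) + M)"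
      using A_le[of "real k *\<^sub>R u"] C by (intro mult_left_mono add_right_mono) auto
    also have "\<dots> = C * real k * norm (B *v u) + C * q * (real k * norm u) + C * (norm (A 0) + M)"
      by (simp add: matrix_vector_mult_scaleR algebra_simps)
    also have "C * q * (real k * norm u) \<le> 1 / 4 * (real k * norm u)" using q by (intro mult_right_mono) auto
    finally have "real k * (3 * norm u - 4 * C * norm (B *v u)) \<le> 4 * C * (norm (A 0) + M)"
      by (simp add: algebra_simps)
    then show False using k by simp
  qed
  have lower: "norm (u - v) \<le> 2 * C * norm (A u - A v)" for u v
  proof -
    have "norm (B *v (u - v)) \<le> norm (A u - A v) + norm (g u - g v)"
      using norm_triangle_ineq4[of "A u - A v" "g u - g v"]
      by (simp add: g_def matrix_vector_mult_diff_distrib)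
    then have "4 * C * norm (B *v (u - v)) \<le> 4 * C * (norm (A u - A v) + q * norm (u - v))"
      using glip[of u v] C by (intro mult_left_mono) auto
    also have "\<dots> = 4 * C * norm (A u - A v) + 4 * (C * q) * norm (u - v)" by (simp add: algebra_simps)
    also have "4 * (C * q) * norm (u - v) \<le> 1 * norm (u - v)" using q by (intro mult_right_mono) auto
    finally show ?thesis using B_lower[of "u - v"] by linarith
  qed
  show "\<And>u v. norm (u - v) \<le> 2 * C * norm (A u - A v)" by (rule lower)
  have "inj ((*v) B)"
  proof (rule injI)
    fix u v assume "B *v u = B *v v"
    then have "B *v (u - v) = 0" by (simp add: matrix_vector_mult_diff_distrib)
    then show "u = v" using B_lower[of "u - v"] by simp
  qed
  then have "surj ((*v) B)" using linear_injective_imp_surjective matrix_vector_mul_linear by blast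
  then have "\<forall>w. \<exists>u. B *v u = w" by (metis surj_def)
  then obtain Bi where Bi: "\<And>w. B *v (Bi w) = w" by metis
  have "\<exists>u. A u = y" for y
  proof -
    define T where "T u = Bi (y - g u)" for u
    have "\<exists>!u. T u = u"
    proof (rule banach_fix_type[of "1 / 3"], safe)
      fix u v
      have "B *v (T u - T v) = g v - g u" by (simp add: T_def matrix_vector_mult_diff_distrib Bi)
      then have "3 * norm (T u - T v) \<le> 4 * C * (q * norm (u - v))"
        using B_lower[of "T u - T v"] glip[of v u] C by (smt (verit) mult_left_mono norm_minus_commute)
      also have "\<dots> = 4 * (C * q) * norm (u - v)" by (simp add: algebra_simps)
      also have "\<dots> \<le> 1 * norm (u - v)" using q by (intro mult_right_mono) auto
      finally show "dist (T u) (T v) \<le> 1 / 3 * dist u v" by (simp add: dist_norm)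
    qed simp_all
    then obtain u where "T u = u" by blast
    then have "B *v u = y - g u" using Bi[of "y - g u"] by (simp add: T_def)
    then show ?thesis by (intro exI[of _ u]) (simp add: g_def)
  qed
  then have "surj A" by (metis surj_def)
  moreover have "inj A"
  proof (rule injI)
    fix u v assume "A u = A v"
    then show "u = v" using lower[of u v] by simp
  qed
  ultimately show "bij A" by (simp add: bij_def)
qed


section \<open>From an orbit equivalence to a smooth displacement\<close>

lemma linear_form_integral:
  fixes A :: "real^'n::finite \<Rightarrow> real^'n" and \<omega> :: "real^'n \<Rightarrow> real^'n^'n"
  assumes "\<And>u. (A has_derivative (\<lambda>v. \<omega> u *v v)) (at u)" "A 0 = 0"
  shows "form_integral \<omega> = A"
proof
  fix x
  have "((\<lambda>t. \<omega> (t *\<^sub>R x) *v x) has_integral (A (1 *\<^sub>R x) - A (0 *\<^sub>R x))) {0..1}"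
  proof (rule fundamental_theorem_of_calculus)
    fix t :: real
    have "((\<lambda>t. t *\<^sub>R x) has_derivative (\<lambda>s. s *\<^sub>R x)) (at t)" by (auto intro!: derivative_eq_intros)
    from has_derivative_compose[OF this assms(1)]
    have "((\<lambda>t. A (t *\<^sub>R x)) has_derivative (\<lambda>s. s *\<^sub>R (\<omega> (t *\<^sub>R x) *v x))) (at t)"
      by (simp add: matrix_vector_mult_scaleR)
    then show "((\<lambda>t. A (t *\<^sub>R x)) has_vector_derivative \<omega> (t *\<^sub>R x) *v x) (at t within {0..1})"
      unfolding has_vector_derivative_def by (rule has_derivative_at_withinI)
  qed simp
  then show "form_integral \<omega> x = A x" using assms(2) by (simp add: form_integral_def integral_unique)
qed

text \<open>
An orbit equivalence together with a smooth cocycle \<open>A\<close> cohomologous to its displacement \<open>\<alpha>\<close> through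
\<open>S\<close>. The matrix \<open>F\<close> is the derivative of \<open>A\<close>, as a function on the flow space.
\<close>

locale smooth_displacement = flow_orbit_equivalence X actX Y actY h k
  for X :: "'a::complete_space set" and actX :: "real^'n::finite \<Rightarrow> 'a \<Rightarrow> 'a"
    and Y :: "'b::complete_space set" and actY :: "real^'n \<Rightarrow> 'b \<Rightarrow> 'b"
    and h :: "'a \<Rightarrow> 'b" and k :: "'b \<Rightarrow> 'a" +
  fixes \<alpha> A :: "'a \<Rightarrow> real^'n \<Rightarrow> real^'n" and S :: "'a \<Rightarrow> real^'n" and F :: "'a \<Rightarrow> real^'n^'n" and C :: real
  assumes \<alpha>: "x \<in> X \<Longrightarrow> h (actX u x) = actY (\<alpha> x u) (h x)"
    and \<alpha>_cocycle: "flow_cocycle X actX \<alpha>"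
    and \<alpha>_bij: "x \<in> X \<Longrightarrow> bij (\<alpha> x)"
    and A_cocycle: "flow_cocycle X actX A"
    and S_cont: "continuous_on X S"
    and A_eq: "x \<in> X \<Longrightarrow> A x u = \<alpha> x u + S (actX u x) - S x"
    and A_bij: "x \<in> X \<Longrightarrow> bij (A x)"
    and C: "0 < C"
    and A_lower: "x \<in> X \<Longrightarrow> norm (u - v) \<le> C * norm (A x u - A x v)"
    and A_deriv: "x \<in> X \<Longrightarrow> (A x has_derivative (\<lambda>v. F (actX u x) *v v)) (at u)"
    and F_pe: "\<And>i j js. \<exists>G. continuous_on X G \<and> (\<forall>x\<in>X. \<forall>u. foldr partial js (\<lambda>u. F (actX u x) $ i $ j) u = G (actX u x))"
    and F_smooth: "x \<in> X \<Longrightarrow> smooth (\<lambda>u. F (actX u x) $ i $ j)"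
    and F_closed: "x \<in> X \<Longrightarrow> closed_form (\<lambda>u. F (actX u x))"

text \<open>
The cube is chosen so large that the averaged slope is within \<open>e\<close> of the matrix \<open>B\<close> of integrals, at
every point of \<open>X\<close>. Since \<open>\<alpha>\<close> changes only by the bounded coboundary of \<open>S\<close>, the smoothed cocycle inherits the
linear lower growth bound of \<open>\<alpha>\<close>.
\<close>

theorem (in flow_orbit_equivalence) smooth_displacement_exists:
  assumes "X \<noteq> {}" and unique: "\<And>N. invariant_prob X actX N \<Longrightarrow> N = M"
  shows "\<exists>\<alpha> A S F C. smooth_displacement X actX Y actY h k \<alpha> A S F C"
proof -
  obtain \<alpha> C where \<alpha>: "\<And>x u. x \<in> X \<Longrightarrow> h (actX u x) = actY (\<alpha> x u) (h x)"
    "continuous_on (X \<times> UNIV) (\<lambda>(x, u). \<alpha> x u)"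
    "\<And>x u v. x \<in> X \<Longrightarrow> \<alpha> x (u + v) = \<alpha> x u + \<alpha> (actX u x) v"
    "\<And>x. x \<in> X \<Longrightarrow> bij (\<alpha> x)"
    "0 < C" "\<And>x u. x \<in> X \<Longrightarrow> norm u \<le> C * (norm (\<alpha> x u) + 1)"
    by (rule orbit_cocycle[OF assms(1)]) (rule that)
  interpret a: flow_cocycle X actX \<alpha>
    by (intro flow_cocycle.intro X.compact_flow_axioms flow_cocycle_axioms.intro \<alpha>(2,3))
  obtain \<rho> :: "real^'n \<Rightarrow> real" where \<rho>: "kernel \<rho>" "integral (cube 1) \<rho> = 1" by (rule kernel_exists)
  define B :: "real^'n^'n" where "B = (\<chi> i j. integral\<^sup>L M (\<lambda>y. slope \<alpha> \<rho> y $ i $ j))"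
  \<comment> \<open>The accuracy of the slope that \<open>near_linear_homeomorphism\<close> requires.\<close>
  define e where "e = 1 / (4 * C * real CARD('n) ^ 2)"
  have e: "0 < e" "C * (real CARD('n) ^ 2 * e) \<le> 1 / 4" using \<alpha>(5) by (simp_all add: e_def)
  have "\<exists>R0. \<forall>R\<ge>R0. \<forall>x\<in>X. \<bar>X.cube_average R (\<lambda>y. slope \<alpha> \<rho> y $ i $ j) x - B $ i $ j\<bar> < e" for i j
  proof -
    have "continuous_on X (\<lambda>y. slope \<alpha> \<rho> y $ i $ j)"
      by (simp add: slope_def) (intro continuous_intros a.kernel_moment_continuous kernel_partial \<rho>)
    from X.uniform_cube_averages[OF unique this e(1)] show ?thesis by (simp add: B_def)
  qed
  then obtain R0 where R0: "\<And>i j R x. R0 i j \<le> R \<Longrightarrow> x \<in> X \<Longrightarrow>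
      \<bar>X.cube_average R (\<lambda>y. slope \<alpha> \<rho> y $ i $ j) x - B $ i $ j\<bar> < e" by metis
  define R where "R = Max (insert 1 ((\<lambda>(i, j). R0 i j) ` UNIV))"
  have R: "0 < R" "R0 i j \<le> R" for i j
  proof -
    have "1 \<le> R" unfolding R_def by (rule Max_ge) auto
    then show "0 < R" by simp
    show "R0 i j \<le> R" unfolding R_def by (rule Max_ge) (auto intro!: image_eqI[of _ _ "(i, j)"])
  qed
  define b where "b = a.cube_mean R"
  interpret b: flow_cocycle X actX b
    unfolding b_def a.cube_mean_def[abs_def] by (rule a.cohomologous_cocycle[OF a.cube_shift_continuous])
  define F where "F = slope b \<rho>"
  define s where "s = kernel_shift b \<rho>"
  define A where "A x u = b x u + s (actX u x) - s x" for x u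
  define S where "S x = a.cube_shift R x + s x" for x
  have s_cont: "continuous_on X s"
    unfolding s_def kernel_shift_def[abs_def] by (intro continuous_intros b.kernel_moment_continuous \<rho>)
  have S_cont: "continuous_on X S"
    unfolding S_def[abs_def] by (intro continuous_intros s_cont a.cube_shift_continuous)
  have A_eq: "A x u = \<alpha> x u + S (actX u x) - S x" for x u
    by (simp add: A_def b_def a.cube_mean_def S_def)
  have A_deriv: "(A x has_derivative (\<lambda>v. F (actX u x) *v v)) (at u)" if "x \<in> X" for x u
    using b.smoothed_cocycle_has_derivative[OF \<rho> that] by (simp add: A_def[abs_def] s_def F_def)
  have F_close: "\<bar>F x $ i $ j - B $ i $ j\<bar> \<le> e" if "x \<in> X" for x i j
    using R0[OF R(2) that, of i j] a.slope_cube_mean[OF that R(1) \<rho>(1), of i j] by (simp add: F_def b_def)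
  obtain K where "\<forall>y \<in> S ` X. norm y \<le> K"
    using compact_imp_bounded[OF compact_continuous_image[OF S_cont X.compact]] unfolding bounded_iff by metis
  then have K: "norm (S x) \<le> K" if "x \<in> X" for x using that by blast
  have growth: "norm u \<le> C * (norm (A x u) + (2 * K + 1))" if x: "x \<in> X" for x u
  proof -
    have "\<alpha> x u = A x u - S (actX u x) + S x" by (simp add: A_eq)
    then have "norm (\<alpha> x u) \<le> norm (A x u) + norm (S (actX u x)) + norm (S x)"
      using norm_triangle_ineq[of "A x u - S (actX u x)" "S x"] norm_triangle_ineq4[of "A x u" "S (actX u x)"] by simp
    also have "\<dots> \<le> norm (A x u) + 2 * K" using K[OF x] K[OF X.act_in[OF x, of u]] by simp
    finally have "C * (norm (\<alpha> x u) + 1) \<le> C * (norm (A x u) + (2 * K + 1))"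
      using \<alpha>(5) by (intro mult_left_mono) auto
    then show ?thesis using \<alpha>(6)[OF x, of u] by linarith
  qed
  have lin: "bij (A x) \<and> (\<forall>u v. norm (u - v) \<le> 2 * C * norm (A x u - A x v))" if x: "x \<in> X" for x
    using near_linear_homeomorphism[OF A_deriv[OF x] F_close[OF X.act_in[OF x]] growth[OF x] \<alpha>(5) e(2)] by blast
  have "smooth_displacement X actX Y actY h k \<alpha> A S F (2 * C)"
  proof (intro smooth_displacement.intro smooth_displacement_axioms.intro flow_orbit_equivalence_axioms)
    show "\<exists>G. continuous_on X G \<and> (\<forall>x\<in>X. \<forall>u. foldr partial js (\<lambda>u. F (actX u x) $ i $ j) u = G (actX u x))" for i j js
      unfolding F_def by (rule b.slope_iterated_partials[OF \<rho>(1)])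
    show "flow_cocycle X actX \<alpha>" by (rule a.flow_cocycle_axioms)
    show "flow_cocycle X actX A" unfolding A_def[abs_def] by (rule b.cohomologous_cocycle[OF s_cont])
    show "smooth (\<lambda>u. F (actX u x) $ i $ j)" if "x \<in> X" for x i j unfolding F_def by (rule b.slope_smooth[OF \<rho>(1) that])
    show "closed_form (\<lambda>u. F (actX u x))" if "x \<in> X" for x unfolding F_def by (rule b.slope_closed[OF \<rho>(1) that])
  qed (use \<alpha> S_cont A_eq lin A_deriv in auto)
  then show ?thesis by blast
qed

context smooth_displacement
begin

interpretation \<alpha>: flow_cocycle X actX \<alpha> by (rule \<alpha>_cocycle)
interpretation A: flow_cocycle X actX A by (rule A_cocycle)

lemma form_integral_F: "x \<in> X \<Longrightarrow> form_integral (\<lambda>u. F (actX u x)) = A x"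
  by (rule linear_form_integral[OF A_deriv A.cocycle_0])

text \<open>
Translating \<open>x\<close> by \<open>rewind x\<close> compensates the coboundary of \<open>S\<close>: this is the vector field of the
quasi-translation.
\<close>

definition rewind :: "'a \<Rightarrow> real^'n" where
  "rewind x = inv (A x) (- S x)"

lemma A_rewind: "x \<in> X \<Longrightarrow> A x (rewind x) = - S x"
  unfolding rewind_def using A_bij by (metis bij_inv_eq_iff)

lemma rewind_continuous: "continuous_on X rewind"
  unfolding continuous_on_def
proof
  fix y assume y: "y \<in> X"
  have "continuous_on X (\<lambda>x. C * norm (S x + A x (rewind y)))"
    by (intro continuous_intros S_cont A.cocycle_continuous)
  then have "((\<lambda>x. C * norm (S x + A x (rewind y))) \<longlongrightarrow> C * norm (S y + A y (rewind y))) (at y within X)"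
    using y by (auto simp: continuous_on_def)
  then have lim: "((\<lambda>x. C * norm (S x + A x (rewind y))) \<longlongrightarrow> 0) (at y within X)" using A_rewind[OF y] by simp
  have "\<forall>\<^sub>F x in at y within X. dist (rewind x) (rewind y) \<le> C * norm (S x + A x (rewind y))"
    unfolding eventually_at_filter
  proof (intro always_eventually allI impI)
    fix x assume x: "x \<in> X"
    have "norm (rewind x - rewind y) \<le> C * norm (A x (rewind x) - A x (rewind y))" by (rule A_lower[OF x])
    also have "norm (A x (rewind x) - A x (rewind y)) = norm (S x + A x (rewind y))"
      unfolding A_rewind[OF x] by (metis minus_add_distrib norm_minus_cancel uminus_add_conv_diff add.commute)
    finally show "dist (rewind x) (rewind y) \<le> C * norm (S x + A x (rewind y))" by (simp add: dist_norm)
  qed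
  then have "((\<lambda>x. dist (rewind x) (rewind y)) \<longlongrightarrow> 0) (at y within X)"
    by (rule real_tendsto_sandwich[OF always_eventually _ tendsto_const lim, rotated]) simp
  then show "(rewind \<longlongrightarrow> rewind y) (at y within X)" by (rule tendsto_dist_iff[THEN iffD2])
qed

definition quasi :: "'a \<Rightarrow> 'a" where
  "quasi x = actX (rewind x) x"

lemma A_shifted_rewind:
  assumes x: "x \<in> X"
  shows "A x (v + rewind (actX v x)) = \<alpha> x v - S x"
  using A.cocycle_add[OF x, of v "rewind (actX v x)"] A_rewind[OF X.act_in[OF x, of v]] A_eq[OF x, of v] by simp

lemma quasi_act:
  assumes x: "x \<in> X"
  shows "quasi (actX v x) = actX (v + rewind (actX v x)) x"
  using X.act_act[OF x] by (simp add: quasi_def)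

lemma quasi_continuous: "continuous_on X quasi"
  unfolding quasi_def[abs_def] by (intro X.act_continuous rewind_continuous continuous_intros)

text \<open>
On the orbit of \<open>x\<close> the quasi-translation reads \<open>v \<mapsto> (A x)\<^sup>-\<^sup>1 (\<alpha> x v - S x)\<close> by \<open>A_shifted_rewind\<close>, a
bijection because \<open>\<alpha> x\<close> and \<open>A x\<close> are bijections.
\<close>

lemma quasi_bij: "bij_betw quasi X X"
  unfolding bij_betw_def
proof
  show "inj_on quasi X"
  proof (rule inj_onI)
    fix x y assume x: "x \<in> X" and y: "y \<in> X" and eq: "quasi x = quasi y"
    define v where "v = rewind x - rewind y"
    have "actX v x = actX (- rewind y) (quasi x)" using X.act_act[OF x] by (simp add: quasi_def v_def)
    also have "\<dots> = y" using eq X.act_act[OF y] X.act_zero[OF y] by (simp add: quasi_def)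
    finally have v: "actX v x = y" .
    have "\<alpha> x v - S x = - S x" using A_shifted_rewind[OF x, of v] A_rewind[OF x] v by (simp add: v_def)
    then have "\<alpha> x v = \<alpha> x 0" using \<alpha>.cocycle_0[OF x] by simp
    then have "v = 0" using \<alpha>_bij[OF x] by (meson bij_def injD)
    then show "x = y" using v X.act_zero[OF x] by simp
  qed
  show "quasi ` X = X"
  proof (intro equalityI subsetI)
    fix x assume x: "x \<in> X"
    obtain v where v: "\<alpha> x v = S x" using \<alpha>_bij[OF x] by (metis bij_pointE)
    have "A x (v + rewind (actX v x)) = A x 0" using A_shifted_rewind[OF x, of v] v A.cocycle_0[OF x] by simp
    then have "v + rewind (actX v x) = 0" using A_bij[OF x] by (meson bij_def injD)
    then have "quasi (actX v x) = x" using quasi_act[OF x] X.act_zero[OF x] by simp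
    then show "x \<in> quasi ` X" using X.act_in[OF x] by (metis image_eqI)
  qed (auto simp: quasi_def intro: X.act_in)
qed

lemma A_inverse_growth:
  assumes x: "x \<in> X" shows "norm u \<le> C * norm (A x u)"
  using A_lower[OF x, of u 0] A.cocycle_0[OF x] by simp

lemma A_bounded: "\<exists>K. \<forall>x\<in>X. \<forall>u. norm u \<le> r \<longrightarrow> norm (A x u) \<le> K"
proof -
  have "compact ((\<lambda>(x, u). A x u) ` (X \<times> cball 0 r))"
    by (rule compact_continuous_image[OF continuous_on_subset[OF A.cocycle_cont]])
      (auto intro: compact_Times[OF X.compact])
  from compact_imp_bounded[OF this]
  obtain K where "\<forall>z \<in> (\<lambda>(x, u). A x u) ` (X \<times> cball 0 r). norm z \<le> K"
    unfolding bounded_iff by metis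
  then show ?thesis by (intro exI[of _ K]) auto
qed

end


section \<open>Tiling spaces as compact flows\<close>

text \<open>
A point is recorded by its distances to a dense sequence.
\<close>

lemma compact_metric_embedding:
  fixes M :: "'a set"
  assumes "Metric_space M d" "compact_space (Metric_space.mtopology M d)" "M \<noteq> {}"
  shows "\<exists>(E :: 'a \<Rightarrow> nat \<Rightarrow> real) E'. homeomorphic_maps (Metric_space.mtopology M d) (top_of_set (E ` M)) E E'"
proof -
  interpret Metric_space M d by fact
  have "mtotally_bounded M" using assms(2) compact_space_eq_mcomplete_mtotally_bounded by blast
  then have "\<exists>K. finite K \<and> K \<subseteq> M \<and> M \<subseteq> (\<Union>x\<in>K. mball x (1 / real (Suc m)))" for m
    unfolding mtotally_bounded_def by simp
  then obtain K where K: "\<And>m. finite (K m)" "\<And>m. K m \<subseteq> M" "\<And>m. M \<subseteq> (\<Union>x\<in>K m. mball x (1 / real (Suc m)))" by metis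
  define Q where "Q = (\<Union>m. K m)"
  have "Q \<noteq> {}" using K(3)[of 0] assms(3) by (auto simp: Q_def)
  moreover have "countable Q" unfolding Q_def by (intro countable_UN) (auto intro: countable_finite K(1))
  ultimately have q: "range (from_nat_into Q) = Q" by simp
  define E where "E x n = d x (from_nat_into Q n)" for x n
  have QM: "from_nat_into Q n \<in> M" for n using q K(2) by (auto simp: Q_def)
  have "continuous_map mtopology euclideanreal (\<lambda>x. E x n)" for n
    unfolding mtopology_is_euclidean[symmetric] metric_continuous_map[OF Met_TC.Metric_space_axioms]
  proof (intro conjI ballI allI impI)
    fix x and e :: real assume "x \<in> M" "0 < e"
    have "dist (E x n) (E y n) < e" if "y \<in> M" "d x y < e" for y
      using mdist_reverse_triangle[of x "from_nat_into Q n" y] triangle[of x y "from_nat_into Q n"] triangle[of y x "from_nat_into Q n"]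
        that \<open>x \<in> M\<close> QM commute unfolding E_def dist_real_def by (smt (verit))
    then show "\<exists>\<delta>>0. \<forall>y. y \<in> M \<and> d x y < \<delta> \<longrightarrow> dist (E x n) (E y n) < e" using \<open>0 < e\<close> by blast
  qed simp
  then have "continuous_map mtopology (product_topology (\<lambda>_. euclidean) UNIV) E"
    by (simp add: continuous_map_componentwise_UNIV)
  then have "continuous_map mtopology (top_of_set (E ` M)) E"
    by (simp add: euclidean_product_topology continuous_map_in_subtopology)
  moreover have "inj_on E M"
  proof (rule inj_onI, rule ccontr)
    fix x y assume xy: "x \<in> M" "y \<in> M" "E x = E y" "x \<noteq> y"
    then have "0 < d x y" by simp
    then obtain m where m: "1 / real (Suc m) < d x y / 2" using nat_approx_posE by (metis half_gt_zero)
    obtain z where z: "z \<in> K m" "x \<in> mball z (1 / real (Suc m))" using K(3) xy(1) by blast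
    then obtain n where n: "z = from_nat_into Q n" using q by (metis (no_types, lifting) Q_def UN_I UNIV_I rangeE)
    have "d x z = d y z" using xy(3) n unfolding E_def by metis
    then show False using triangle[of x z y] z m xy commute[of z x] commute[of z y] by auto
  qed
  ultimately have "homeomorphic_map mtopology (top_of_set (E ` M)) E"
    using assms(2) by (intro continuous_imp_homeomorphic_map) (auto simp: Hausdorff_space_subtopology)
  then show ?thesis using homeomorphic_map_maps by blast
qed

lemma translate_tile_add [simp]: "translate_tile w (translate_tile v t) = translate_tile (v + w) t"
  by (simp add: translate_tile_def image_image diff_diff_eq)

lemma translate_tile_0 [simp]: "translate_tile 0 t = t"
  by (simp add: translate_tile_def)

lemma translate_translate: "translate w (translate v T) = translate (v + w) T"
  by (simp add: translate_def image_image)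

lemma translate_0 [simp]: "translate 0 T = T"
  by (simp add: translate_def)

lemma tile_dist_translate [simp]: "tile_dist dl (translate_tile x t) (translate_tile x s) = tile_dist dl t s"
  by (simp add: tile_dist_def translate_tile_def hausdorff_dist_def dist_norm)

lemma tile_dist_translate_le:
  assumes "Metric_space L dl" "snd t \<in> L"
  shows "tile_dist dl t (translate_tile v t) \<le> norm v"
proof -
  interpret Metric_space L dl by fact
  have "hausdorff_dist (fst t) (fst (translate_tile v t)) \<le> norm v"
    by (rule hausdorff_dist_le) (auto simp: translate_tile_def dist_norm intro!: bexI)
  then show ?thesis using assms(2) by (simp add: tile_dist_def translate_tile_def)
qed

lemma tiling_close_translate:
  fixes T S :: "('v::euclidean_space, 'l) tiling"
  assumes close: "tiling_close dl a T S" and ab: "a \<le> b" "1 / b + norm x \<le> 1 / a"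
  shows "tiling_close dl b (translate x T) (translate x S)"
proof -
  obtain T0 S0 f where f: "T0 \<subseteq> T" "S0 \<subseteq> S" "bij_betw f T0 S0"
    "{t\<in>T. fst t \<inter> cball 0 (1 / a) \<noteq> {}} \<subseteq> T0" "{s\<in>S. fst s \<inter> cball 0 (1 / a) \<noteq> {}} \<subseteq> S0"
    "\<forall>t\<in>T0. tile_dist dl t (f t) < a"
    using close unfolding tiling_close_def by blast
  let ?p = "translate_tile x :: ('v, 'l) tile \<Rightarrow> _" and ?m = "translate_tile (- x) :: ('v, 'l) tile \<Rightarrow> _"
  have bij: "bij_betw (?p \<circ> f \<circ> ?m) (?p ` T0) (?p ` S0)"
  proof -
    have "bij_betw ?m (?p ` T0) T0" by (rule bij_betw_byWitness[where f' = ?p]) auto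
    moreover have "bij_betw ?p S0 (?p ` S0)" by (rule bij_betw_byWitness[where f' = ?m]) auto
    ultimately show ?thesis using f(3) by (metis bij_betw_trans comp_assoc)
  qed
  have meet: "{t\<in>translate x U. fst t \<inter> cball 0 (1 / b) \<noteq> {}} \<subseteq> ?p ` U0"
    if U0: "{t\<in>U. fst t \<inter> cball 0 (1 / a) \<noteq> {}} \<subseteq> U0" for U U0 :: "('v, 'l) tiling"
  proof
    fix t' assume "t' \<in> {t\<in>translate x U. fst t \<inter> cball 0 (1 / b) \<noteq> {}}"
    then obtain t where t: "t \<in> U" "t' = ?p t" and meets: "fst (?p t) \<inter> cball 0 (1 / b) \<noteq> {}"
      by (auto simp: translate_def)
    obtain y where y: "y \<in> fst t" "norm (y - x) \<le> 1 / b" using meets by (auto simp: translate_tile_def)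
    have "norm y \<le> 1 / a" using y(2) ab(2) norm_triangle_sub[of y x] by linarith
    then have "t \<in> {t\<in>U. fst t \<inter> cball 0 (1 / a) \<noteq> {}}" using t y by auto
    then show "t' \<in> ?p ` U0" using U0 t(2) by blast
  qed
  have "\<forall>t\<in>?p ` T0. tile_dist dl t ((?p \<circ> f \<circ> ?m) t) < b" using f(6) ab(1) by fastforce
  then show ?thesis
    unfolding tiling_close_def using f(1,2)
    by (intro exI[of _ "?p ` T0"] exI[of _ "?p ` S0"] exI[of _ "?p \<circ> f \<circ> ?m"] conjI bij meet f(4,5))
      (auto simp: translate_def)
qed

lemma tiling_close_small_translate:
  fixes T :: "('v::euclidean_space, 'l) tiling"
  assumes "Metric_space L dl" "T \<in> all_tilings L" "norm v < b"
  shows "tiling_close dl b T (translate v T)"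
proof -
  have bij: "bij_betw (translate_tile v) T (translate v T)"
    by (rule bij_betw_byWitness[where f' = "translate_tile (- v)"]) (auto simp: translate_def)
  have "\<forall>t\<in>T. tile_dist dl t (translate_tile v t) < b"
    using tile_dist_translate_le[OF assms(1)] regular_tile_all_tilings[OF assms(2)] assms(3)
    by (metis le_less_trans regular_tile_def)
  then show ?thesis
    unfolding tiling_close_def by (intro exI[of _ T] exI[of _ "translate v T"] exI[of _ "translate_tile v"] conjI bij) auto
qed

locale compact_tiling_space =
  fixes L :: "'l set" and dl :: "'l \<Rightarrow> 'l \<Rightarrow> real" and \<Omega> :: "(real^'n::finite, 'l) tiling set"
  assumes tiling_space: "tiling_space L dl \<Omega>" and nonempty: "\<Omega> \<noteq> {}"
begin

lemma label_metric: "Metric_space L dl"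
  using tiling_space by (simp add: tiling_space_def compact_metric_def)

lemma \<Omega>_tilings: "\<Omega> \<subseteq> all_tilings L"
  using tiling_space by (auto simp: tiling_space_def all_tilings_def)

lemma translate_in: "T \<in> \<Omega> \<Longrightarrow> translate x T \<in> \<Omega>"
  using tiling_space by (simp add: tiling_space_def)

sublocale Submetric "all_tilings L" "tiling_dist dl :: (real^'n, 'l) tiling \<Rightarrow> _" \<Omega>
  using Metric_space_all_tilings[OF label_metric] \<Omega>_tilings by (simp add: Submetric_def Submetric_axioms_def)

lemma metric_\<Omega>: "Metric_space \<Omega> (tiling_dist dl)" by (rule sub.Metric_space_axioms)

lemma space_topology_eq: "space_topology L dl \<Omega> = Metric_space.mtopology \<Omega> (tiling_dist dl)"
  by (simp add: space_topology_def tiling_topology_def mtopology_submetric)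

lemma compact_\<Omega>: "compact_space (space_topology L dl \<Omega>)"
  using tiling_space by (simp add: space_topology_def tiling_space_def compactin_subspace)

lemma topspace_\<Omega>: "topspace (space_topology L dl \<Omega>) = \<Omega>"
  by (simp add: space_topology_eq)

text \<open>
Translation is continuous, uniformly for vectors in a ball. A translation by \<open>x\<close> costs a radius of
\<open>norm x\<close> in the comparison of patches, hence the choice of \<open>a\<close>.
\<close>

lemma translate_uniform:
  assumes "0 < e"
  shows "\<exists>\<delta>>0. \<forall>T\<in>\<Omega>. \<forall>S\<in>\<Omega>. \<forall>x y. norm x \<le> K \<longrightarrow> dist x y < \<delta> \<longrightarrow> tiling_dist dl T S < \<delta> \<longrightarrow>
    tiling_dist dl (translate x T) (translate y S) < e"
proof -
  define b' where "b' = min (e / 2) 1"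
  define b where "b = b' / 2"
  define a where "a = 1 / (1 / b + max 0 K)"
  have b: "0 < b'" "b' \<le> 1" "2 * b' \<le> e" "0 < b" "b < b'" using assms by (auto simp: b'_def b_def)
  have den: "1 / b \<le> 1 / b + max 0 K" "0 < 1 / b" using b by auto
  then have "0 < 1 / b + max 0 K" by linarith
  then have a: "0 < a" "1 / a = 1 / b + max 0 K" by (simp_all add: a_def)
  have "a \<le> b"
    using den frac_le[of 1 1 "1 / b" "1 / b + max 0 K"] by (simp add: a_def)
  have "tiling_dist dl (translate x T) (translate y S) < e"
    if T: "T \<in> \<Omega>" and S: "S \<in> \<Omega>" and x: "norm x \<le> K" "dist x y < a" and TS: "tiling_dist dl T S < a" for T S x y
  proof -
    have "a \<le> 1" using \<open>a \<le> b\<close> b by simp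
    then obtain a' where a': "0 < a'" "a' < a" "tiling_close dl a' T S"
      using TS tiling_dist_less_iff[OF label_metric] by blast
    then have "tiling_close dl a T S" using tiling_close_mono[OF label_metric] by (metis less_imp_le)
    then have "tiling_close dl b (translate x T) (translate x S)"
      using \<open>a \<le> b\<close> x(1) a(2) by (intro tiling_close_translate) auto
    then have 1: "tiling_dist dl (translate x T) (translate x S) < b'"
      unfolding tiling_dist_less_iff[OF label_metric b(2)] using b by blast
    have "translate x S \<in> all_tilings L" using translate_in[OF S] \<Omega>_tilings by blast
    moreover have "norm (y - x) < b" using x(2) \<open>a \<le> b\<close> by (simp add: dist_norm norm_minus_commute)
    ultimately have "tiling_close dl b (translate x S) (translate (y - x) (translate x S))"
      by (rule tiling_close_small_translate[OF label_metric])
    then have "tiling_close dl b (translate x S) (translate y S)" by (simp add: translate_translate)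
    then have 2: "tiling_dist dl (translate x S) (translate y S) < b'"
      unfolding tiling_dist_less_iff[OF label_metric b(2)] using b by blast
    have "tiling_dist dl (translate x T) (translate y S) \<le>
        tiling_dist dl (translate x T) (translate x S) + tiling_dist dl (translate x S) (translate y S)"
      by (rule sub.triangle) (use translate_in T S in auto)
    then show ?thesis using 1 2 b(3) by linarith
  qed
  then show ?thesis using a(1) by blast
qed

text \<open>
The copy of the tiling space inside \<open>nat \<Rightarrow> real\<close> makes the theory of flows in metric types applicable.
\<close>

definition code :: "(real^'n, 'l) tiling \<Rightarrow> nat \<Rightarrow> real" where
  "code = (SOME E. \<exists>E'. homeomorphic_maps (space_topology L dl \<Omega>) (top_of_set (E ` \<Omega>)) E E')"

definition decode :: "(nat \<Rightarrow> real) \<Rightarrow> (real^'n, 'l) tiling" where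
  "decode = (SOME E'. homeomorphic_maps (space_topology L dl \<Omega>) (top_of_set (code ` \<Omega>)) code E')"

abbreviation coded :: "(nat \<Rightarrow> real) set" where "coded \<equiv> code ` \<Omega>"

definition act :: "real^'n \<Rightarrow> (nat \<Rightarrow> real) \<Rightarrow> nat \<Rightarrow> real" where
  "act v x = code (translate v (decode x))"

lemma code_decode: "homeomorphic_maps (space_topology L dl \<Omega>) (top_of_set coded) code decode"
proof -
  have ex: "\<exists>E :: _ \<Rightarrow> nat \<Rightarrow> real. \<exists>E'. homeomorphic_maps (space_topology L dl \<Omega>) (top_of_set (E ` \<Omega>)) E E'"
    using compact_metric_embedding[OF metric_\<Omega> _ nonempty] compact_\<Omega> unfolding space_topology_eq by blast
  have "\<exists>E'. homeomorphic_maps (space_topology L dl \<Omega>) (top_of_set (code ` \<Omega>)) code E'"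
    unfolding code_def by (rule someI_ex[OF ex])
  then show ?thesis unfolding decode_def by (rule someI_ex)
qed

lemma code_homeomorphic: "homeomorphic_map (space_topology L dl \<Omega>) (top_of_set coded) code"
  and decode_homeomorphic: "homeomorphic_map (top_of_set coded) (space_topology L dl \<Omega>) decode"
  using code_decode homeomorphic_maps_map by blast+

lemma code_continuous: "continuous_map (space_topology L dl \<Omega>) (top_of_set coded) code"
  and decode_continuous: "continuous_map (top_of_set coded) (space_topology L dl \<Omega>) decode"
  and decode_code: "T \<in> \<Omega> \<Longrightarrow> decode (code T) = T"
  and code_decode_id: "x \<in> coded \<Longrightarrow> code (decode x) = x"
  using code_decode by (auto simp: homeomorphic_maps_def topspace_\<Omega>)

lemma decode_in: "x \<in> coded \<Longrightarrow> decode x \<in> \<Omega>"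
  using decode_code by auto

lemma act_code: "T \<in> \<Omega> \<Longrightarrow> act v (code T) = code (translate v T)"
  by (simp add: act_def decode_code)

lemma decode_act: "x \<in> coded \<Longrightarrow> decode (act v x) = translate v (decode x)"
  by (simp add: act_def decode_code translate_in decode_in)

lemma code_near:
  assumes "T \<in> \<Omega>" "0 < e"
  shows "\<exists>\<delta>>0. \<forall>S\<in>\<Omega>. tiling_dist dl T S < \<delta> \<longrightarrow> dist (code T) (code S) < e"
proof -
  have "continuous_map (space_topology L dl \<Omega>) euclidean code"
    using code_continuous continuous_map_in_subtopology by blast
  then show ?thesis
    unfolding space_topology_eq mtopology_is_euclidean[symmetric]
      sub.metric_continuous_map[OF Met_TC.Metric_space_axioms] using assms by meson
qed

lemma compact_coded: "compact coded"
proof -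
  have "compact_space (top_of_set coded)"
    using compact_\<Omega> code_homeomorphic homeomorphic_compact_space homeomorphic_map_imp_homeomorphic_space by blast
  then show ?thesis using compact_space_subtopology compactin_euclidean_iff compact_space_def
    by (metis compactin_subtopology order_refl topspace_euclidean_subtopology)
qed

sublocale flow: compact_flow coded act
proof
  show "compact coded" by (rule compact_coded)
  show "act v x \<in> coded" if "x \<in> coded" for x v
    using translate_in[OF decode_in[OF that]] by (simp add: act_def)
  show "act 0 x = x" if "x \<in> coded" for x using code_decode_id[OF that] by (simp add: act_def)
  show "act w (act v x) = act (v + w) x" if "x \<in> coded" for x v w
    using decode_act[OF that, of v] by (simp add: act_def[of w] act_def[of "v + w"] translate_translate)
  show "continuous_on (coded \<times> UNIV) (\<lambda>(x, v). act v x)"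
    unfolding continuous_on_iff
  proof (intro ballI allI impI)
    fix p :: "(nat \<Rightarrow> real) \<times> (real^'n)" and e :: real assume p: "p \<in> coded \<times> UNIV" and e: "0 < e"
    obtain x0 v0 where p_eq: "p = (x0, v0)" "x0 \<in> coded" using p by blast
    obtain d1 where d1: "0 < d1" "\<And>S. S \<in> \<Omega> \<Longrightarrow> tiling_dist dl (translate v0 (decode x0)) S < d1 \<Longrightarrow>
        dist (code (translate v0 (decode x0))) (code S) < e"
      using code_near[OF translate_in[OF decode_in[OF p_eq(2)]] e, of v0] by blast
    obtain d2 where d2: "0 < d2" "\<And>T S x y. T \<in> \<Omega> \<Longrightarrow> S \<in> \<Omega> \<Longrightarrow> norm x \<le> norm v0 \<Longrightarrow> dist x y < d2 \<Longrightarrow>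
        tiling_dist dl T S < d2 \<Longrightarrow> tiling_dist dl (translate x T) (translate y S) < d1"
      using translate_uniform[OF d1(1), of "norm v0"] by blast
    have "openin (space_topology L dl \<Omega>) {S \<in> \<Omega>. tiling_dist dl (decode x0) S < d2}"
      using sub.openin_mball[of "decode x0" d2] decode_in[OF p_eq(2)] by (simp add: space_topology_eq sub.mball_def)
    then have "openin (top_of_set coded) {x \<in> coded. decode x \<in> {S \<in> \<Omega>. tiling_dist dl (decode x0) S < d2}}"
      using decode_continuous openin_continuous_map_preimage by fastforce
    moreover have "x0 \<in> {x \<in> coded. decode x \<in> {S \<in> \<Omega>. tiling_dist dl (decode x0) S < d2}}"
      using p_eq(2) d2(1) decode_in[OF p_eq(2)] by simp
    ultimately obtain d3 where d3: "0 < d3" "\<And>x. x \<in> coded \<Longrightarrow> dist x x0 < d3 \<Longrightarrow> tiling_dist dl (decode x0) (decode x) < d2"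
      unfolding openin_euclidean_subtopology_iff by blast
    show "\<exists>d>0. \<forall>q\<in>coded \<times> UNIV. dist q p < d \<longrightarrow> dist (case q of (x, v) \<Rightarrow> act v x) (case p of (x, v) \<Rightarrow> act v x) < e"
    proof (intro exI[of _ "min d2 d3"] conjI ballI impI)
      show "0 < min d2 d3" using d2 d3 by simp
      fix q assume q: "q \<in> coded \<times> (UNIV :: (real^'n) set)" "dist q p < min d2 d3"
      obtain x v where q_eq: "q = (x, v)" "x \<in> coded" using q by blast
      have "dist x x0 < d3" "dist v0 v < d2"
        using q(2) dist_fst_le[of q p] dist_snd_le[of q p] by (auto simp: p_eq q_eq dist_commute)
      then have "tiling_dist dl (translate v0 (decode x0)) (translate v (decode x)) < d1"
        using d3(2) q_eq(2) p_eq(2) by (intro d2(2) decode_in) auto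
      then have "dist (act v0 x0) (act v x) < e"
        unfolding act_def by (intro d1(2) translate_in decode_in q_eq(2))
      then show "dist (case q of (x, v) \<Rightarrow> act v x) (case p of (x, v) \<Rightarrow> act v x) < e"
        by (simp add: p_eq q_eq dist_commute)
    qed
  qed
qed

lemma flow_free: "aperiodic \<Omega> \<Longrightarrow> free_on coded act"
  unfolding free_on_def aperiodic_def
proof (intro ballI allI impI)
  fix x v assume *: "\<forall>T\<in>\<Omega>. \<forall>x. translate x T = T \<longrightarrow> x = 0" "x \<in> coded" "act v x = x"
  then have "translate v (decode x) = decode x" using decode_act by metis
  then show "v = 0" using * decode_in by blast
qed

lemma flow_minimal: 
  assumes "minimal L dl \<Omega>" shows "minimal_on coded act"
  unfolding minimal_on_def
proof
  fix x assume x: "x \<in> coded"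
  have orb: "orbit (decode x) \<subseteq> \<Omega>" using translate_in decode_in[OF x] by (auto simp: orbit_def)
  have "coded = code ` (space_topology L dl \<Omega> closure_of orbit (decode x))"
    using assms decode_in[OF x] by (simp add: minimal_def)
  also have "\<dots> = top_of_set coded closure_of (code ` orbit (decode x))"
    using homeomorphic_map_closure_of[OF code_homeomorphic] orb topspace_\<Omega> by metis
  also have "code ` orbit (decode x) = range (\<lambda>v. act v x)" by (auto simp: orbit_def act_def)
  also have "top_of_set coded closure_of range (\<lambda>v. act v x) \<subseteq> closure (range (\<lambda>v. act v x))"
    using closure_mono[of "coded \<inter> range (\<lambda>v. act v x)" "range (\<lambda>v. act v x)"]
    unfolding closure_of_subtopology by auto
  finally show "coded \<subseteq> closure (range (\<lambda>v. act v x))" .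
qed

text \<open>
An invariant measure on the coded space decodes to an invariant measure on the tiling space, which is
\<open>M\<close>, and coding \<open>M\<close> recovers it.
\<close>

lemma flow_uniquely_ergodic:
  assumes "uniquely_ergodic L dl \<Omega>"
  shows "\<exists>M. \<forall>N. invariant_prob coded act N \<longrightarrow> N = M"
proof -
  obtain M where M: "\<And>N. invariant_prob_measure L dl \<Omega> N \<Longrightarrow> N = M"
    using assms unfolding uniquely_ergodic_def by blast
  define \<S> where "\<S> = sigma \<Omega> {U. openin (space_topology L dl \<Omega>) U}"
  have sp: "space \<S> = \<Omega>" by (simp add: \<S>_def space_measure_of_conv)
  have sub: "{U. openin (space_topology L dl \<Omega>) U} \<subseteq> Pow \<Omega>"
    using openin_subset topspace_\<Omega> by blast
  then have st: "sets \<S> = sigma_sets \<Omega> {U. openin (space_topology L dl \<Omega>) U}"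
    unfolding \<S>_def by (rule sets_measure_of)
  have decode_m: "decode \<in> relative_borel coded \<rightarrow>\<^sub>M \<S>"
    unfolding \<S>_def
  proof (rule measurable_measure_of[OF sub])
    fix U assume "U \<in> {U. openin (space_topology L dl \<Omega>) U}"
    then have "openin (top_of_set coded) {x \<in> topspace (top_of_set coded). decode x \<in> U}"
      using decode_continuous openin_continuous_map_preimage by blast
    then show "decode -` U \<inter> space (relative_borel coded) \<in> sets (relative_borel coded)"
      by (auto simp: sets_relative_borel vimage_def Int_def conj_commute intro: sigma_sets.Basic)
  qed (auto intro: decode_in)
  have code_m: "code \<in> \<S> \<rightarrow>\<^sub>M relative_borel coded"
    unfolding relative_borel_def
  proof (rule measurable_measure_of)
    fix U assume "U \<in> {U. openin (top_of_set coded) U}"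
    then have "openin (space_topology L dl \<Omega>) {x \<in> topspace (space_topology L dl \<Omega>). code x \<in> U}"
      using code_continuous openin_continuous_map_preimage by blast
    then show "code -` U \<inter> space \<S> \<in> sets \<S>"
      by (auto simp: sp st topspace_\<Omega> vimage_def Int_def conj_commute intro: sigma_sets.Basic)
  qed (auto simp: sp dest: openin_imp_subset)
  have "N = distr M (relative_borel coded) code" if N: "invariant_prob coded act N" for N
  proof -
    have Np: "prob_space N" and Ns: "sets N = sets (relative_borel coded)"
      and Ni: "\<And>v B. B \<in> sets N \<Longrightarrow> emeasure N (act v ` B) = emeasure N B"
      using N unfolding invariant_prob_def by auto
    have spN: "space N = coded" using sets_eq_imp_space_eq[OF Ns] by simp
    have dm: "decode \<in> N \<rightarrow>\<^sub>M \<S>" using decode_m measurable_cong_sets[OF Ns refl] by blast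
    have pre: "decode -` B \<inter> coded = code ` B" if "B \<subseteq> \<Omega>" for B
    proof (intro equalityI subsetI)
      fix x assume "x \<in> decode -` B \<inter> coded"
      then show "x \<in> code ` B" using code_decode_id[of x] by (metis IntD1 IntD2 image_eqI vimageD)
    next
      fix x assume "x \<in> code ` B"
      then show "x \<in> decode -` B \<inter> coded" using that decode_code by auto
    qed
    have "invariant_prob_measure L dl \<Omega> (distr N \<S> decode)"
      unfolding invariant_prob_measure_def
    proof (intro conjI allI ballI)
      show "prob_space (distr N \<S> decode)" using Np dm by (rule prob_space.prob_space_distr)
      fix x B assume B: "B \<in> sets (distr N \<S> decode)"
      then have BS: "B \<in> sets \<S>" "B \<subseteq> \<Omega>" using sets.sets_into_space sp by auto
      have tB: "translate x ` B \<subseteq> \<Omega>" using BS(2) translate_in by blast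
      have cB: "code ` B \<in> sets N" using measurable_sets[OF dm BS(1)] pre[OF BS(2)] spN by simp
      have "code ` translate x ` B = act x ` code ` B"
        using BS(2) by (auto simp: image_image act_code subset_iff intro!: image_cong)
      moreover have "translate x ` B \<in> sets \<S>"
      proof -
        have "translate x ` B = (\<lambda>T. decode (act (- x) (code T))) -` B \<inter> \<Omega>"
        proof (intro equalityI subsetI)
          fix T assume "T \<in> translate x ` B"
          then obtain U where "U \<in> B" "T = translate x U" by blast
          then show "T \<in> (\<lambda>T. decode (act (- x) (code T))) -` B \<inter> \<Omega>"
            using BS(2) translate_in by (auto simp: act_code decode_code translate_translate subset_iff)
        next
          fix T assume T: "T \<in> (\<lambda>T. decode (act (- x) (code T))) -` B \<inter> \<Omega>"
          then have "translate (- x) T \<in> B" using translate_in by (auto simp: act_code decode_code)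
          then have "translate x (translate (- x) T) \<in> translate x ` B" by blast
          then show "T \<in> translate x ` B" by (simp add: translate_translate)
        qed
        moreover have "continuous_on coded (act (- x))"
          using flow.act_continuous[OF continuous_on_id continuous_on_const, of coded "- x"] by simp
        then have "act (- x) \<in> relative_borel coded \<rightarrow>\<^sub>M relative_borel coded"
          by (intro measurable_into_relative_borel[OF borel_measurable_relative_borel]) (auto intro: flow.act_in)
        from measurable_sets[OF measurable_compose[OF measurable_compose[OF code_m this] decode_m] BS(1)]
        have "(\<lambda>T. decode (act (- x) (code T))) -` B \<inter> \<Omega> \<in> sets \<S>" by (simp add: sp)
        ultimately show ?thesis by simp
      qed
      ultimately show "emeasure (distr N \<S> decode) (translate x ` B) = emeasure (distr N \<S> decode) B"
        using BS tB Ni[OF cB, of x] by (simp add: emeasure_distr[OF dm] spN pre)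
    qed (simp_all add: sp st)
    then have "distr N \<S> decode = M" by (rule M)
    then have "distr M (relative_borel coded) code = distr N (relative_borel coded) (code \<circ> decode)"
      using distr_distr[OF code_m dm] by simp
    also have "\<dots> = distr N N (\<lambda>x. x)"
      by (rule distr_cong) (simp_all add: Ns[symmetric] spN code_decode_id)
    finally show ?thesis by simp
  qed
  then show ?thesis by blast
qed

end


section \<open>Centers of convex bodies\<close>

text \<open>
A convex body that contains a ball of radius \<open>r\<close> and has diameter at most \<open>R\<close>.
\<close>

definition body :: "real \<Rightarrow> real \<Rightarrow> 'v::euclidean_space set \<Rightarrow> bool" where
  "body r R K \<longleftrightarrow> convex K \<and> compact K \<and> (\<exists>x. ball x r \<subseteq> K) \<and> (\<forall>y\<in>K. \<forall>z\<in>K. dist y z \<le> R)"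

definition depth :: "'v::euclidean_space set \<Rightarrow> 'v \<Rightarrow> real" where
  "depth K x = infdist x (- K)"

text \<open>
The first term is strongly convex in \<open>x\<close>, which makes the minimum over \<open>K\<close> unique and stable. The second one
is convex as well and, for large \<open>c\<close>, keeps the minimum away from the boundary. Both commute with
translations.
\<close>

definition energy :: "real \<Rightarrow> 'v::euclidean_space set \<Rightarrow> 'v \<Rightarrow> real" where
  "energy c K x = (SUP y\<in>K. (dist x y)\<^sup>2) - c * depth K x"

definition is_center :: "real \<Rightarrow> 'v::euclidean_space set \<Rightarrow> 'v \<Rightarrow> bool" where
  "is_center c K p \<longleftrightarrow> p \<in> K \<and> (\<forall>x\<in>K. energy c K p \<le> energy c K x)"

lemma compact_complement_nonempty: "compact K \<Longrightarrow> - K \<noteq> ({} :: 'v::euclidean_space set)"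
  using not_bounded_UNIV compact_imp_bounded by (metis Compl_empty_eq double_complement)

lemma le_depth_iff:
  fixes K :: "'v::euclidean_space set"
  assumes "compact K"
  shows "a \<le> depth K x \<longleftrightarrow> ball x a \<subseteq> K"
proof
  assume a: "a \<le> depth K x"
  show "ball x a \<subseteq> K"
  proof
    fix y assume "y \<in> ball x a"
    then show "y \<in> K" using a infdist_le[of y "- K" x] by (cases "y \<in> K") (auto simp: depth_def)
  qed
next
  assume "ball x a \<subseteq> K"
  then have "a \<le> dist x y" if "y \<in> - K" for y using that by (meson ComplD mem_ball not_le subsetD)
  then show "a \<le> depth K x"
    unfolding depth_def infdist_def using compact_complement_nonempty[OF assms] by (auto intro!: cINF_greatest)
qed

lemma depth_nonneg: "0 \<le> depth K x" by (simp add: depth_def infdist_nonneg)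

lemma bdd_above_dist2:
  fixes K :: "'v::euclidean_space set"
  assumes "compact K" shows "bdd_above ((\<lambda>y. (dist x y)\<^sup>2) ` K)"
proof -
  have "compact ((\<lambda>y. (dist x y)\<^sup>2) ` K)" by (intro compact_continuous_image assms continuous_intros)
  then show ?thesis by (rule bounded_imp_bdd_above[OF compact_imp_bounded])
qed

text \<open>
The depth is concave: if balls of radii \<open>a\<close> and \<open>b\<close> around two points lie in \<open>K\<close>, then by convexity so does the
ball of radius \<open>(a + b) / 2\<close> around the midpoint. A vector \<open>d\<close> at the midpoint is split in the proportion \<open>a : b\<close>
between the two balls.
\<close>

lemma depth_midpoint:
  fixes K :: "'v::euclidean_space set"
  assumes K: "convex K" "compact K" and x: "x \<in> K" "x' \<in> K"
  shows "(depth K x + depth K x') / 2 \<le> depth K (midpoint x x')"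
  unfolding le_depth_iff[OF K(2)]
proof
  define a b where "a = depth K x" "b = depth K x'"
  have ab: "0 \<le> a" "0 \<le> b" "ball x a \<subseteq> K" "ball x' b \<subseteq> K"
    using le_depth_iff[OF K(2), of a x] le_depth_iff[OF K(2), of b x'] by (auto simp: a_b_def depth_nonneg)
  fix z assume "z \<in> ball (midpoint x x') ((depth K x + depth K x') / 2)"
  then have "norm (z - midpoint x x') < (a + b) / 2" by (simp add: a_b_def dist_norm norm_minus_commute)
  moreover define d where "d = z - midpoint x x'"
  ultimately have d: "2 * norm d < a + b" by simp
  then have pos: "0 < a + b" by (smt (verit) norm_ge_zero)
  have step: "y + (2 * s / (a + b)) *\<^sub>R d \<in> K" if "ball y s \<subseteq> K" "y \<in> K" "0 \<le> s" for y s
  proof (cases "s = 0")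
    case True then show ?thesis using that by simp
  next
    case False
    then have "s * (2 * norm d) < s * (a + b)" using d that(3) by simp
    then have "norm ((2 * s / (a + b)) *\<^sub>R d) < s"
      using pos that(3) by (simp add: pos_divide_less_eq abs_mult mult_ac)
    then have "y + (2 * s / (a + b)) *\<^sub>R d \<in> ball y s" by (simp add: dist_norm)
    then show ?thesis using that(1) by blast
  qed
  have "(1/2) *\<^sub>R (x + (2 * a / (a + b)) *\<^sub>R d) + (1/2) *\<^sub>R (x' + (2 * b / (a + b)) *\<^sub>R d) \<in> K"
    by (rule convexD[OF K(1) step[OF ab(3) x(1) ab(1)] step[OF ab(4) x(2) ab(2)]]) auto
  moreover have "(1/2) *\<^sub>R (x + (2 * a / (a + b)) *\<^sub>R d) + (1/2) *\<^sub>R (x' + (2 * b / (a + b)) *\<^sub>R d) =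
      midpoint x x' + ((a + b) / (a + b)) *\<^sub>R d"
    using pos by (simp add: midpoint_def algebra_simps add_divide_distrib)
      (simp add: scaleR_add_left[symmetric] add_divide_distrib[symmetric])
  ultimately show "z \<in> K" using pos by (simp add: d_def)
qed

text \<open>
Strong convexity comes from the parallelogram law for the squared distance.
\<close>

lemma energy_midpoint:
  fixes K :: "'v::euclidean_space set"
  assumes K: "convex K" "compact K" and x: "x \<in> K" "x' \<in> K" and "0 \<le> c"
  shows "energy c K (midpoint x x') \<le> (energy c K x + energy c K x') / 2 - (dist x x')\<^sup>2 / 4"
proof -
  define sx sx' where "sx = (SUP y\<in>K. (dist x y)\<^sup>2)" "sx' = (SUP y\<in>K. (dist x' y)\<^sup>2)"
  have "(SUP y\<in>K. (dist (midpoint x x') y)\<^sup>2) \<le> (sx + sx') / 2 - (dist x x')\<^sup>2 / 4"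
  proof (rule cSUP_least)
    fix y assume y: "y \<in> K"
    have "(dist (midpoint x x') y)\<^sup>2 = ((dist x y)\<^sup>2 + (dist x' y)\<^sup>2) / 2 - (dist x x')\<^sup>2 / 4"
    proof -
      have 1: "midpoint x x' - y = (1/2) *\<^sub>R ((x - y) + (x' - y))"
        by (simp add: midpoint_def algebra_simps) (simp add: scaleR_add_left[symmetric])
      have 2: "x - x' = (x - y) - (x' - y)" by simp
      show ?thesis unfolding dist_norm 1 2 power2_norm_eq_inner
        by (simp add: inner_add_left inner_add_right inner_diff_left inner_diff_right inner_commute algebra_simps)
          (simp add: field_simps)
    qed
    moreover have "(dist x y)\<^sup>2 \<le> sx" "(dist x' y)\<^sup>2 \<le> sx'"
      unfolding sx_sx'_def using y by (auto intro: cSUP_upper bdd_above_dist2[OF K(2)])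
    ultimately show "(dist (midpoint x x') y)\<^sup>2 \<le> (sx + sx') / 2 - (dist x x')\<^sup>2 / 4" by argo
  qed (use x in blast)
  moreover have "c * ((depth K x + depth K x') / 2) \<le> c * depth K (midpoint x x')"
    using depth_midpoint[OF K x] assms(5) by (rule mult_left_mono)
  ultimately show ?thesis unfolding energy_def sx_sx'_def by argo
qed

lemma center_distance:
  fixes K :: "'v::euclidean_space set"
  assumes K: "convex K" "compact K" and p: "is_center c K p" and "x \<in> K" "0 \<le> c"
  shows "(dist p x)\<^sup>2 \<le> 2 * (energy c K x - energy c K p)"
proof -
  have pK: "p \<in> K" using p by (simp add: is_center_def)
  have "midpoint p x \<in> K"
    using convexD[OF K(1) pK \<open>x \<in> K\<close>, of "1/2" "1/2"] by (simp add: midpoint_def scaleR_right_distrib)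
  then have "energy c K p \<le> energy c K (midpoint p x)" using p by (simp add: is_center_def)
  then show ?thesis using energy_midpoint[OF K pK \<open>x \<in> K\<close> \<open>0 \<le> c\<close>] by argo
qed

lemma dist_square_perturb:
  fixes u v R d :: real
  assumes "0 \<le> u" "u \<le> v + d" "0 \<le> v" "v \<le> R" "0 \<le> d" "d \<le> 1"
  shows "u\<^sup>2 \<le> v\<^sup>2 + (2 * R + 1) * d"
proof -
  have "u\<^sup>2 \<le> (v + d)\<^sup>2" using assms by (intro power_mono) auto
  also have "\<dots> = v\<^sup>2 + (2 * v + d) * d" by (simp add: power2_eq_square algebra_simps)
  also have "\<dots> \<le> v\<^sup>2 + (2 * R + 1) * d" using assms by (intro add_left_mono mult_right_mono) auto
  finally show ?thesis .
qed

lemma sup_dist2_perturb: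
  fixes K K' :: "'v::euclidean_space set"
  assumes K': "compact K'" "K \<noteq> {}" and near: "\<And>y. y \<in> K \<Longrightarrow> \<exists>y'\<in>K'. dist y y' < d"
    and bd: "\<And>y'. y' \<in> K' \<Longrightarrow> dist x y' \<le> R" and d: "0 \<le> d" "d \<le> 1"
  shows "(SUP y\<in>K. (dist x y)\<^sup>2) \<le> (SUP y\<in>K'. (dist x y)\<^sup>2) + (2 * R + 1) * d"
proof (rule cSUP_least[OF K'(2)])
  fix y assume "y \<in> K"
  then obtain y' where y': "y' \<in> K'" "dist y y' < d" using near by blast
  have "(dist x y)\<^sup>2 \<le> (dist x y')\<^sup>2 + (2 * R + 1) * d"
    using y' bd[OF y'(1)] d dist_triangle[of x y y'] by (intro dist_square_perturb) (auto simp: dist_commute)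
  also have "(dist x y')\<^sup>2 \<le> (SUP y\<in>K'. (dist x y)\<^sup>2)" using y'(1) bdd_above_dist2[OF K'(1)] by (rule cSUP_upper)
  finally show "(dist x y)\<^sup>2 \<le> (SUP y\<in>K'. (dist x y)\<^sup>2) + (2 * R + 1) * d" by simp
qed

lemma ball_in_close_convex:
  fixes C :: "'v::euclidean_space set"
  assumes C: "convex C" "closed C" and A: "ball x a \<subseteq> A" and close: "\<And>y. y \<in> A \<Longrightarrow> \<exists>c\<in>C. dist y c < d" and d: "0 < d"
  shows "ball x (a - 2 * d) \<subseteq> C"
proof
  fix y assume y: "y \<in> ball x (a - 2 * d)"
  have "ball y (2 * d) \<subseteq> ball x a"
  proof
    fix z assume "z \<in> ball y (2 * d)"
    then show "z \<in> ball x a" using y dist_triangle[of x z y] by simp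
  qed
  then have "y \<in> interior C"
    using interior_of_close_convex[OF C, of y "2 * d" A] A close d by auto
  then show "y \<in> C" using interior_subset by blast
qed

lemma center_exists:
  fixes K :: "'v::euclidean_space set"
  assumes "body r R K" "0 < r" "0 \<le> c"
  shows "\<exists>p. is_center c K p"
proof -
  have K: "compact K" using assms(1) by (simp add: body_def)
  obtain x0 where "ball x0 r \<subseteq> K" using assms(1) by (auto simp: body_def)
  then have ne: "K \<noteq> {}" using assms(2) by (metis ball_eq_empty not_le subset_empty)
  have upper: "(SUP y\<in>K. (dist x y)\<^sup>2) \<le> (SUP y\<in>K. (dist x' y)\<^sup>2) + (2 * dist x x' * R + (dist x x')\<^sup>2)"
    if "x' \<in> K" for x x'
  proof (rule cSUP_least[OF ne])
    fix y assume y: "y \<in> K"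
    have "dist x' y \<le> R" using assms(1) y that by (auto simp: body_def)
    have "(dist x y)\<^sup>2 \<le> (dist x' y + dist x x')\<^sup>2" using dist_triangle[of x y x'] by (intro power_mono) auto
    also have "\<dots> = (dist x' y)\<^sup>2 + (2 * dist x x' * dist x' y + (dist x x')\<^sup>2)" by (simp add: power2_sum)
    also have "\<dots> \<le> (SUP y\<in>K. (dist x' y)\<^sup>2) + (2 * dist x x' * R + (dist x x')\<^sup>2)"
      using y \<open>dist x' y \<le> R\<close> by (intro add_mono cSUP_upper bdd_above_dist2 K mult_left_mono) auto
    finally show "(dist x y)\<^sup>2 \<le> (SUP y\<in>K. (dist x' y)\<^sup>2) + (2 * dist x x' * R + (dist x x')\<^sup>2)" .
  qed
  have "continuous_on K (\<lambda>x. SUP y\<in>K. (dist x y)\<^sup>2)"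
    unfolding continuous_on_def
  proof
    fix x' assume x': "x' \<in> K"
    have "((\<lambda>x. 2 * dist x x' * R + (dist x x')\<^sup>2) \<longlongrightarrow> 2 * dist x' x' * R + (dist x' x')\<^sup>2) (at x' within K)"
      by (intro tendsto_intros)
    then have lim: "((\<lambda>x. 2 * dist x x' * R + (dist x x')\<^sup>2) \<longlongrightarrow> 0) (at x' within K)" by simp
    have "norm ((SUP y\<in>K. (dist x y)\<^sup>2) - (SUP y\<in>K. (dist x' y)\<^sup>2)) \<le> 2 * dist x x' * R + (dist x x')\<^sup>2"
      if "x \<in> K" for x
      using upper[OF x', of x] upper[OF that, of x'] unfolding dist_commute[of x' x] real_norm_def abs_le_iff by linarith
    then have "\<forall>\<^sub>F x in at x' within K. norm ((SUP y\<in>K. (dist x y)\<^sup>2) - (SUP y\<in>K. (dist x' y)\<^sup>2)) \<le> 2 * dist x x' * R + (dist x x')\<^sup>2"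
      unfolding eventually_at_filter
      by (intro always_eventually allI impI) blast
    from Lim_null_comparison[OF this lim]
    show "((\<lambda>x. SUP y\<in>K. (dist x y)\<^sup>2) \<longlongrightarrow> (SUP y\<in>K. (dist x' y)\<^sup>2)) (at x' within K)" by (rule LIM_zero_cancel)
  qed
  then have "continuous_on K (energy c K)"
    unfolding energy_def[abs_def] depth_def by (intro continuous_intros)
  then show ?thesis using continuous_attains_inf[OF K ne] unfolding is_center_def by blast
qed

text \<open>
Comparison with the center \<open>x0\<close> of an inscribed ball, whose energy is at most \<open>R\<^sup>2 - c r = - R\<^sup>2\<close>, while
the energy of \<open>p\<close> is at least \<open>- c * depth K p\<close>.
\<close>

lemma center_deep:
  fixes K :: "'v::euclidean_space set"
  assumes K: "body r R K" and r: "0 < r" and R: "0 < R" and p: "is_center (2 * R\<^sup>2 / r) K p"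
  shows "ball p (r / 2) \<subseteq> K"
proof -
  let ?c = "2 * R\<^sup>2 / r"
  have cK: "compact K" and c: "0 < ?c" using K r R by (auto simp: body_def)
  obtain x0 where x0: "ball x0 r \<subseteq> K" using K by (auto simp: body_def)
  then have x0K: "x0 \<in> K" using r by (meson centre_in_ball subsetD)
  have "(SUP y\<in>K. (dist x0 y)\<^sup>2) \<le> R\<^sup>2"
    using x0K K by (intro cSUP_least) (auto simp: body_def intro!: power_mono)
  moreover have "?c * r \<le> ?c * depth K x0" using c x0 le_depth_iff[OF cK] by (intro mult_left_mono) auto
  ultimately have "energy ?c K x0 \<le> R\<^sup>2 - 2 * R\<^sup>2" using r by (simp add: energy_def)
  moreover have "energy ?c K p \<le> energy ?c K x0" using p x0K by (simp add: is_center_def)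
  moreover have "0 \<le> (SUP y\<in>K. (dist p y)\<^sup>2)"
    using cSUP_upper2[OF bdd_above_dist2[OF cK] x0K, of 0 p] by simp
  ultimately have "R\<^sup>2 \<le> ?c * depth K p" unfolding energy_def by linarith
  then have "R\<^sup>2 * r \<le> R\<^sup>2 * (2 * depth K p)" using r by (simp add: field_simps)
  then have "r / 2 \<le> depth K p" using R by simp
  then show ?thesis using le_depth_iff[OF cK] by blast
qed

lemma center_unique:
  assumes "convex K" "compact K" "is_center c K p" "is_center c K q" "0 \<le> c"
  shows "p = q"
proof -
  have "energy c K q \<le> energy c K p" "q \<in> K" using assms(3,4) by (auto simp: is_center_def)
  then have "(dist p q)\<^sup>2 \<le> 0" using center_distance[OF assms(1-3) \<open>q \<in> K\<close> assms(5)] by argo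
  then show ?thesis by simp
qed

text \<open>
If \<open>K\<close> and \<open>K'\<close> are within Hausdorff distance \<open>d\<close>, then each center lies in the other body, and its two
energies differ by at most a multiple of \<open>d\<close>. So \<open>p'\<close> nearly minimizes the energy of \<open>K\<close>, and strong
convexity brings it close to \<open>p\<close>.
\<close>

lemma center_perturb:
  fixes K K' :: "'v::euclidean_space set"
  assumes K: "body r R K" "body r R K'" and r: "0 < r" and R: "0 < R"
    and p: "is_center (2 * R\<^sup>2 / r) K p" "is_center (2 * R\<^sup>2 / r) K' p'"
    and near: "\<And>y. y \<in> K \<Longrightarrow> \<exists>y'\<in>K'. dist y y' < d" "\<And>y'. y' \<in> K' \<Longrightarrow> \<exists>y\<in>K. dist y' y < d"
    and d: "0 < d" "d \<le> 1" "4 * d < r"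
  shows "(dist p p')\<^sup>2 \<le> 4 * ((2 * R + 1 + 4 * R\<^sup>2 / r) * d)"
proof -
  let ?c = "2 * R\<^sup>2 / r"
  define E where "E = (2 * R + 1 + 4 * R\<^sup>2 / r) * d"
  have c: "0 \<le> ?c" using r by simp
  have cross: "q \<in> A \<and> energy ?c A q \<le> energy ?c B q + E"
    if A: "body r R A" and B: "body r R B" and q: "is_center ?c B q"
      and AB: "\<And>y. y \<in> A \<Longrightarrow> \<exists>y'\<in>B. dist y y' < d" and BA: "\<And>y'. y' \<in> B \<Longrightarrow> \<exists>y\<in>A. dist y' y < d" for A B q
  proof -
    have cA: "convex A" "compact A" "closed A" and cB: "compact B" "q \<in> B"
      using A B q by (auto simp: body_def compact_imp_closed is_center_def)
    have deep: "ball q (s - 2 * d) \<subseteq> A" if "ball q s \<subseteq> B" for s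
      by (rule ball_in_close_convex[OF cA(1,3) that BA d(1)])
    have "ball q (r / 2 - 2 * d) \<subseteq> A" by (rule deep[OF center_deep[OF B r R q]])
    moreover have "q \<in> ball q (r / 2 - 2 * d)" using d(3) by simp
    ultimately have qA: "q \<in> A" by blast
    have "ball q (depth B q) \<subseteq> B" using le_depth_iff[OF cB(1)] by blast
    then have "depth B q - 2 * d \<le> depth A q" using deep le_depth_iff[OF cA(2)] by blast
    then have "?c * (depth B q - 2 * d) \<le> ?c * depth A q" using c by (rule mult_left_mono)
    moreover have "(SUP y\<in>A. (dist q y)\<^sup>2) \<le> (SUP y\<in>B. (dist q y)\<^sup>2) + (2 * R + 1) * d"
      using B cB d qA AB by (intro sup_dist2_perturb) (auto simp: body_def)
    moreover have "E = (2 * R + 1) * d + ?c * (2 * d)" by (simp add: E_def algebra_simps)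
    ultimately show ?thesis using qA unfolding energy_def right_diff_distrib by argo
  qed
  have 1: "p' \<in> K" "energy ?c K p' \<le> energy ?c K' p' + E" using cross[OF K p(2) near] by auto
  have 2: "p \<in> K'" "energy ?c K' p \<le> energy ?c K p + E" using cross[OF K(2,1) p(1) near(2,1)] by auto
  have "energy ?c K' p' \<le> energy ?c K' p" using p(2) 2(1) by (simp add: is_center_def)
  moreover have "(dist p p')\<^sup>2 \<le> 2 * (energy ?c K p' - energy ?c K p)"
    using K(1) by (intro center_distance[OF _ _ p(1) 1(1) c]) (auto simp: body_def)
  ultimately have "(dist p p')\<^sup>2 \<le> 4 * E" using 1(2) 2(2) by argo
  then show ?thesis by (simp add: E_def)
qed

lemma energy_translate: "energy c ((\<lambda>y. y - v) ` K) (x - v) = energy c K x"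
proof -
  have "- ((\<lambda>y. y - v) ` K) = (\<lambda>y. y - v) ` (- K)" by (rule bij_image_Compl_eq[symmetric]) (rule bij_diff_right)
  then have "depth ((\<lambda>y. y - v) ` K) (x - v) = depth K x"
    by (simp add: depth_def infdist_def image_image dist_norm)
  then show ?thesis by (simp add: energy_def image_image dist_norm)
qed

lemma is_center_translate: "is_center c K p \<Longrightarrow> is_center c ((\<lambda>y. y - v) ` K) (p - v)"
  by (auto simp: is_center_def energy_translate)

lemma body_translate:
  assumes "body r R K" shows "body r R ((\<lambda>y. y - v) ` K)"
proof -
  obtain x where x: "ball x r \<subseteq> K" using assms by (auto simp: body_def)
  have "ball (x - v) r \<subseteq> (\<lambda>y. y - v) ` K"
  proof
    fix z assume "z \<in> ball (x - v) r"
    then have "z + v \<in> K" using x by (auto simp: dist_norm algebra_simps)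
    then show "z \<in> (\<lambda>y. y - v) ` K" by (intro image_eqI[of _ _ "z + v"]) auto
  qed
  then show ?thesis
    using assms unfolding body_def
    by (auto simp: dist_norm intro: convex_translation_subtract compact_translation_subtract)
qed

text \<open>
A tile close to a prototile \<open>q\<close> contains a ball of half the radius of a ball in \<open>q\<close>, and its diameter is
bounded in terms of that of \<open>q\<close>. By compactness finitely many prototiles \<open>q\<close> suffice.
\<close>

lemma compact_prototiles_bodies:
  fixes \<Omega> :: "('v::euclidean_space, 'l) tiling set"
  assumes L: "Metric_space L dl" and P: "compact_prototiles L dl \<Omega>"
  shows "\<exists>r>0. \<exists>R>0. \<forall>T\<in>\<Omega>. \<forall>t\<in>T. body r R (fst t)"
proof -
  obtain P :: "('v, 'l) tile set" where P: "\<And>t. t \<in> P \<Longrightarrow> is_tile L t" "compact_metric P (tile_dist dl)"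
    "\<And>T t. T \<in> \<Omega> \<Longrightarrow> t \<in> T \<Longrightarrow> \<exists>p\<in>P. \<exists>x. t = translate_tile x p"
    using P unfolding compact_prototiles_def by blast
  interpret Metric_space P "tile_dist dl" using P(2) by (simp add: compact_metric_def)
  have reg: "regular_tile L t" "convex (fst t)" "compact (fst t)" if "t \<in> P" for t
    using P(1)[OF that] interior_empty by (auto simp: is_tile_def regular_tile_def polytope_imp_compact polytope_imp_convex)
  have "\<exists>x s. 0 < s \<and> ball x (4 * s) \<subseteq> fst q" if "q \<in> P" for q
  proof -
    have "interior (fst q) \<noteq> {}" using P(1)[OF that] by (simp add: is_tile_def)
    then obtain x e where "0 < e" "ball x e \<subseteq> fst q" by (meson all_not_in_conv mem_interior)
    then show ?thesis by (intro exI[of _ x] exI[of _ "e/4"]) auto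
  qed
  then obtain X s where s: "\<And>q. q \<in> P \<Longrightarrow> 0 < s q" "\<And>q. q \<in> P \<Longrightarrow> ball (X q) (4 * s q) \<subseteq> fst q" by metis
  have "compactin mtopology P" using P(2) by (simp add: compact_metric_def compact_space_def)
  moreover have "P \<subseteq> \<Union> ((\<lambda>q. mball q (s q)) ` P)"
  proof
    fix q assume "q \<in> P"
    then have "q \<in> mball q (s q)" using s(1) by simp
    then show "q \<in> \<Union> ((\<lambda>q. mball q (s q)) ` P)" using \<open>q \<in> P\<close> by blast
  qed
  moreover have "\<forall>U\<in>(\<lambda>q. mball q (s q)) ` P. openin mtopology U" by simp
  ultimately have "\<exists>\<F>. finite \<F> \<and> \<F> \<subseteq> (\<lambda>q. mball q (s q)) ` P \<and> P \<subseteq> \<Union>\<F>"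
    unfolding compactin_def by simp
  then obtain \<F> where \<F>: "finite \<F>" "\<F> \<subseteq> (\<lambda>q. mball q (s q)) ` P" "P \<subseteq> \<Union>\<F>" by blast
  then obtain Q where Q: "finite Q" "Q \<subseteq> P" "P \<subseteq> (\<Union>q\<in>Q. mball q (s q))"
    using finite_subset_image[OF \<F>(1,2)] by metis
  define r where "r = Min (insert 1 (s ` Q))"
  have r: "0 < r" "\<And>q. q \<in> Q \<Longrightarrow> r \<le> s q" using Q s(1) by (auto simp: r_def)
  have "\<exists>B. \<forall>y\<in>fst q. \<forall>z\<in>fst q. dist y z \<le> B" if "q \<in> Q" for q
  proof -
    have "bounded (fst q)" using compact_imp_bounded[OF reg(3)] Q(2) that by blast
    then show ?thesis by (simp add: bounded_two_points)
  qed
  then obtain B where B: "\<And>q y z. q \<in> Q \<Longrightarrow> y \<in> fst q \<Longrightarrow> z \<in> fst q \<Longrightarrow> dist y z \<le> B q" by metis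
  define R where "R = Max (insert 1 ((\<lambda>q. B q + 2 * s q) ` Q))"
  have "1 \<le> R" unfolding R_def using Q(1) by (intro Max_ge) auto
  have RB: "B q + 2 * s q \<le> R" if "q \<in> Q" for q unfolding R_def using Q(1) that by (intro Max_ge) auto
  have body_P: "body r R (fst p)" if p: "p \<in> P" for p
  proof -
    obtain q where q: "q \<in> Q" "tile_dist dl q p < s q" "q \<in> P" using Q p by auto
    note near = tile_dist_lessD[OF L reg(1)[OF q(3)] reg(1)[OF p] q(2)]
    have "ball (X q) (4 * s q - 2 * s q) \<subseteq> fst p"
      using reg[OF p] near(1) s(1)[OF q(3)] s(2)[OF q(3)]
      by (intro ball_in_close_convex[of "fst p" "X q" "4 * s q" "fst q"]) (auto intro: compact_imp_closed)
    then have "ball (X q) r \<subseteq> fst p" using r(2)[OF q(1)] s(1)[OF q(3)] subset_ball[of r "4 * s q - 2 * s q" "X q"] by auto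
    moreover have "dist y z \<le> R" if "y \<in> fst p" "z \<in> fst p" for y z
    proof -
      obtain y' z' where *: "y' \<in> fst q" "dist y' y < s q" "z' \<in> fst q" "dist z' z < s q"
        using near(2) \<open>y \<in> fst p\<close> \<open>z \<in> fst p\<close> by meson
      have "dist y z \<le> dist y y' + dist y' z' + dist z' z"
        using dist_triangle[of y z y'] dist_triangle[of y' z z'] by linarith
      then show ?thesis using * B[OF q(1) *(1,3)] RB[OF q(1)] by (simp add: dist_commute)
    qed
    ultimately show ?thesis using reg[OF p] unfolding body_def by blast
  qed
  have "body r R (fst t)" if T: "T \<in> \<Omega>" "t \<in> T" for T t
  proof -
    obtain p x where "p \<in> P" "t = translate_tile x p" using P(3)[OF T] by blast
    then show ?thesis using body_translate[OF body_P] by (simp add: translate_tile_def)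
  qed
  then show ?thesis using r(1) \<open>1 \<le> R\<close> by (intro exI[of _ r] conjI exI[of _ R]) auto
qed


section \<open>The Delone set of tile centers\<close>

text \<open>
A continuous and equivariant choice of a point in each tile, with distinct tiles giving well separated points.
It serves tilings and labelled Delone sets alike.
\<close>

definition tile_selector :: "('l \<Rightarrow> 'l \<Rightarrow> real) \<Rightarrow> ('v::euclidean_space, 'l) tiling set \<Rightarrow> ('v set \<Rightarrow> 'v) \<Rightarrow> bool" where
  "tile_selector dl \<Omega> ctr \<longleftrightarrow>
     (\<forall>T\<in>\<Omega>. inj_on (\<lambda>t. ctr (fst t)) T \<and> delone ((\<lambda>t. ctr (fst t)) ` T)) \<and>
     (\<forall>T\<in>\<Omega>. \<forall>t\<in>T. ctr (fst t) \<in> fst t \<and> (\<forall>x. ctr (fst (translate_tile x t)) = ctr (fst t) - x)) \<and>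
     (\<forall>e>0. \<exists>\<delta>>0. \<forall>T\<in>\<Omega>. \<forall>S\<in>\<Omega>. \<forall>t\<in>T. \<forall>s\<in>S. tile_dist dl t s < \<delta> \<longrightarrow> dist (ctr (fst t)) (ctr (fst s)) < e)"

lemma delone_tile_selector:
  fixes \<Omega> :: "('v::euclidean_space, 'l) tiling set"
  assumes L: "Metric_space L dl" and \<Omega>: "\<And>T. T \<in> \<Omega> \<Longrightarrow> is_labelled_delone L T"
  shows "tile_selector dl \<Omega> the_elem"
proof -
  have form: "\<exists>p. fst t = {p}" if "T \<in> \<Omega>" "t \<in> T" for T t
    using \<Omega>[OF that(1)] that(2) by (auto simp: is_labelled_delone_def labelled_points_def)
  have reg: "regular_tile L t" if "T \<in> \<Omega>" "t \<in> T" for T t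
    using \<Omega>[OF that(1)] that(2) by (intro regular_tile_all_tilings[of T]) (auto simp: all_tilings_def)
  show ?thesis
    unfolding tile_selector_def
  proof (intro conjI ballI allI impI)
    fix T assume T: "T \<in> \<Omega>"
    obtain X lab where X: "delone X" "T = labelled_points X lab"
      using \<Omega>[OF T] unfolding is_labelled_delone_def by blast
    show "inj_on (\<lambda>t. the_elem (fst t)) T" by (auto simp: X(2) labelled_points_def inj_on_def)
    show "delone ((\<lambda>t. the_elem (fst t)) ` T)" using X by (simp add: labelled_points_def image_image)
    fix t assume t: "t \<in> T"
    obtain p where p: "fst t = {p}" using form[OF T t] by blast
    show "the_elem (fst t) \<in> fst t" using p by simp
    show "the_elem (fst (translate_tile x t)) = the_elem (fst t) - x" for x using p by (simp add: translate_tile_def)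
  next
    fix e :: real assume "0 < e"
    have "dist (the_elem (fst t)) (the_elem (fst s)) < e"
      if "T \<in> \<Omega>" "S \<in> \<Omega>" "t \<in> T" "s \<in> S" "tile_dist dl t s < e" for T S t s
      using tile_dist_lessD(1)[OF L reg[OF that(1,3)] reg[OF that(2,4)] that(5)] form[OF that(1,3)] form[OF that(2,4)] by auto
    then show "\<exists>\<delta>>0. \<forall>T\<in>\<Omega>. \<forall>S\<in>\<Omega>. \<forall>t\<in>T. \<forall>s\<in>S. tile_dist dl t s < \<delta> \<longrightarrow>
        dist (the_elem (fst t)) (the_elem (fst s)) < e"
      using \<open>0 < e\<close> by blast
  qed
qed

text \<open>
The center of a tile lies at depth at least \<open>r / 2\<close>, and interiors of distinct tiles are disjoint, so
distinct centers have distance at least \<open>r / 2\<close>.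
\<close>

lemma polytope_tile_selector:
  fixes \<Omega> :: "('v::euclidean_space, 'l) tiling set"
  assumes L: "Metric_space L dl" and P: "compact_prototiles L dl \<Omega>" and \<Omega>: "\<And>T. T \<in> \<Omega> \<Longrightarrow> is_tiling L T"
  shows "\<exists>ctr. tile_selector dl \<Omega> ctr"
proof -
  obtain r R where rR: "0 < r" "0 < R" and body: "\<And>T t. T \<in> \<Omega> \<Longrightarrow> t \<in> T \<Longrightarrow> body r R (fst t)"
    using compact_prototiles_bodies[OF L P] by blast
  define c where "c = 2 * R\<^sup>2 / r"
  have c: "0 \<le> c" using rR by (simp add: c_def)
  define ctr where "ctr K = (SOME p. is_center c K p)" for K :: "'v set"
  have ctr: "is_center c (fst t) (ctr (fst t))" if "T \<in> \<Omega>" "t \<in> T" for T t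
    unfolding ctr_def by (rule someI_ex) (rule center_exists[OF body[OF that] rR(1) c])
  have inside: "ctr (fst t) \<in> fst t" if "T \<in> \<Omega>" "t \<in> T" for T t
    using ctr[OF that] by (simp add: is_center_def)
  have deep: "ball (ctr (fst t)) (r / 2) \<subseteq> fst t" if "T \<in> \<Omega>" "t \<in> T" for T t
    using center_deep[OF body[OF that] rR] ctr[OF that] by (simp add: c_def)
  have reg: "regular_tile L t" if "T \<in> \<Omega>" "t \<in> T" for T t
    using \<Omega>[OF that(1)] that(2) by (intro regular_tile_all_tilings[of T]) (auto simp: all_tilings_def)
  have apart: "t = s" if T: "T \<in> \<Omega>" and t: "t \<in> T" and s: "s \<in> T" and near: "dist (ctr (fst t)) (ctr (fst s)) < r / 2" for T t s
  proof (rule ccontr)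
    assume "t \<noteq> s"
    then have "fst t \<inter> fst s \<subseteq> frontier (fst t)" using \<Omega>[OF T] t s unfolding is_tiling_def by blast
    moreover have "ctr (fst s) \<in> interior (fst t)"
      using deep[OF T t] near by (intro interiorI[of "ball (ctr (fst t)) (r / 2)"]) auto
    moreover have "ctr (fst s) \<in> fst t \<inter> fst s"
      using inside[OF T s] interior_subset[of "fst t"] \<open>ctr (fst s) \<in> interior (fst t)\<close> by blast
    ultimately show False by (auto simp: frontier_def)
  qed
  have "tile_selector dl \<Omega> ctr"
    unfolding tile_selector_def
  proof (intro conjI ballI allI impI)
    fix T assume T: "T \<in> \<Omega>"
    show "inj_on (\<lambda>t. ctr (fst t)) T"
    proof (rule inj_onI)
      fix t s assume "t \<in> T" "s \<in> T" "ctr (fst t) = ctr (fst s)"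
      then show "t = s" using rR(1) by (intro apart[OF T]) simp_all
    qed
    have "uniform_discrete ((\<lambda>t. ctr (fst t)) ` T)"
      unfolding uniform_discrete_def
    proof (intro exI[of _ "r / 2"] conjI ballI impI)
      fix x y assume xy: "x \<in> (\<lambda>t. ctr (fst t)) ` T" "y \<in> (\<lambda>t. ctr (fst t)) ` T" "dist x y < r / 2"
      then obtain t s where "t \<in> T" "s \<in> T" "x = ctr (fst t)" "y = ctr (fst s)" by blast
      then show "x = y" using apart[OF T, of t s] xy(3) by simp
    qed (use rR in simp)
    moreover have "relatively_dense ((\<lambda>t. ctr (fst t)) ` T)"
      unfolding relatively_dense_def
    proof (intro exI allI)
      fix x
      have "x \<in> (\<Union>t\<in>T. fst t)" using \<Omega>[OF T] by (simp add: is_tiling_def)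
      then obtain t where t: "t \<in> T" "x \<in> fst t" by blast
      then have "dist x (ctr (fst t)) \<le> R" using body[OF T t(1)] inside[OF T t(1)] by (auto simp: body_def)
      then show "\<exists>p\<in>(\<lambda>t. ctr (fst t)) ` T. dist x p \<le> R" using t(1) by blast
    qed
    ultimately show "delone ((\<lambda>t. ctr (fst t)) ` T)" by (simp add: delone_def)
    fix t assume t: "t \<in> T"
    show "ctr (fst t) \<in> fst t" by (rule inside[OF T t])
    fix x
    have B: "body r R (fst (translate_tile x t))" using body_translate[OF body[OF T t]] by (simp add: translate_tile_def)
    have "is_center c (fst (translate_tile x t)) (ctr (fst (translate_tile x t)))"
      unfolding ctr_def by (rule someI_ex) (rule center_exists[OF B rR(1) c])
    moreover have "is_center c (fst (translate_tile x t)) (ctr (fst t) - x)"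
      using is_center_translate[OF ctr[OF T t]] by (simp add: translate_tile_def)
    ultimately show "ctr (fst (translate_tile x t)) = ctr (fst t) - x"
      using B c by (intro center_unique) (auto simp: body_def)
  next
    fix e :: real assume e: "0 < e"
    define M where "M = 4 * (2 * R + 1 + 4 * R\<^sup>2 / r)"
    have M: "0 < M" using rR by (simp add: M_def add_pos_nonneg)
    define d where "d = min (min (1 / 2) (r / 5)) (e\<^sup>2 / (2 * M))"
    have "d \<le> 1 / 2" "d \<le> r / 5" unfolding d_def by linarith+
    then have d: "0 < d" "d \<le> 1" "4 * d < r" using rR e M by (auto simp: d_def)
    have "d \<le> e\<^sup>2 / (2 * M)" unfolding d_def by simp
    then have "M * d \<le> e\<^sup>2 / 2" using M by (simp add: field_simps)
    moreover have "0 < e\<^sup>2" using e by simp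
    ultimately have Md: "M * d < e\<^sup>2" by linarith
    have "dist (ctr (fst t)) (ctr (fst s)) < e"
      if *: "T \<in> \<Omega>" "S \<in> \<Omega>" "t \<in> T" "s \<in> S" "tile_dist dl t s < d" for T S t s
    proof -
      note near = tile_dist_lessD(1,2)[OF L reg[OF *(1,3)] reg[OF *(2,4)] *(5)]
      have "(dist (ctr (fst t)) (ctr (fst s)))\<^sup>2 \<le> 4 * ((2 * R + 1 + 4 * R\<^sup>2 / r) * d)"
      proof (rule center_perturb[OF body[OF *(1,3)] body[OF *(2,4)] rR])
        show "is_center (2 * R\<^sup>2 / r) (fst t) (ctr (fst t))" "is_center (2 * R\<^sup>2 / r) (fst s) (ctr (fst s))"
          using ctr[OF *(1,3)] ctr[OF *(2,4)] by (simp_all add: c_def)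
        show "\<exists>y'\<in>fst s. dist y y' < d" if "y \<in> fst t" for y using near(1)[OF that] .
        show "\<exists>y\<in>fst t. dist y' y < d" if "y' \<in> fst s" for y' using near(2)[OF that] by (simp add: dist_commute)
      qed (fact d)+
      also have "\<dots> = M * d" by (simp only: M_def mult.assoc)
      also note Md
      finally have "(dist (ctr (fst t)) (ctr (fst s)))\<^sup>2 < e\<^sup>2" .
      then show ?thesis using e by (simp add: power_less_imp_less_base)
    qed
    then show "\<exists>\<delta>>0. \<forall>T\<in>\<Omega>. \<forall>S\<in>\<Omega>. \<forall>t\<in>T. \<forall>s\<in>S. tile_dist dl t s < \<delta> \<longrightarrow> dist (ctr (fst t)) (ctr (fst s)) < e"
      using d(1) by blast
  qed
  then show ?thesis by blast
qed

text \<open>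
Point patterns are close if their points can be matched within \<open>b\<close> on the ball of radius \<open>1 / b\<close>. The indices are
tiles, so that one matching of tiles serves for all point sets derived from them.
\<close>

lemma tiling_close_points:
  fixes T1 :: "'t set" and p q :: "_ \<Rightarrow> 'v::euclidean_space"
  assumes f: "bij_betw f T1 S1" "T1 \<subseteq> T" "S1 \<subseteq> S"
    and inj: "inj_on p T" "inj_on q S"
    and cover: "\<And>t. t \<in> T \<Longrightarrow> norm (p t) \<le> 1 / b \<Longrightarrow> t \<in> T1" "\<And>s. s \<in> S \<Longrightarrow> norm (q s) \<le> 1 / b \<Longrightarrow> s \<in> S1"
    and near: "\<And>t. t \<in> T1 \<Longrightarrow> dist (p t) (q (f t)) < b" "\<And>t. t \<in> T1 \<Longrightarrow> dl (g t) (g' (f t)) < b"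
  shows "tiling_close dl b ((\<lambda>t. ({p t}, g t)) ` T) ((\<lambda>s. ({q s}, g' s)) ` S)"
proof -
  define P where "P t = ({p t}, g t)" for t
  define Q where "Q s = ({q s}, g' s)" for s
  have P: "inj_on P T" and Q: "inj_on Q S"
    using inj by (auto simp: P_def Q_def inj_on_def)
  have "bij_betw P T1 (P ` T1)" using P f(2) by (meson inj_on_imp_bij_betw inj_on_subset)
  moreover have "bij_betw Q S1 (Q ` S1)" using Q f(3) by (meson inj_on_imp_bij_betw inj_on_subset)
  ultimately have bij: "bij_betw (Q \<circ> f \<circ> the_inv_into T1 P) (P ` T1) (Q ` S1)"
    using f(1) by (metis bij_betw_the_inv_into bij_betw_trans comp_assoc)
  have inv: "the_inv_into T1 P (P t) = t" if "t \<in> T1" for t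
    using that P f(2) by (meson inj_on_subset the_inv_into_f_f)
  have "tile_dist dl (P t) (Q (f t)) < b" if "t \<in> T1" for t
  proof -
    have "hausdorff_dist {p t} {q (f t)} \<le> dist (p t) (q (f t))" by (rule hausdorff_dist_le) auto
    then show ?thesis using near[OF that] by (simp add: tile_dist_def P_def Q_def)
  qed
  then have "\<forall>z\<in>P ` T1. tile_dist dl z ((Q \<circ> f \<circ> the_inv_into T1 P) z) < b" using inv by simp
  moreover have "{z\<in>P ` T. fst z \<inter> cball 0 (1 / b) \<noteq> {}} \<subseteq> P ` T1" using cover(1) by (auto simp: P_def)
  moreover have "{z\<in>Q ` S. fst z \<inter> cball 0 (1 / b) \<noteq> {}} \<subseteq> Q ` S1" using cover(2) by (auto simp: Q_def)
  ultimately have "tiling_close dl b (P ` T) (Q ` S)"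
    unfolding tiling_close_def using bij f(2,3) by (intro exI[of _ "P ` T1"] exI[of _ "Q ` S1"] exI conjI) auto
  then show ?thesis by (simp add: P_def[abs_def] Q_def[abs_def])
qed

context compact_tiling_space
begin

lemma tile_selector_exists: "\<exists>ctr. tile_selector dl \<Omega> ctr"
  using tiling_space polytope_tile_selector[OF label_metric, of \<Omega>] delone_tile_selector[OF label_metric, of \<Omega>]
  unfolding tiling_space_def by blast

definition ctr :: "(real^'n) set \<Rightarrow> real^'n" where "ctr = (SOME ctr. tile_selector dl \<Omega> ctr)"

definition pos :: "(real^'n, 'l) tile \<Rightarrow> real^'n" where "pos t = ctr (fst t)"

lemma selector: "tile_selector dl \<Omega> ctr"
  unfolding ctr_def by (rule someI_ex[OF tile_selector_exists])

lemma pos_inj: "T \<in> \<Omega> \<Longrightarrow> inj_on pos T"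
  and pos_delone: "T \<in> \<Omega> \<Longrightarrow> delone (pos ` T)"
  and pos_in: "T \<in> \<Omega> \<Longrightarrow> t \<in> T \<Longrightarrow> pos t \<in> fst t"
  and pos_translate: "T \<in> \<Omega> \<Longrightarrow> t \<in> T \<Longrightarrow> pos (translate_tile x t) = pos t - x"
  and pos_near: "0 < e \<Longrightarrow> \<exists>\<delta>>0. \<forall>T\<in>\<Omega>. \<forall>S\<in>\<Omega>. \<forall>t\<in>T. \<forall>s\<in>S. tile_dist dl t s < \<delta> \<longrightarrow> dist (pos t) (pos s) < e"
  using selector unfolding tile_selector_def pos_def[abs_def] by blast+

lemma pos_image_translate: "T \<in> \<Omega> \<Longrightarrow> pos ` translate x T = (\<lambda>y. y - x) ` pos ` T"
  by (auto simp: translate_def image_image pos_translate intro!: image_cong)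

text \<open>
A matching of the tiles of \<open>T\<close> and \<open>S\<close> that covers all tiles with center in the ball of radius \<open>K\<close>. The bound
\<open>K + 1\<close> keeps all matched tiles in a fixed bounded region, where cocycles are uniformly continuous.
\<close>

definition matched :: "real \<Rightarrow> real \<Rightarrow> (real^'n, 'l) tiling \<Rightarrow> (real^'n, 'l) tiling \<Rightarrow> bool" where
  "matched e K T S \<longleftrightarrow> (\<exists>T1 S1 f. T1 \<subseteq> T \<and> S1 \<subseteq> S \<and> bij_betw f T1 S1 \<and>
    (\<forall>t\<in>T. norm (pos t) \<le> K \<longrightarrow> t \<in> T1) \<and> (\<forall>s\<in>S. norm (pos s) \<le> K \<longrightarrow> s \<in> S1) \<and>
    (\<forall>t\<in>T1. norm (pos t) \<le> K + 1 \<and> dist (pos t) (pos (f t)) < e))"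

lemma positions_match:
  assumes e: "0 < e"
  shows "\<exists>\<delta>>0. \<forall>T\<in>\<Omega>. \<forall>S\<in>\<Omega>. tiling_dist dl T S < \<delta> \<longrightarrow> matched e K T S"
proof -
  obtain d where d: "0 < d" "\<And>T S t s. T \<in> \<Omega> \<Longrightarrow> S \<in> \<Omega> \<Longrightarrow> t \<in> T \<Longrightarrow> s \<in> S \<Longrightarrow> tile_dist dl t s < d \<Longrightarrow>
      dist (pos t) (pos s) < min e 1"
    using pos_near[of "min e 1"] e by auto
  define a where "a = min (min d 1) (1 / (max K 0 + 1))"
  have k: "0 < max K 0 + 1" by simp
  have a: "0 < a" "a \<le> 1" "a \<le> d" "a \<le> 1 / (max K 0 + 1)" using d k by (auto simp: a_def)
  have "a * (max K 0 + 1) \<le> 1" using a(4) k by (simp add: field_simps)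
  then have "max K 0 + 1 \<le> 1 / a" using a(1) by (simp add: field_simps)
  then have Ka: "K \<le> 1 / a" by simp
  have "matched e K T S"
    if T: "T \<in> \<Omega>" and S: "S \<in> \<Omega>" and TS: "tiling_dist dl T S < a" for T S
  proof -
    have "tiling_close dl a T S"
      using TS tiling_dist_less_iff[OF label_metric a(2)] tiling_close_mono[OF label_metric] by (meson less_imp_le)
    then obtain T0 S0 f where f: "T0 \<subseteq> T" "S0 \<subseteq> S" "bij_betw f T0 S0"
      "{t\<in>T. fst t \<inter> cball 0 (1 / a) \<noteq> {}} \<subseteq> T0" "{s\<in>S. fst s \<inter> cball 0 (1 / a) \<noteq> {}} \<subseteq> S0"
      "\<forall>t\<in>T0. tile_dist dl t (f t) < a"
      unfolding tiling_close_def by blast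
    have near: "dist (pos t) (pos (f t)) < min e 1" if "t \<in> T0" for t
      using d(2)[OF T S] f(1,2,6) a(3) that bij_betwE[OF f(3)] by (meson less_le_trans subsetD)
    have meet: "u \<in> U0" if "U \<in> \<Omega>" "u \<in> U" "norm (pos u) \<le> K" "{t\<in>U. fst t \<inter> cball 0 (1 / a) \<noteq> {}} \<subseteq> U0" for u U U0
    proof -
      have "pos u \<in> fst u \<inter> cball 0 (1 / a)" using pos_in[OF that(1,2)] that(3) Ka by simp
      then show ?thesis using that(2,4) by blast
    qed
    define T1 where "T1 = {t\<in>T0. norm (pos t) \<le> K + 1}"
    have "bij_betw f T1 (f ` T1)" using f(3) unfolding T1_def bij_betw_def by (auto intro: inj_on_subset)
    moreover have "s \<in> f ` T1" if s: "s \<in> S" "norm (pos s) \<le> K" for s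
    proof -
      have "s \<in> S0" using meet[OF S s f(5)] .
      then obtain t where t: "t \<in> T0" "s = f t" using f(3) by (auto simp: bij_betw_def)
      have "norm (pos t) \<le> K + 1"
        using near[OF t(1)] s(2) t(2) norm_triangle_sub[of "pos t" "pos s"] by (simp add: dist_norm)
      then show ?thesis using t by (auto simp: T1_def)
    qed
    moreover have "t \<in> T1" if "t \<in> T" "norm (pos t) \<le> K" for t
      using meet[OF T that f(4)] that by (simp add: T1_def)
    moreover have "f ` T1 \<subseteq> S" using f(2,3) by (auto simp: T1_def bij_betw_def)
    ultimately show ?thesis unfolding matched_def using f(1) near by (intro exI[of _ T1] exI[of _ "f ` T1"] exI[of _ f]) (auto simp: T1_def)
  qed
  then show ?thesis using a(1) by blast
qed

lemma associated_delone_pos: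
  assumes T: "T \<in> \<Omega>"
  shows "associated_delone L dl \<Omega> T (pos ` T)"
  unfolding associated_delone_def
proof (intro exI[of _ "\<lambda>S. pos ` S"] conjI ballI allI)
  have U: "Metric_space (UNIV :: unit set) (\<lambda>_ _. 0)" by (simp add: Metric_space_def)
  let ?P = "\<lambda>S. labelled_points (pos ` S) (\<lambda>_. ())"
  have P_eq: "?P S = (\<lambda>t. ({pos t}, ())) ` S" for S by (simp add: labelled_points_def image_image)
  have in_all: "?P S \<in> all_tilings UNIV" if "S \<in> \<Omega>" for S
    using pos_delone[OF that] by (auto simp: all_tilings_def is_labelled_delone_def)
  show "continuous_map (space_topology L dl \<Omega>) (tiling_topology UNIV (\<lambda>_ _. 0)) ?P"
    unfolding space_topology_eq tiling_topology_def sub.metric_continuous_map[OF Metric_space_all_tilings[OF U]]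
  proof (intro conjI ballI allI impI)
    show "?P ` \<Omega> \<subseteq> all_tilings UNIV" using in_all by blast
    fix S and e :: real assume S: "S \<in> \<Omega>" and e: "0 < e"
    define b where "b = min e 1 / 2"
    have b: "0 < b" "b < min e 1" using e by (auto simp: b_def)
    obtain d where d: "0 < d" "\<And>S'. S' \<in> \<Omega> \<Longrightarrow> tiling_dist dl S S' < d \<Longrightarrow> matched b (1 / b) S S'"
      using positions_match[OF b(1), of "1 / b"] S by blast
    have "tiling_dist (\<lambda>_ _. 0) (?P S) (?P S') < e" if S': "S' \<in> \<Omega>" "tiling_dist dl S S' < d" for S'
    proof -
      obtain T1 S1 f where f: "T1 \<subseteq> S" "S1 \<subseteq> S'" "bij_betw f T1 S1"
        "\<forall>t\<in>S. norm (pos t) \<le> 1 / b \<longrightarrow> t \<in> T1" "\<forall>s\<in>S'. norm (pos s) \<le> 1 / b \<longrightarrow> s \<in> S1"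
        "\<forall>t\<in>T1. norm (pos t) \<le> 1 / b + 1 \<and> dist (pos t) (pos (f t)) < b"
        using d(2)[OF S'] unfolding matched_def by blast
      have "tiling_close (\<lambda>_ _. 0) b (?P S) (?P S')"
        unfolding P_eq using f b(1)
        by (intro tiling_close_points[OF f(3,1,2) pos_inj[OF S] pos_inj[OF S'(1)]]) auto
      then have "tiling_dist (\<lambda>_ _. 0) (?P S) (?P S') < min e 1"
        unfolding tiling_dist_less_iff[OF U min.cobounded2] using b by blast
      then show ?thesis by simp
    qed
    then show "\<exists>\<delta>>0. \<forall>x. x \<in> \<Omega> \<and> tiling_dist dl S x < \<delta> \<longrightarrow> tiling_dist (\<lambda>_ _. 0) (?P S) (?P x) < e"
      using d(1) by blast
  qed
qed (use T pos_delone pos_image_translate in auto)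

end


section \<open>The shape change\<close>

text \<open>
A tiling space \<open>\<Omega>\<close> whose coded flow carries an orbit equivalence with smooth displacement.
\<close>

locale shape_change_setting =
  compact_tiling_space L dl \<Omega> +
  sd: smooth_displacement "compact_tiling_space.code L dl \<Omega> ` \<Omega>" "compact_tiling_space.act L dl \<Omega>" Y actY hh kk \<alpha> A sh F C
  for L :: "'l set" and dl :: "'l \<Rightarrow> 'l \<Rightarrow> real" and \<Omega> :: "(real^'n::finite, 'l) tiling set"
    and Y :: "'b::complete_space set" and actY and hh and kk and \<alpha> and A and sh and F and C
begin

interpretation A: flow_cocycle coded act A by (rule sd.A_cocycle)

definition AT :: "(real^'n, 'l) tiling \<Rightarrow> real^'n \<Rightarrow> real^'n" where "AT T = A (code T)"

lemma AT_add: "T \<in> \<Omega> \<Longrightarrow> AT T (u + v) = AT T u + AT (translate u T) v"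
  using A.cocycle_add[of "code T" u v] by (simp add: AT_def act_code)

lemma AT_lower: "T \<in> \<Omega> \<Longrightarrow> norm (u - v) \<le> C * norm (AT T u - AT T v)"
  unfolding AT_def by (rule sd.A_lower) simp

lemma AT_norm: "T \<in> \<Omega> \<Longrightarrow> norm u \<le> C * norm (AT T u)"
  unfolding AT_def by (rule sd.A_inverse_growth) simp

lemma AT_bij: "T \<in> \<Omega> \<Longrightarrow> bij (AT T)"
  unfolding AT_def by (rule sd.A_bij) simp

lemma AT_near:
  assumes T: "T \<in> \<Omega>" and e: "0 < e"
  shows "\<exists>\<delta>>0. \<forall>S\<in>\<Omega>. \<forall>p p'. tiling_dist dl T S < \<delta> \<longrightarrow> norm p \<le> K \<longrightarrow> dist p p' < \<delta> \<longrightarrow> dist (AT T p) (AT S p') < e"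
proof -
  have "continuous_on (coded \<times> cball 0 (K + 1)) (\<lambda>(x, u). A x u)"
    by (rule continuous_on_subset[OF A.cocycle_cont]) auto
  then have "uniformly_continuous_on (coded \<times> cball 0 (K + 1)) (\<lambda>(x, u). A x u)"
    by (intro compact_uniformly_continuous compact_Times compact_coded compact_cball)
  then obtain d where d: "0 < d" "\<And>z z'. z \<in> coded \<times> cball 0 (K + 1) \<Longrightarrow> z' \<in> coded \<times> cball 0 (K + 1) \<Longrightarrow>
      dist z' z < d \<Longrightarrow> dist (case z' of (x, u) \<Rightarrow> A x u) (case z of (x, u) \<Rightarrow> A x u) < e"
    using e unfolding uniformly_continuous_on_def by metis
  obtain d' where d': "0 < d'" "\<And>S. S \<in> \<Omega> \<Longrightarrow> tiling_dist dl T S < d' \<Longrightarrow> dist (code T) (code S) < d / 2"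
    using code_near[OF T, of "d / 2"] d(1) by auto
  define \<delta> where "\<delta> = min (min d' (d / 2)) 1"
  have "dist (AT T p) (AT S p') < e" if S: "S \<in> \<Omega>" "tiling_dist dl T S < \<delta>" and p: "norm p \<le> K" "dist p p' < \<delta>" for S p p'
  proof -
    have cS: "dist (code T) (code S) < d / 2" using S by (intro d'(2)) (auto simp: \<delta>_def)
    have "dist (code T, p) (code S, p') \<le> dist (code T) (code S) + dist p p'"
      unfolding dist_Pair_Pair by (rule sqrt_sum_squares_le_sum) auto
    then have "dist (code T, p) (code S, p') < d" using cS p(2) by (simp add: \<delta>_def)
    moreover have "norm p' \<le> K + 1"
      using p norm_triangle_sub[of p' p] by (simp add: \<delta>_def dist_norm norm_minus_commute)
    ultimately have "dist (case (code T, p) of (x, u) \<Rightarrow> A x u) (case (code S, p') of (x, u) \<Rightarrow> A x u) < e"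
      using T S(1) p(1) by (intro d(2)) auto
    then show ?thesis by (simp add: AT_def)
  qed
  moreover have "0 < \<delta>" using d(1) d'(1) by (simp add: \<delta>_def)
  ultimately show ?thesis by blast
qed

text \<open>
The shape change: the center \<open>p\<close> of each tile moves to \<open>A(T, p)\<close> and is labelled by the tiling seen from
\<open>p\<close>.
\<close>

definition hsc :: "(real^'n, 'l) tiling \<Rightarrow> (real^'n, (real^'n, 'l) tiling) tiling" where
  "hsc T = (\<lambda>t. ({AT T (pos t)}, translate (pos t) T)) ` T"

lemma hsc_eq_moved: "hsc T = moved_tiling T (pos ` T) (AT T)"
  by (simp add: hsc_def moved_tiling_def image_image)

lemma hsc_translate:
  assumes T: "T \<in> \<Omega>"
  shows "hsc (translate x T) = translate (AT T x) (hsc T)"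
proof -
  have "hsc (translate x T) = (\<lambda>t. ({AT (translate x T) (pos t - x)}, translate (pos t) T)) ` T"
    unfolding hsc_def unfolding translate_def[of x T] image_image
    by (rule image_cong[OF refl]) (simp add: pos_translate[OF T] translate_def[of x T, symmetric] translate_translate)
  also have "\<dots> = (\<lambda>t. ({AT T (pos t) - AT T x}, translate (pos t) T)) ` T"
    using AT_add[OF T, of x] by (intro image_cong[OF refl]) (simp add: algebra_simps, metis add_diff_cancel_left' diff_add_cancel)
  also have "\<dots> = translate (AT T x) (hsc T)"
    by (simp add: hsc_def translate_def[of "AT T x"] image_image translate_tile_def)
  finally show ?thesis .
qed

lemma tiling_nonempty: "T \<in> \<Omega> \<Longrightarrow> \<exists>t. t \<in> T"
  using pos_delone[of T] unfolding delone_def relatively_dense_def by blast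

text \<open>
One point of \<open>hsc T\<close> with its label determines the orbit of \<open>T\<close>; its position determines the point on the orbit,
because \<open>A(T, z) = 0\<close> only for \<open>z = 0\<close>.
\<close>

lemma hsc_inj: "inj_on hsc \<Omega>"
proof (rule inj_onI)
  fix T S assume T: "T \<in> \<Omega>" and S: "S \<in> \<Omega>" and eq: "hsc T = hsc S"
  obtain t where t: "t \<in> T" using tiling_nonempty[OF T] by blast
  then have "({AT T (pos t)}, translate (pos t) T) \<in> hsc S" unfolding eq[symmetric] by (simp add: hsc_def)
  then obtain s where s: "AT T (pos t) = AT S (pos s)" "translate (pos t) T = translate (pos s) S" by (auto simp: hsc_def)
  define z where "z = pos t - pos s"
  have "translate z T = translate (- pos s) (translate (pos t) T)" by (simp add: translate_translate z_def)
  then have Sz: "translate z T = S" by (simp add: s(2) translate_translate)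
  have "AT T (pos t) = AT T z + AT S (pos s)" using AT_add[OF T, of z "pos s"] unfolding Sz by (simp add: z_def)
  then have "AT T z = 0" using s(1) by simp
  then have "z = 0" using AT_norm[OF T, of z] by simp
  then show "T = S" using Sz by simp
qed

lemma hsc_delone:
  assumes T: "T \<in> \<Omega>"
  shows "is_labelled_delone \<Omega> (hsc T)"
  unfolding is_labelled_delone_def
proof (intro exI conjI)
  let ?X = "AT T ` pos ` T"
  have C: "0 < C" by (rule sd.C)
  have inv: "inv (AT T) (AT T p) = p" for p using AT_bij[OF T] by (simp add: bij_is_inj)
  show "hsc T = labelled_points ?X (\<lambda>q. translate (inv (AT T) q) T)"
    by (simp add: hsc_def labelled_points_def image_image inv)
  show "(\<lambda>q. translate (inv (AT T) q) T) ` ?X \<subseteq> \<Omega>" using translate_in[OF T] by blast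
  obtain e where e: "0 < e" "\<And>x y. x \<in> pos ` T \<Longrightarrow> y \<in> pos ` T \<Longrightarrow> dist x y < e \<Longrightarrow> x = y"
    using pos_delone[OF T] unfolding delone_def uniform_discrete_def by blast
  have "uniform_discrete ?X"
    unfolding uniform_discrete_def
  proof (intro exI[of _ "e / C"] conjI ballI impI)
    fix x y assume xy: "x \<in> ?X" "y \<in> ?X" "dist x y < e / C"
    obtain p where p: "p \<in> pos ` T" "x = AT T p" using xy(1) by (rule imageE)
    obtain q where q: "q \<in> pos ` T" "y = AT T q" using xy(2) by (rule imageE)
    have "dist p q \<le> C * dist x y" using AT_lower[OF T, of p q] p(2) q(2) by (simp add: dist_norm)
    also have "\<dots> < e" using xy(3) C by (simp add: field_simps)
    finally show "x = y" using e(2)[OF p(1) q(1)] p(2) q(2) by simp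
  qed (use e(1) C in simp)
  moreover have "relatively_dense ?X"
  proof -
    obtain R where R: "\<And>x. \<exists>p\<in>pos ` T. dist x p \<le> R"
      using pos_delone[OF T] unfolding delone_def relatively_dense_def by blast
    obtain K where K: "\<forall>x\<in>coded. \<forall>u. norm u \<le> R \<longrightarrow> norm (A x u) \<le> K" using sd.A_bounded[of R] by blast
    have "\<exists>q\<in>?X. dist y q \<le> K" for y
    proof -
      obtain x where y: "y = AT T x" using AT_bij[OF T] by (metis bij_pointE)
      obtain p where p: "p \<in> pos ` T" "dist x p \<le> R" using R by blast
      have "AT T p = AT T x + AT (translate x T) (p - x)" using AT_add[OF T, of x "p - x"] by simp
      moreover have "norm (AT (translate x T) (p - x)) \<le> K"
        using K translate_in[OF T] p(2) by (simp add: AT_def dist_norm norm_minus_commute)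
      ultimately have "dist y (AT T p) \<le> K" by (simp add: y dist_norm)
      then show ?thesis using p(1) by blast
    qed
    then show ?thesis unfolding relatively_dense_def by blast
  qed
  ultimately show "delone ?X" by (simp add: delone_def)
qed

lemma hsc_all: "T \<in> \<Omega> \<Longrightarrow> hsc T \<in> all_tilings \<Omega>"
  using hsc_delone by (simp add: all_tilings_def)

text \<open>
A moved point in the ball of radius \<open>1 / b\<close> comes from a tile with center in the ball of radius \<open>C / b\<close>,
since \<open>A(T, \<cdot>)\<close> shrinks distances at most by the factor \<open>C\<close>. On that bounded region positions and
labels depend uniformly continuously on the tiling.
\<close>

lemma hsc_continuous: "continuous_map (space_topology L dl \<Omega>) (tiling_topology \<Omega> (tiling_dist dl)) hsc"
  unfolding space_topology_eq tiling_topology_def sub.metric_continuous_map[OF Metric_space_all_tilings[OF metric_\<Omega>]]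
proof (intro conjI ballI allI impI)
  show "hsc ` \<Omega> \<subseteq> all_tilings \<Omega>" using hsc_all by blast
  fix T and e :: real assume T: "T \<in> \<Omega>" and e: "0 < e"
  define b where "b = min e 1 / 2"
  have b: "0 < b" "b < min e 1" using e by (auto simp: b_def)
  define K where "K = C / b"
  have K: "norm p \<le> K" if "S \<in> \<Omega>" "norm (AT S p) \<le> 1 / b" for S p
  proof -
    have "norm p \<le> C * norm (AT S p)" by (rule AT_norm[OF that(1)])
    also have "\<dots> \<le> C * (1 / b)" using that(2) sd.C by (intro mult_left_mono) auto
    finally show ?thesis by (simp add: K_def)
  qed
  obtain d1 where d1: "0 < d1" "\<And>S p p'. S \<in> \<Omega> \<Longrightarrow> tiling_dist dl T S < d1 \<Longrightarrow> norm p \<le> K + 1 \<Longrightarrow> dist p p' < d1 \<Longrightarrow>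
      dist (AT T p) (AT S p') < b" using AT_near[OF T b(1), of "K + 1"] by blast
  obtain d2 where d2: "0 < d2" "\<And>S p p'. S \<in> \<Omega> \<Longrightarrow> norm p \<le> K + 1 \<Longrightarrow> dist p p' < d2 \<Longrightarrow> tiling_dist dl T S < d2 \<Longrightarrow>
      tiling_dist dl (translate p T) (translate p' S) < b" using translate_uniform[OF b(1), of "K + 1"] T by blast
  define d3 where "d3 = min d1 d2"
  have "0 < d3" using d1 d2 by (simp add: d3_def)
  obtain d4 where d4: "0 < d4" "\<And>S. S \<in> \<Omega> \<Longrightarrow> tiling_dist dl T S < d4 \<Longrightarrow> matched d3 K T S"
    using positions_match[OF \<open>0 < d3\<close>, of K] T by blast
  have "tiling_dist (tiling_dist dl) (hsc T) (hsc S) < e" if S: "S \<in> \<Omega>" and TS: "tiling_dist dl T S < min d3 d4" for S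
  proof -
    obtain T1 S1 f where f: "T1 \<subseteq> T" "S1 \<subseteq> S" "bij_betw f T1 S1"
      "\<forall>t\<in>T. norm (pos t) \<le> K \<longrightarrow> t \<in> T1" "\<forall>s\<in>S. norm (pos s) \<le> K \<longrightarrow> s \<in> S1"
      "\<forall>t\<in>T1. norm (pos t) \<le> K + 1 \<and> dist (pos t) (pos (f t)) < d3"
      using d4(2)[OF S] TS unfolding matched_def by auto
    have inj: "inj_on (\<lambda>t. AT U (pos t)) U" if "U \<in> \<Omega>" for U
      using comp_inj_on[OF pos_inj[OF that] inj_on_subset[OF bij_is_inj[OF AT_bij[OF that]]]] by (simp add: comp_def)
    have "tiling_close (tiling_dist dl) b (hsc T) (hsc S)"
      unfolding hsc_def
    proof (rule tiling_close_points[OF f(3,1,2) inj[OF T] inj[OF S]])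
      show "t \<in> T1" if "t \<in> T" "norm (AT T (pos t)) \<le> 1 / b" for t using f(4) that K[OF T] by blast
      show "s \<in> S1" if "s \<in> S" "norm (AT S (pos s)) \<le> 1 / b" for s using f(5) that K[OF S] by blast
      show "dist (AT T (pos t)) (AT S (pos (f t))) < b" if "t \<in> T1" for t
        using f(6) that TS by (intro d1(2) S) (auto simp: d3_def)
      show "tiling_dist dl (translate (pos t) T) (translate (pos (f t)) S) < b" if "t \<in> T1" for t
        using f(6) that TS by (intro d2(2) S) (auto simp: d3_def)
    qed
    then have "tiling_dist (tiling_dist dl) (hsc T) (hsc S) < min e 1"
      unfolding tiling_dist_less_iff[OF metric_\<Omega> min.cobounded2] using b by blast
    then show ?thesis by simp
  qed
  then show "\<exists>\<delta>>0. \<forall>x. x \<in> \<Omega> \<and> tiling_dist dl T x < \<delta> \<longrightarrow> tiling_dist (tiling_dist dl) (hsc T) (hsc x) < e"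
    using \<open>0 < d3\<close> d4(1) by (intro exI[of _ "min d3 d4"]) auto
qed

lemma hsc_homeomorphic:
  "homeomorphic_map (space_topology L dl \<Omega>) (space_topology \<Omega> (tiling_dist dl) (hsc ` \<Omega>)) hsc"
proof (rule continuous_imp_homeomorphic_map)
  interpret H: Metric_space "all_tilings \<Omega> :: (real^'n, (real^'n, 'l) tiling) tiling set" "tiling_dist (tiling_dist dl)"
    by (rule Metric_space_all_tilings[OF metric_\<Omega>])
  have top: "topspace (space_topology \<Omega> (tiling_dist dl) (hsc ` \<Omega>)) = hsc ` \<Omega>"
    using hsc_all by (auto simp: space_topology_def tiling_topology_def)
  show "compact_space (space_topology L dl \<Omega>)" by (rule compact_\<Omega>)
  show "Hausdorff_space (space_topology \<Omega> (tiling_dist dl) (hsc ` \<Omega>))"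
    by (simp add: space_topology_def tiling_topology_def Hausdorff_space_subtopology H.Hausdorff_space_mtopology)
  show "continuous_map (space_topology L dl \<Omega>) (space_topology \<Omega> (tiling_dist dl) (hsc ` \<Omega>)) hsc"
    using hsc_continuous unfolding space_topology_def[of \<Omega>] by (simp add: continuous_map_in_subtopology topspace_\<Omega>)
  show "hsc ` topspace (space_topology L dl \<Omega>) = topspace (space_topology \<Omega> (tiling_dist dl) (hsc ` \<Omega>))"
    by (simp add: top topspace_\<Omega>)
  show "inj_on hsc (topspace (space_topology L dl \<Omega>))" using hsc_inj by (simp add: topspace_\<Omega>)
qed

lemma hsc_compactin: "compactin (tiling_topology \<Omega> (tiling_dist dl)) (hsc ` \<Omega>)"
  using image_compactin[OF _ hsc_continuous] compact_\<Omega> topspace_\<Omega> unfolding compact_space_def by metis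

lemma hsc_tiling_space: "tiling_space \<Omega> (tiling_dist dl) (hsc ` \<Omega>)"
  unfolding tiling_space_def
proof (intro conjI ballI allI hsc_compactin)
  show "compact_metric \<Omega> (tiling_dist dl)"
    using metric_\<Omega> compact_\<Omega> by (simp add: compact_metric_def space_topology_eq)
  show "(\<forall>T\<in>hsc ` \<Omega>. is_tiling \<Omega> T) \<and> compact_prototiles \<Omega> (tiling_dist dl) (hsc ` \<Omega>) \<or> (\<forall>T\<in>hsc ` \<Omega>. is_labelled_delone \<Omega> T)"
    using hsc_delone by blast
  fix T' y assume "T' \<in> hsc ` \<Omega>"
  then obtain T where T: "T \<in> \<Omega>" "T' = hsc T" by blast
  obtain x where "y = AT T x" using AT_bij[OF T(1)] by (metis bij_pointE)
  then show "translate y T' \<in> hsc ` \<Omega>" using hsc_translate[OF T(1), of x] translate_in[OF T(1)] T(2) by (metis imageI)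
qed

lemma hsc_orbit: "T \<in> \<Omega> \<Longrightarrow> orbit (hsc T) = hsc ` orbit T"
proof -
  assume T: "T \<in> \<Omega>"
  have "orbit (hsc T) = (\<lambda>y. translate y (hsc T)) ` range (AT T)"
    using AT_bij[OF T] by (simp add: orbit_def bij_is_surj)
  also have "\<dots> = range (\<lambda>x. hsc (translate x T))" by (simp add: hsc_translate[OF T] image_image)
  also have "\<dots> = hsc ` orbit T" by (simp add: orbit_def image_image)
  finally show ?thesis .
qed

lemma hsc_orbit_closure:
  assumes min: "minimal L dl \<Omega>" and T: "T \<in> \<Omega>"
  shows "tiling_topology \<Omega> (tiling_dist dl) closure_of orbit (hsc T) = hsc ` \<Omega>"
proof
  interpret H: Metric_space "all_tilings \<Omega> :: (real^'n, (real^'n, 'l) tiling) tiling set" "tiling_dist (tiling_dist dl)"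
    by (rule Metric_space_all_tilings[OF metric_\<Omega>])
  have orb: "orbit T \<subseteq> \<Omega>" using translate_in[OF T] by (auto simp: orbit_def)
  have "closedin (tiling_topology \<Omega> (tiling_dist dl)) (hsc ` \<Omega>)"
    using compactin_imp_closedin[OF H.Hausdorff_space_mtopology] hsc_compactin by (simp add: tiling_topology_def)
  then show "tiling_topology \<Omega> (tiling_dist dl) closure_of orbit (hsc T) \<subseteq> hsc ` \<Omega>"
    using orb by (intro closure_of_minimal) (auto simp: hsc_orbit[OF T])
  have "hsc ` \<Omega> = hsc ` (space_topology L dl \<Omega> closure_of orbit T)"
    using min T by (simp add: minimal_def)
  also have "\<dots> = space_topology \<Omega> (tiling_dist dl) (hsc ` \<Omega>) closure_of (hsc ` orbit T)"
    using homeomorphic_map_closure_of[OF hsc_homeomorphic] orb topspace_\<Omega> by metis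
  also have "\<dots> \<subseteq> tiling_topology \<Omega> (tiling_dist dl) closure_of orbit (hsc T)"
    unfolding space_topology_def closure_of_subtopology hsc_orbit[OF T]
    by (rule order_trans[OF Int_lower2]) (rule closure_of_mono, blast)
  finally show "hsc ` \<Omega> \<subseteq> tiling_topology \<Omega> (tiling_dist dl) closure_of orbit (hsc T)" .
qed

text \<open>
The base tiling is translated so that one of its centers is at the origin.
\<close>

lemma hsc_shape_change:
  assumes min: "minimal L dl \<Omega>"
  shows "shape_change L dl \<Omega> (hsc ` \<Omega>) hsc"
proof -
  obtain T0 where T0: "T0 \<in> \<Omega>" using nonempty by blast
  obtain t0 where t0: "t0 \<in> T0" using tiling_nonempty[OF T0] by blast
  define T where "T = translate (pos t0) T0"
  have T: "T \<in> \<Omega>" using translate_in[OF T0] by (simp add: T_def)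
  define \<omega> where "\<omega> u = F (act u (code T))" for u
  have cT: "code T \<in> coded" using T by simp
  have orbit_code: "code (translate u T) = act u (code T)" for u using act_code[OF T] by simp
  have form: "form_integral \<omega> = AT T"
    unfolding \<omega>_def[abs_def] AT_def by (rule sd.form_integral_F[OF cT])
  have "pos t0 - pos t0 \<in> pos ` T" using t0 by (simp add: T_def pos_image_translate[OF T0])
  then have zero: "0 \<in> pos ` T" by simp
  have pe: "smooth_weakly_pe_form L dl \<Omega> T \<omega>"
    unfolding smooth_weakly_pe_form_def
  proof (intro allI conjI)
    show "smooth (\<lambda>x. \<omega> x $ i $ j)" for i j unfolding \<omega>_def by (rule sd.F_smooth[OF cT])
    fix i j js
    obtain G where G: "continuous_on coded G"
      "\<forall>x\<in>coded. \<forall>u. foldr partial js (\<lambda>u. F (act u x) $ i $ j) u = G (act u x)" using sd.F_pe by blast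
    show "weakly_pe L dl \<Omega> T (foldr partial js (\<lambda>x. \<omega> x $ i $ j))"
      unfolding weakly_pe_def
    proof (intro exI conjI allI)
      have "continuous_map (top_of_set coded) euclideanreal G" using G(1) by simp
      then show "continuous_map (space_topology L dl \<Omega>) euclideanreal (G \<circ> code)"
        using code_continuous continuous_map_compose by blast
      show "foldr partial js (\<lambda>x. \<omega> x $ i $ j) u = (G \<circ> code) (translate u T)" for u
        using G(2)[rule_format, OF cT, of u] unfolding \<omega>_def comp_def orbit_code .
    qed
  qed
  have homeo: "homeomorphic_map euclidean euclidean (AT T)"
  proof -
    have "continuous_on UNIV (AT T)"
      unfolding AT_def by (intro A.cocycle_continuous continuous_intros) (use T in auto)
    moreover have "continuous_on UNIV (inv (AT T))"
    proof (rule continuous_on_iff[THEN iffD2], intro ballI allI impI)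
      fix y e :: "_ :: metric_space" and r :: real assume r: "0 < r"
      have "dist (inv (AT T) y') (inv (AT T) y) < r" if "dist y' y < r / C" for y y'
      proof -
        have "norm (inv (AT T) y' - inv (AT T) y) \<le> C * norm (AT T (inv (AT T) y') - AT T (inv (AT T) y))"
          by (rule AT_lower[OF T])
        also have "\<dots> = C * dist y' y" using AT_bij[OF T] by (simp add: bij_is_surj surj_f_inv_f dist_norm)
        also have "\<dots> < r" using that sd.C by (simp add: field_simps)
        finally show ?thesis by (simp add: dist_norm)
      qed
      then show "\<exists>d>0. \<forall>x'\<in>UNIV. dist x' y < d \<longrightarrow> dist (inv (AT T) x') (inv (AT T) y) < r"
        using r sd.C by (intro exI[of _ "r / C"]) auto
    qed
    ultimately have "homeomorphic_maps euclidean euclidean (AT T) (inv (AT T))"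
      using AT_bij[OF T] unfolding homeomorphic_maps_def
      by (auto simp: bij_is_inj bij_is_surj surj_f_inv_f)
    then show ?thesis by (rule homeomorphic_maps_imp_map)
  qed
  have moved: "moved_tiling T (pos ` T) (AT T) = hsc T" by (simp add: hsc_eq_moved)
  have ass: "associated_delone L dl \<Omega> T (pos ` T)" by (rule associated_delone_pos[OF T])
  have closed: "closed_form \<omega>" unfolding \<omega>_def[abs_def] by (rule sd.F_closed[OF cT])
  show ?thesis
    unfolding shape_change_def
    by (rule bexI[OF _ T], rule exI[of _ "pos ` T"], rule exI[of _ \<omega>])
      (simp add: Let_def form moved zero pos_delone[OF T] ass pe closed homeo hsc_delone[OF T]
        hsc_orbit_closure[OF min T] hsc_homeomorphic hsc_translate[OF T])
qed

definition quasi_T :: "(real^'n, 'l) tiling \<Rightarrow> (real^'n, 'l) tiling" where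
  "quasi_T T = translate (sd.rewind (code T)) T"

lemma quasi_T_eq: "T \<in> \<Omega> \<Longrightarrow> quasi_T T = decode (sd.quasi (code T))"
  by (simp add: quasi_T_def sd.quasi_def act_code decode_code translate_in)

lemma quasi_T_quasi_translation: "quasi_translation L dl \<Omega> quasi_T"
  unfolding quasi_translation_def
proof (intro exI conjI ballI)
  have "continuous_map (top_of_set coded) euclidean sd.rewind" using sd.rewind_continuous by simp
  then show "continuous_map (space_topology L dl \<Omega>) euclidean (sd.rewind \<circ> code)"
    using code_continuous continuous_map_compose by blast
qed (simp add: quasi_T_def)

lemma quasi_T_homeomorphic: "homeomorphic_map (space_topology L dl \<Omega>) (space_topology L dl \<Omega>) quasi_T"
proof -
  have img: "sd.quasi ` coded = coded" and inj: "inj_on sd.quasi coded" using sd.quasi_bij by (auto simp: bij_betw_def)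
  have "continuous_map (top_of_set coded) (top_of_set coded) sd.quasi"
    using sd.quasi_continuous img by (simp add: continuous_map_in_subtopology image_subset_iff_funcset[symmetric])
  then have "homeomorphic_map (top_of_set coded) (top_of_set coded) sd.quasi"
    using compact_coded img inj by (intro continuous_imp_homeomorphic_map) (auto simp: Hausdorff_space_subtopology compact_space_subtopology)
  from homeomorphic_map_compose[OF homeomorphic_map_compose[OF code_homeomorphic this] decode_homeomorphic]
  have "homeomorphic_map (space_topology L dl \<Omega>) (space_topology L dl \<Omega>) (decode \<circ> (sd.quasi \<circ> code))" .
  then show ?thesis
    by (rule homeomorphic_map_eq) (simp add: topspace_\<Omega> quasi_T_eq)
qed

text \<open>
Composed with the quasi-translation, the shape change has displacement exactly \<open>\<alpha>\<close>, the same as the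
orbit equivalence.
\<close>

lemma hsc_quasi_T:
  assumes T: "T \<in> \<Omega>"
  shows "hsc (quasi_T (translate u T)) = translate (\<alpha> (code T) u) (hsc (quasi_T T))"
proof -
  have key: "hsc (quasi_T (translate v T)) = translate (\<alpha> (code T) v - sh (code T)) (hsc T)" for v
  proof -
    have "quasi_T (translate v T) = translate (v + sd.rewind (act v (code T))) T"
      by (simp add: quasi_T_def act_code[OF T] translate_translate)
    then show ?thesis
      using hsc_translate[OF T] sd.A_shifted_rewind[of "code T" v] T by (simp add: AT_def)
  qed
  have "\<alpha> (code T) 0 = 0" using flow_cocycle.cocycle_0[OF sd.\<alpha>_cocycle, of "code T"] T by simp
  then show ?thesis using key[of u] key[of 0] by (simp add: translate_translate)
qed

end

theorem theorem1p2:
  fixes L :: "'l set" and dl :: "'l \<Rightarrow> 'l \<Rightarrow> real" and \<Omega> :: "(real^'n::finite, 'l) tiling set"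
    and L' :: "'m set" and dl' :: "'m \<Rightarrow> 'm \<Rightarrow> real" and \<Omega>' :: "(real^'n, 'm) tiling set"
    and h :: "(real^'n, 'l) tiling \<Rightarrow> (real^'n, 'm) tiling"
  assumes "tiling_space L dl \<Omega>"
    and "minimal L dl \<Omega>"
    and "uniquely_ergodic L dl \<Omega>"
    and "aperiodic \<Omega>"
    and "tiling_space L' dl' \<Omega>'"
    and "orbit_equivalence L dl \<Omega> L' dl' \<Omega>' h"
  shows "\<exists>(\<Omega>'' :: (real^'n, (real^'n, 'l) tiling) tiling set) \<tau> h_sc \<phi>.
           tiling_space \<Omega> (tiling_dist dl) \<Omega>'' \<and>
           homeomorphic_map (space_topology L dl \<Omega>) (space_topology L dl \<Omega>) \<tau> \<and>
           homeomorphic_map (space_topology L dl \<Omega>)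
             (space_topology \<Omega> (tiling_dist dl) \<Omega>'') h_sc \<and>
           homeomorphic_map (space_topology L' dl' \<Omega>')
             (space_topology \<Omega> (tiling_dist dl) \<Omega>'') \<phi> \<and>
           (\<forall>T\<in>\<Omega>. \<phi> (h T) = h_sc (\<tau> T)) \<and>
           quasi_translation L dl \<Omega> \<tau> \<and>
           shape_change L dl \<Omega> \<Omega>'' h_sc \<and>
           topological_conjugacy L' dl' \<Omega>' \<Omega> (tiling_dist dl) \<Omega>'' \<phi>"
proof -
  have h: "homeomorphic_map (space_topology L dl \<Omega>) (space_topology L' dl' \<Omega>') h"
    and h_orbit: "\<And>T. T \<in> \<Omega> \<Longrightarrow> h ` orbit T = orbit (h T)"
    using assms(6) by (auto simp: orbit_equivalence_def)
  have ne: "\<Omega> \<noteq> {}"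
  proof -
    obtain M where "invariant_prob_measure L dl \<Omega> M" using assms(3) unfolding uniquely_ergodic_def by blast
    then show ?thesis using prob_space.not_empty unfolding invariant_prob_measure_def by blast
  qed
  interpret O: compact_tiling_space L dl \<Omega> by unfold_locales (fact assms ne)+
  have top': "topspace (space_topology L' dl' \<Omega>') = \<Omega>'"
    using assms(5) unfolding space_topology_def tiling_space_def
    by (metis compactin_subset_topspace topspace_subtopology_subset)
  have h_image: "h ` \<Omega> = \<Omega>'" using homeomorphic_imp_surjective_map[OF h] by (simp add: O.topspace_\<Omega> top')
  have ne': "\<Omega>' \<noteq> {}" using ne h_image by blast
  interpret O': compact_tiling_space L' dl' \<Omega>' by unfold_locales (fact assms ne')+
  obtain g where g: "homeomorphic_maps (space_topology L dl \<Omega>) (space_topology L' dl' \<Omega>') h g"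
    using h homeomorphic_map_maps by blast
  have gh: "g (h T) = T" if "T \<in> \<Omega>" for T using g that by (simp add: homeomorphic_maps_def O.topspace_\<Omega>)
  have g_homeo: "homeomorphic_map (space_topology L' dl' \<Omega>') (space_topology L dl \<Omega>) g"
    using g homeomorphic_maps_map by blast
  define hh kk where "hh = O'.code \<circ> h \<circ> O.decode" and "kk = O.code \<circ> g \<circ> O'.decode"
  have hh_code: "hh (O.code T) = O'.code (h T)" if "T \<in> \<Omega>" for T using that by (simp add: hh_def O.decode_code)
  have maps: "homeomorphic_maps (top_of_set O.coded) (top_of_set O'.coded) hh kk"
  proof -
    have "homeomorphic_maps (top_of_set O.coded) (space_topology L dl \<Omega>) O.decode O.code"
      using O.code_decode homeomorphic_maps_sym by blast
    from homeomorphic_maps_compose[OF conjI[OF homeomorphic_maps_compose[OF conjI[OF this g]] O'.code_decode]]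
    show ?thesis by (simp add: hh_def kk_def comp_assoc)
  qed
  have homeo: "homeomorphism O.coded O'.coded hh kk"
  proof -
    have c: "continuous_on O.coded hh" "continuous_on O'.coded kk" "hh ` O.coded \<subseteq> O'.coded" "kk ` O'.coded \<subseteq> O.coded"
      and i: "\<And>x. x \<in> O.coded \<Longrightarrow> kk (hh x) = x" "\<And>y. y \<in> O'.coded \<Longrightarrow> hh (kk y) = y"
      using maps unfolding homeomorphic_maps_def by (auto simp: continuous_map_in_subtopology)
    show ?thesis by (rule homeomorphismI) (fact c i)+
  qed
  have orb: "hh ` range (\<lambda>v. O.act v x) = range (\<lambda>w. O'.act w (hh x))" if x: "x \<in> O.coded" for x
  proof -
    obtain T where T: "T \<in> \<Omega>" "x = O.code T" using x by blast
    then have hT: "h T \<in> \<Omega>'" using h_image by blast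
    have "hh ` range (\<lambda>v. O.act v x) = O'.code ` h ` orbit T"
      using T by (simp add: orbit_def image_image O.act_code hh_code O.translate_in)
    also have "\<dots> = O'.code ` orbit (h T)" using h_orbit[OF T(1)] by simp
    also have "\<dots> = range (\<lambda>w. O'.act w (hh x))"
      using T hT by (simp add: orbit_def image_image O'.act_code hh_code)
    finally show ?thesis .
  qed
  interpret E: flow_orbit_equivalence O.coded O.act O'.coded O'.act hh kk
    by (intro flow_orbit_equivalence.intro flow_orbit_equivalence_axioms.intro O.flow.compact_flow_axioms
        O'.flow.compact_flow_axioms homeo orb O.flow_free O.flow_minimal assms)
  obtain M where "\<And>N. invariant_prob O.coded O.act N \<Longrightarrow> N = M"
    using O.flow_uniquely_ergodic[OF assms(3)] by blast
  then obtain \<alpha> A sh F C where "smooth_displacement O.coded O.act O'.coded O'.act hh kk \<alpha> A sh F C"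
    using E.smooth_displacement_exists[of M] ne by blast
  then interpret Z: shape_change_setting L dl \<Omega> O'.coded O'.act hh kk \<alpha> A sh F C
    by (intro shape_change_setting.intro O.compact_tiling_space_axioms)
  define \<phi> where "\<phi> = Z.hsc \<circ> (Z.quasi_T \<circ> g)"
  have \<phi>h: "\<phi> (h T) = Z.hsc (Z.quasi_T T)" if "T \<in> \<Omega>" for T using gh[OF that] by (simp add: \<phi>_def)
  have \<phi>: "homeomorphic_map (space_topology L' dl' \<Omega>') (space_topology \<Omega> (tiling_dist dl) (Z.hsc ` \<Omega>)) \<phi>"
    unfolding \<phi>_def
    by (rule homeomorphic_map_compose[OF homeomorphic_map_compose[OF g_homeo Z.quasi_T_homeomorphic] Z.hsc_homeomorphic])
  have conj: "\<phi> (translate y S) = translate y (\<phi> S)" if S: "S \<in> \<Omega>'" for S y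
  proof -
    obtain T where T: "T \<in> \<Omega>" "S = h T" using S h_image by blast
    obtain u where u: "y = \<alpha> (O.code T) u" using Z.sd.\<alpha>_bij[of "O.code T"] T(1) by (metis bij_pointE imageI)
    have "O'.code (h (translate u T)) = O'.act y (O'.code (h T))"
      using Z.sd.\<alpha>[of "O.code T" u] T(1) by (simp add: u O.act_code hh_code O.translate_in)
    also have "\<dots> = O'.code (translate y (h T))" using S T by (simp add: O'.act_code)
    finally have "h (translate u T) = translate y (h T)"
      using O'.decode_code O'.translate_in S T h_image O.translate_in by (metis imageI)
    then have "\<phi> (translate y S) = Z.hsc (Z.quasi_T (translate u T))"
      using \<phi>h[OF O.translate_in[OF T(1), of u]] T(2) by simp
    also have "\<dots> = translate y (\<phi> S)" using Z.hsc_quasi_T[OF T(1), of u] \<phi>h[OF T(1)] by (simp add: u T(2))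
    finally show ?thesis .
  qed
  show ?thesis
    by (rule exI[of _ "Z.hsc ` \<Omega>"], rule exI[of _ Z.quasi_T], rule exI[of _ Z.hsc], rule exI[of _ \<phi>])
      (use \<phi> \<phi>h conj Z.hsc_tiling_space Z.quasi_T_homeomorphic Z.hsc_homeomorphic Z.quasi_T_quasi_translation
        Z.hsc_shape_change[OF assms(2)] in \<open>simp add: topological_conjugacy_def\<close>)
qed

end
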